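(* Let $u_0:\mathbb R^d\to\mathbb R$ be nondecreasing (in the coordinatewise order) and locally Lipschitz, satisfying for every $b\in\mathbb R^d$ $$\lim_{M\to\infty}\sup\{|y|_\infty^{-d/(d+1)}u_0(y): y\le b,\ |y|_\infty\ge M\}=-\infty.$$ Suppose that on some probability space there are random initial height functions $\sigma_n(\cdot,0)$, $n\ge1$, each a.s. in $\Sigma$, such that (12) for every $y\in\mathbb R^d$, $n^{-1}\sigma_n(ny,0)\to u_0(y)$ a.s.; and (13) for every fixed $b\in\mathbb R^d$ and $C>0$, with probability one there exist finite (possibly random) $M,N>0$ such that $n\ge N$, $y\le b$, $|y|_\infty\ge M$ imply $\sigma_n(ny,0)\le -Cn|y|_\infty^{d/(d+1)}$. Augment the probability space with a rate-one Poisson point process on $\mathbb R^d\times(0,\infty)$ and define $\sigma_n(x,t)=\sup_{y\le x}\{\sigma_n(y,0)+\mathbf H((y,0),(x,t))\}$ for $t>0$ (the same Poisson process for all $n$). Define $u(x,0)=u_0(x)$ and, for $t>0$, $$u(x,t)=\sup_{y\le x}\{u_0(y)+t\,g((x-y)/t)\}.$$ Then for every $(x,t)\in\mathbb R^d\times[0,\infty)$, $\lim_{n\to\infty}n^{-1}\sigma_n(nx,nt)=u(x,t)$ almost surely.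
   Context: Order conventions: for $x,y\in\mathbb R^\nu$ write $x\le y$ if $x_i\le y_i$ for all $i$, and $x<y$ if $x_i<y_i$ for all $i$; rectangles are $(a,b]=\{x:a<x\le b\}$, etc.; $\mathbf 1=(1,\dots,1)$; $|x|_\infty=\max_i|x_i|$. Fix $d\ge2$. $\mathbb Z^*=\mathbb Z\cup\{\pm\infty\}$. The state space $\Sigma$ is the set of functions $\sigma:\mathbb R^d\to\mathbb Z^*$ such that (i) $x\le y$ implies $\sigma(x)\le\sigma(y)$; (ii) for every cube $[-q\mathbf 1,q\mathbf 1]$ there are finite partitions $-q=s_i^0<\dots<s_i^{m_i}=q$ of each coordinate axis such that $\sigma$ is constant on each rectangle $\prod_{i}[s_i^{k_i},s_i^{k_i+1})$; (iii) for every $b\in\mathbb R^d$, $\lim_{M\to\infty}\sup\{|y|_\infty^{-d/(d+1)}\sigma(y): y\le b,\ |y|_\infty\ge M\}=-\infty$. For $y\le x$ in $\mathbb R^d$ and $t>0$, $\mathbf H((y,0),(x,t))$ is the maximal $m\ge0$ such that there are Poisson points $p^1<\dots<p^m$ (strict coordinatewise order in $\mathbb R^{d+1}$) in $\{(\eta,s):y<\eta\le x,\ 0<s\le t\}$. $c_{d+1}$ denotes the constant such that, for a rate-one Poisson point process on $\mathbb R^{d+1}$, the maximal number of Poisson points on a strictly increasing chain in $(0,n\mathbf 1]$ divided by $n$ converges a.s. to $c_{d+1}$. For $x\in[0,\infty)^d$, $g(x)=c_{d+1}(x_1x_2\cdots x_d)^{1/(d+1)}$, and $g=-\infty$ outside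 $[0,\infty)^d$. *)

theory Defs
  imports "HOL-Analysis.Analysis" "HOL-Probability.Probability"
begin

text \<open>Coordinatewise orders: the library order on real^'d is coordinatewise for \<le>;
  strict coordinatewise order (all coordinates strict) is defined here.\<close>

definition vlt :: "real^'d \<Rightarrow> real^'d \<Rightarrow> bool" where
  "vlt x y \<longleftrightarrow> (\<forall>i. x$i < y$i)"

definition plt :: "(real^'d) \<times> real \<Rightarrow> (real^'d) \<times> real \<Rightarrow> bool" where
  "plt p q \<longleftrightarrow> vlt (fst p) (fst q) \<and> snd p < snd q"

definition supnorm :: "real^'d \<Rightarrow> real" where
  "supnorm x = Max (range (\<lambda>i. \<bar>x$i\<bar>))"

definition poisson_process ::
  "'a measure \<Rightarrow> ('a \<Rightarrow> 'b::euclidean_space set) \<Rightarrow> 'b set \<Rightarrow> bool" where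
  "poisson_process M N D \<longleftrightarrow>
     prob_space M \<and>
     (\<forall>\<omega>\<in>space M. N \<omega> \<subseteq> D) \<and>
     (AE \<omega> in M. \<forall>B. bounded B \<longrightarrow> finite (N \<omega> \<inter> B)) \<and>
     (\<forall>(k::nat) (A::nat \<Rightarrow> 'b set).
        (\<forall>i<k. A i \<in> sets lborel \<and> bounded (A i) \<and> A i \<subseteq> D) \<and> disjoint_family_on A {..<k}
        \<longrightarrow> prob_space.indep_vars M (\<lambda>_. count_space UNIV)
               (\<lambda>i \<omega>. card (N \<omega> \<inter> A i)) {..<k}
          \<and> (\<forall>i<k. \<forall>m::nat. measure M {\<omega>\<in>space M. card (N \<omega> \<inter> A i) = m}
                 = measure lborel (A i) ^ m / fact m * exp (- measure lborel (A i))))"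

definition Hpath :: "((real^'d) \<times> real) set \<Rightarrow> real^'d \<Rightarrow> real^'d \<Rightarrow> real \<Rightarrow> nat" where
  "Hpath P y x t = Sup {m. \<exists>p::nat \<Rightarrow> (real^'d) \<times> real.
       (\<forall>k<m. p k \<in> P \<and> vlt y (fst (p k)) \<and> fst (p k) \<le> x \<and> 0 < snd (p k) \<and> snd (p k) \<le> t)
     \<and> (\<forall>k. Suc k < m \<longrightarrow> plt (p k) (p (Suc k)))}"

definition Sigma_space :: "(real^'d \<Rightarrow> ereal) set" where
  "Sigma_space = {\<sigma>.
     (\<forall>x. \<sigma> x \<in> range (\<lambda>k::int. ereal (of_int k)) \<union> {\<infinity>, -\<infinity>}) \<and>
     (\<forall>x y. x \<le> y \<longrightarrow> \<sigma> x \<le> \<sigma> y) \<and>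
     (\<forall>q::real. q > 0 \<longrightarrow> (\<exists>S :: 'd \<Rightarrow> real set.
        (\<forall>i. finite (S i) \<and> -q \<in> S i \<and> q \<in> S i \<and> S i \<subseteq> {-q..q}) \<and>
        (\<forall>x y. (\<forall>i. -q \<le> x$i \<and> x$i < q \<and> -q \<le> y$i \<and> y$i < q \<and>
                    (\<forall>s\<in>S i. s \<le> x$i \<longleftrightarrow> s \<le> y$i)) \<longrightarrow> \<sigma> x = \<sigma> y))) \<and>
     (\<forall>b::real^'d. ((\<lambda>M::real. Sup {ereal (supnorm y powr (- real CARD('d) / (real CARD('d) + 1))) * \<sigma> y
                       | y. y \<le> b \<and> supnorm y \<ge> M}) \<longlongrightarrow> -\<infinity>) at_top)}"

definition gfun :: "real \<Rightarrow> real^'d \<Rightarrow> ereal" where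
  "gfun c x = (if \<forall>i. 0 \<le> x$i
               then ereal (c * (\<Prod>i\<in>UNIV. x$i) powr (1 / (real CARD('d) + 1)))
               else -\<infinity>)"

definition ufun :: "real \<Rightarrow> (real^'d \<Rightarrow> real) \<Rightarrow> real^'d \<Rightarrow> real \<Rightarrow> ereal" where
  "ufun c u0 x t = (if t = 0 then ereal (u0 x)
     else Sup {ereal (u0 y) + ereal t * gfun c ((1 / t) *\<^sub>R (x - y)) | y. y \<le> x})"

definition evolve :: "(real^'d \<Rightarrow> ereal) \<Rightarrow> ((real^'d) \<times> real) set \<Rightarrow> real^'d \<Rightarrow> real \<Rightarrow> ereal" where
  "evolve \<sigma>0 P x t = (if t = 0 then \<sigma>0 x
     else Sup {\<sigma>0 y + ereal (real (Hpath P y x t)) | y. y \<le> x})"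

end

theory Submission
  imports Defs
begin

text \<open>
  Let \<open>L(B)\<close> be the length of the longest chain of Poisson points in a box \<open>B\<close>. Cutting \<open>B\<close>
  into finer and finer grids shows that the law of \<open>L(B)\<close> depends only on the volume of \<open>B\<close>, that
  \<open>L\<close> is independent on disjoint boxes, and, by counting chains of grid cells, that
  \<open>P(L(B) \<ge> m) \<le> vol(B)^m / (m!)^(d+1)\<close>.

  The convergence defining \<open>c\<close> only concerns cubes at the origin; its extension to the boxes
  \<open>n B\<close> needs tail bounds. The lower tail is exponentially small because \<open>L\<close> is superadditive along
  independent diagonal blocks. The upper tail is summable along geometric sequences: this is the converse
  Borel--Cantelli lemma applied to disjoint boxes between consecutive cubes. Since \<open>L\<close> is monotone,
  geometric sequences suffice, and \<open>L(n B) / n\<close> tends to \<open>c vol(B)^(1/(d+1))\<close> almost surely.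

  The lower bound in the theorem is then immediate along a countable set of starting points \<open>y\<close>
  realising the supremum. For the upper bound, the chain-counting bound together with the decay of the initial
  heights removes the points \<open>y\<close> far away, and monotonicity of heights and chains reduces the others to
  a finite grid.
\<close>

section \<open>Chains, boxes and grids\<close>

text \<open>The sets \<open>lis < m\<close> need not be measurable, and the process is given only
  through the joint law of its counts in disjoint bounded Borel sets. Every probability is therefore
  computed for events decided by which cells of dyadic grids are occupied; they agree with
  statements about \<open>lis\<close> almost surely, on locally finite configurations.

  Equality of laws carries convergence in probability from cubes at the origin to other boxes, but
  not almost sure convergence, so rates are needed. Concatenating chains in diagonal blocks
  amplifies a small lower tail. It has no counterpart for the upper tail, because a long chain need
  not split along blocks fixed in advance. There the almost sure hypothesis itself must be
  exploited, on infinitely many independent boxes. This gives summability only for geometric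
  sequences of large ratio, whereas interpolation between scales needs a ratio near one; splitting
  the exponents into residue classes reconciles the two.\<close>

definition chain_in :: "('x \<Rightarrow> 'x \<Rightarrow> bool) \<Rightarrow> 'x set \<Rightarrow> nat \<Rightarrow> bool" where
  "chain_in R S m \<longleftrightarrow> (\<exists>p. (\<forall>k<m. p k \<in> S) \<and> (\<forall>k. Suc k < m \<longrightarrow> R (p k) (p (Suc k))))"

lemma chain_in_0: "chain_in R S 0"
  by (auto simp: chain_in_def)

lemma chain_in_mono: "chain_in R S m \<Longrightarrow> S \<subseteq> T \<Longrightarrow> chain_in R T m"
  unfolding chain_in_def by blast

lemma chain_in_le: "chain_in R S m \<Longrightarrow> k \<le> m \<Longrightarrow> chain_in R S k"
  unfolding chain_in_def by (meson less_le_trans)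

text \<open>The relation is a parameter so that chains can be carried between points and grid
  indices in both directions.\<close>

lemma chain_in_map:
  assumes "chain_in R S m" "\<And>x. x \<in> S \<Longrightarrow> f x \<in> T"
    "\<And>x y. x \<in> S \<Longrightarrow> y \<in> S \<Longrightarrow> R x y \<Longrightarrow> R' (f x) (f y)"
  shows "chain_in R' T m"
proof -
  obtain p where p: "\<And>k. k < m \<Longrightarrow> p k \<in> S" "\<And>k. Suc k < m \<Longrightarrow> R (p k) (p (Suc k))"
    using assms(1) unfolding chain_in_def by blast
  show ?thesis
    unfolding chain_in_def
    by (rule exI[of _ "\<lambda>k. f (p k)"]) (auto intro!: assms p)
qed

lemma chain_in_append:
  assumes "chain_in R A m" "chain_in R B n" "\<And>x y. x \<in> A \<Longrightarrow> y \<in> B \<Longrightarrow> R x y"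
  shows "chain_in R (A \<union> B) (m + n)"
proof -
  obtain p where p: "\<And>k. k < m \<Longrightarrow> p k \<in> A" "\<And>k. Suc k < m \<Longrightarrow> R (p k) (p (Suc k))"
    using assms(1) unfolding chain_in_def by blast
  obtain q where q: "\<And>k. k < n \<Longrightarrow> q k \<in> B" "\<And>k. Suc k < n \<Longrightarrow> R (q k) (q (Suc k))"
    using assms(2) unfolding chain_in_def by blast
  define r where "r k = (if k < m then p k else q (k - m))" for k
  have "r k \<in> A \<union> B" if "k < m + n" for k
    using that p(1)[of k] q(1)[of "k - m"] by (auto simp: r_def)
  moreover have "R (r k) (r (Suc k))" if k: "Suc k < m + n" for k
  proof -
    consider "Suc k < m" | "Suc k = m" | "m \<le> k" by linarith
    then show ?thesis
    proof cases
      case 1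
      then show ?thesis using p(2)[of k] by (simp add: r_def)
    next
      case 2
      then show ?thesis using p(1)[of k] q(1)[of 0] assms(3) k by (auto simp: r_def)
    next
      case 3
      then show ?thesis using q(2)[of "k - m"] k by (simp add: r_def Suc_diff_le)
    qed
  qed
  ultimately show ?thesis unfolding chain_in_def by blast
qed

text \<open>This is the source of superadditivity: chains in blocks that are ordered among
  themselves can be concatenated.\<close>

lemma chain_in_UN:
  fixes L :: nat
  assumes "\<And>i. i < L \<Longrightarrow> chain_in R (A i) (g i)"
    and "\<And>i j x y. i < j \<Longrightarrow> j < L \<Longrightarrow> x \<in> A i \<Longrightarrow> y \<in> A j \<Longrightarrow> R x y"
  shows "chain_in R (\<Union>i<L. A i) (\<Sum>i<L. g i)"
  using assms
proof (induction L)
  case 0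
  then show ?case by (simp add: chain_in_0)
next
  case (Suc L)
  have "chain_in R ((\<Union>i<L. A i) \<union> A L) ((\<Sum>i<L. g i) + g L)"
    by (rule chain_in_append) (use Suc in auto)
  then show ?case by (simp add: lessThan_Suc Un_commute add.commute)
qed

lemma chain_in_less:
  assumes "transp R" "\<And>k. Suc k < m \<Longrightarrow> R (p k) (p (Suc k))" "i < j" "j < m"
  shows "R (p i) (p j)"
  using assms(3,4)
proof (induction j)
  case (Suc j)
  show ?case
  proof (cases "i = j")
    case True
    then show ?thesis using assms(2) Suc by auto
  next
    case False
    then have "R (p i) (p j)" using Suc by auto
    then show ?thesis using assms(1,2) Suc.prems by (meson transpD)
  qed
qed simp

lemma chain_in_le_card:
  assumes "transp R" "\<And>x. \<not> R x x" "finite S" "chain_in R S m"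
  shows "m \<le> card S"
proof -
  obtain p where p: "\<And>k. k < m \<Longrightarrow> p k \<in> S" "\<And>k. Suc k < m \<Longrightarrow> R (p k) (p (Suc k))"
    using assms(4) unfolding chain_in_def by blast
  have "inj_on p {..<m}"
  proof (rule linorder_inj_onI)
    fix i j assume "i < j" "i \<in> {..<m}" "j \<in> {..<m}"
    then have "R (p i) (p j)" using chain_in_less[OF assms(1), of m p i j] p by auto
    then show "p i \<noteq> p j" using assms(2) by metis
  qed auto
  then have "card {..<m} \<le> card S"
    by (rule card_inj_on_le) (use p assms in auto)
  then show ?thesis by simp
qed

section \<open>Longest chains in half-open boxes of a Euclidean space\<close>

definition slt :: "'b::euclidean_space \<Rightarrow> 'b \<Rightarrow> bool" where
  "slt p q \<longleftrightarrow> (\<forall>i\<in>Basis. p \<bullet> i < q \<bullet> i)"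

definition hbox :: "'b::euclidean_space \<Rightarrow> 'b \<Rightarrow> 'b set" where
  "hbox a b = {z. \<forall>i\<in>Basis. a \<bullet> i < z \<bullet> i \<and> z \<bullet> i \<le> b \<bullet> i}"

text \<open>On \<open>nat\<close> the supremum of an unbounded set carries no information; the
  comparison lemmas below therefore assume finiteness of the point set.\<close>

definition lis :: "'b::euclidean_space set \<Rightarrow> nat" where
  "lis S = Sup {m. chain_in slt S m}"

lemma slt_trans: "transp slt"
  by (rule transpI) (fastforce simp: slt_def intro: less_trans)

lemma slt_irrefl: "\<not> slt x x"
  by (auto simp: slt_def)

lemma le_lis_iff:
  fixes S :: "'b::euclidean_space set"
  assumes "finite S"
  shows "m \<le> lis S \<longleftrightarrow> chain_in slt S m"
proof -
  let ?X = "{m. chain_in slt S m}"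
  have sub: "?X \<subseteq> {..card S}"
    using chain_in_le_card[OF slt_trans slt_irrefl assms] by blast
  then have fin: "finite ?X" by (rule finite_subset) simp
  have ne: "?X \<noteq> {}" using chain_in_0 by blast
  have L: "lis S = Max ?X" using ne unfolding lis_def Sup_nat_def by presburger
  have "chain_in slt S (lis S)" using Max_in[OF fin ne] L by simp
  then show ?thesis using Max_ge[OF fin] L chain_in_le by (metis mem_Collect_eq)
qed

lemma lis_less_iff: "finite S \<Longrightarrow> lis S < m \<longleftrightarrow> \<not> chain_in slt S m"
  using le_lis_iff[of S m] by auto

lemma lis_mono:
  assumes "finite T" "S \<subseteq> T"
  shows "lis S \<le> lis T"
  using assms le_lis_iff[of S "lis S"] le_lis_iff[of T "lis S"] chain_in_mono finite_subset by blast

lemma hbox_mono: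
  assumes "\<And>i. i \<in> Basis \<Longrightarrow> a' \<bullet> i \<le> a \<bullet> i" "\<And>i. i \<in> Basis \<Longrightarrow> b \<bullet> i \<le> b' \<bullet> i"
  shows "hbox a b \<subseteq> hbox a' b'"
  using assms unfolding hbox_def by (force intro: le_less_trans order_trans)

lemma hbox_subset_cbox: "hbox a b \<subseteq> cbox a b"
  unfolding hbox_def cbox_def by (blast intro: less_imp_le)

lemma bounded_hbox: "bounded (hbox a b)"
  using hbox_subset_cbox bounded_cbox bounded_subset by blast

lemma sets_hbox: "hbox a b \<in> sets borel"
  unfolding hbox_def by measurable

lemma measure_hbox:
  fixes a b :: "'b::euclidean_space"
  assumes "\<And>i. i \<in> Basis \<Longrightarrow> a \<bullet> i \<le> b \<bullet> i"
  shows "measure lborel (hbox a b) = (\<Prod>i\<in>Basis. b \<bullet> i - a \<bullet> i)"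
proof -
  have "box a b \<subseteq> hbox a b" by (auto simp: hbox_def box_def intro: less_imp_le)
  then have "emeasure lborel (box a b) \<le> emeasure lborel (hbox a b)"
    by (intro emeasure_mono) (auto simp: sets_hbox)
  moreover have "emeasure lborel (hbox a b) \<le> emeasure lborel (cbox a b)"
    by (intro emeasure_mono hbox_subset_cbox) auto
  ultimately have "emeasure lborel (hbox a b) = ennreal (\<Prod>i\<in>Basis. b \<bullet> i - a \<bullet> i)"
    using assms by (auto simp: emeasure_lborel_cbox_eq emeasure_lborel_box_eq inner_diff_left)
  then show ?thesis
    using assms by (simp add: measure_def prod_nonneg)
qed

section \<open>Approximating chains of points by chains of grid cells\<close>

definition grid :: "nat \<Rightarrow> ('b::euclidean_space \<Rightarrow> nat) set" where
  "grid N = PiE Basis (\<lambda>_. {..<N})"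

text \<open>The coordinates are rescaled so that the box becomes \<open>(0, N]\<close> in each
  direction; passing from \<open>N\<close> to \<open>2 * N\<close> just doubles both inequalities.
  Cells are open below and closed above, like \<open>hbox\<close>, so they partition the
  box.\<close>

definition cell :: "'b::euclidean_space \<Rightarrow> 'b \<Rightarrow> nat \<Rightarrow> ('b \<Rightarrow> nat) \<Rightarrow> 'b set" where
  "cell a b N k = {z. \<forall>i\<in>Basis. real (k i) < real N * ((z \<bullet> i - a \<bullet> i) / (b \<bullet> i - a \<bullet> i))
     \<and> real N * ((z \<bullet> i - a \<bullet> i) / (b \<bullet> i - a \<bullet> i)) \<le> real (k i) + 1}"

definition ilt :: "('b::euclidean_space \<Rightarrow> nat) \<Rightarrow> ('b \<Rightarrow> nat) \<Rightarrow> bool" where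
  "ilt k l \<longleftrightarrow> (\<forall>i\<in>Basis. k i < l i)"

text \<open>Occupation is expressed through \<open>card\<close> because the Poisson hypothesis
  speaks of nothing else. Since \<open>card\<close> of an infinite set is 0, an occupied cell
  contains finitely many points, at least one.\<close>

definition occ :: "'b::euclidean_space set \<Rightarrow> 'b \<Rightarrow> 'b \<Rightarrow> nat \<Rightarrow> ('b \<Rightarrow> nat) set" where
  "occ P a b N = {k \<in> grid N. card (P \<inter> cell a b N k) \<noteq> 0}"

text \<open>The ceiling minus one matches cells that are closed above. Restricting to
  \<open>Basis\<close> makes the index an element of the extensional function space
  \<open>grid N\<close>.\<close>

definition cell_index :: "'b::euclidean_space \<Rightarrow> 'b \<Rightarrow> nat \<Rightarrow> 'b \<Rightarrow> 'b \<Rightarrow> nat" where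
  "cell_index a b N z = restrict (\<lambda>i. nat (\<lceil>real N * ((z \<bullet> i - a \<bullet> i) / (b \<bullet> i - a \<bullet> i))\<rceil> - 1)) Basis"

lemma finite_grid: "finite (grid N :: ('b::euclidean_space \<Rightarrow> nat) set)"
  unfolding grid_def by (rule finite_PiE) auto

lemma cell_inj:
  assumes "z \<in> cell a b N k" "z \<in> cell a b N l" "k \<in> grid N" "l \<in> grid N"
  shows "k = l"
proof
  fix i show "k i = l i"
  proof (cases "i \<in> Basis")
    case True
    then have "real (k i) < real (l i) + 1" "real (l i) < real (k i) + 1"
      using assms(1,2) unfolding cell_def by force+
    then show ?thesis by linarith
  next
    case False
    then show ?thesis using assms(3,4) by (auto simp: grid_def PiE_def extensional_def)
  qed
qed

lemma disjoint_cells: "disjoint_family_on (cell a b N) (grid N)"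
  unfolding disjoint_family_on_def using cell_inj by blast

lemma nat_ceiling_minus_1:
  fixes w :: real
  assumes "0 < w" "w \<le> real N"
  shows "real (nat (\<lceil>w\<rceil> - 1)) < w" "w \<le> real (nat (\<lceil>w\<rceil> - 1)) + 1" "nat (\<lceil>w\<rceil> - 1) < N"
proof -
  have c: "\<lceil>w\<rceil> \<ge> 1" "\<lceil>w\<rceil> \<le> int N" using assms by linarith+
  then have e: "real (nat (\<lceil>w\<rceil> - 1)) = of_int \<lceil>w\<rceil> - 1" by simp
  show "real (nat (\<lceil>w\<rceil> - 1)) < w" "w \<le> real (nat (\<lceil>w\<rceil> - 1)) + 1"
    unfolding e by linarith+
  show "nat (\<lceil>w\<rceil> - 1) < N" using c by linarith
qed

lemma cell_index:
  assumes "slt a b" "z \<in> hbox a b" "N > 0"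
  shows "z \<in> cell a b N (cell_index a b N z)" "cell_index a b N z \<in> grid N"
proof -
  have w: "0 < real N * ((z \<bullet> i - a \<bullet> i) / (b \<bullet> i - a \<bullet> i))"
    "real N * ((z \<bullet> i - a \<bullet> i) / (b \<bullet> i - a \<bullet> i)) \<le> real N" if "i \<in> Basis" for i
  proof -
    have "a \<bullet> i < b \<bullet> i" "a \<bullet> i < z \<bullet> i" "z \<bullet> i \<le> b \<bullet> i" using assms that by (auto simp: slt_def hbox_def)
    then have "0 < (z \<bullet> i - a \<bullet> i) / (b \<bullet> i - a \<bullet> i)" "(z \<bullet> i - a \<bullet> i) / (b \<bullet> i - a \<bullet> i) \<le> 1" by auto
    then show "0 < real N * ((z \<bullet> i - a \<bullet> i) / (b \<bullet> i - a \<bullet> i))"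
      "real N * ((z \<bullet> i - a \<bullet> i) / (b \<bullet> i - a \<bullet> i)) \<le> real N"
      using assms(3) mult_left_le[of "(z \<bullet> i - a \<bullet> i) / (b \<bullet> i - a \<bullet> i)" "real N"]
      by (simp_all only: of_nat_0_less_iff mult_pos_pos of_nat_0_le_iff)
  qed
  show "z \<in> cell a b N (cell_index a b N z)"
    using nat_ceiling_minus_1(1,2)[OF w] by (auto simp: cell_def cell_index_def)
  show "cell_index a b N z \<in> grid N"
    using nat_ceiling_minus_1(3)[OF w] by (auto simp: grid_def cell_index_def)
qed

lemma cell_eq_hbox:
  assumes "slt a b" "N > 0"
  shows "cell a b N k = hbox (\<Sum>i\<in>Basis. (a \<bullet> i + real (k i) * ((b \<bullet> i - a \<bullet> i) / real N)) *\<^sub>R i)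
    (\<Sum>i\<in>Basis. (a \<bullet> i + (real (k i) + 1) * ((b \<bullet> i - a \<bullet> i) / real N)) *\<^sub>R i)"
proof -
  have "(real (k i) < real N * ((z \<bullet> i - a \<bullet> i) / (b \<bullet> i - a \<bullet> i)) \<longleftrightarrow>
      a \<bullet> i + real (k i) * ((b \<bullet> i - a \<bullet> i) / real N) < z \<bullet> i) \<and>
      (real N * ((z \<bullet> i - a \<bullet> i) / (b \<bullet> i - a \<bullet> i)) \<le> real (k i) + 1 \<longleftrightarrow>
      z \<bullet> i \<le> a \<bullet> i + (real (k i) + 1) * ((b \<bullet> i - a \<bullet> i) / real N))" if "i \<in> Basis" for i z
  proof -
    have "b \<bullet> i - a \<bullet> i > 0" using assms that by (auto simp: slt_def)
    then show ?thesis using assms(2) by (auto simp: field_simps)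
  qed
  then show ?thesis
    unfolding cell_def hbox_def by (intro Collect_cong ball_cong) auto
qed

lemma sets_cell: "cell a b N k \<in> sets borel"
  unfolding cell_def by measurable

lemma cell_subset_hbox:
  assumes "slt a b" "N > 0" "k \<in> grid N"
  shows "cell a b N k \<subseteq> hbox a b"
proof
  fix z assume z: "z \<in> cell a b N k"
  have "a \<bullet> i < z \<bullet> i \<and> z \<bullet> i \<le> b \<bullet> i" if i: "i \<in> Basis" for i
  proof -
    have ab: "b \<bullet> i - a \<bullet> i > 0" using assms i by (auto simp: slt_def)
    let ?w = "(z \<bullet> i - a \<bullet> i) / (b \<bullet> i - a \<bullet> i)"
    have "k i < N" using assms i by (auto simp: grid_def)
    moreover have "real (k i) < real N * ?w" "real N * ?w \<le> real (k i) + 1" using z i by (auto simp: cell_def)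
    ultimately have "0 < real N * ?w" "real N * ?w \<le> real N * 1" by linarith+
    then have "0 < ?w" "?w \<le> 1" using assms(2) mult_le_cancel_left_pos[of "real N" ?w 1]
      by (metis of_nat_0_less_iff zero_less_mult_pos, simp)
    then show ?thesis using ab by (auto simp: field_simps zero_less_divide_iff)
  qed
  then show "z \<in> hbox a b" by (auto simp: hbox_def)
qed

lemma measure_cell:
  fixes a b :: "'b::euclidean_space"
  assumes "slt a b" "N > 0"
  shows "measure lborel (cell a b N k) = (\<Prod>i\<in>Basis. b \<bullet> i - a \<bullet> i) / real N ^ DIM('b)"
proof -
  have "0 \<le> (b \<bullet> i - a \<bullet> i) / real N" if "i \<in> Basis" for i
    using assms that by (auto simp: slt_def less_imp_le)
  then have "measure lborel (cell a b N k) = (\<Prod>i\<in>Basis. (b \<bullet> i - a \<bullet> i) / real N)"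
    unfolding cell_eq_hbox[OF assms]
    by (subst measure_hbox) (auto simp: distrib_right simp del: times_divide_eq_right times_divide_eq_left intro!: prod.cong)
  then show ?thesis by (simp add: prod_dividef)
qed

text \<open>Pick a point in each occupied cell and pass to the subcell that contains it. Its index
  in each coordinate is \<open>2 * k i\<close> or \<open>2 * k i + 1\<close>, and
  \<open>k i < l i\<close> gives \<open>2 * k i + 1 < 2 * l i\<close>, so strict order survives.
  This is what makes the grid events monotone under dyadic refinement.\<close>

lemma occ_refine:
  assumes ab: "slt a b" "N > 0" and ch: "chain_in ilt (occ P a b N) m"
  shows "chain_in ilt (occ P a b (2 * N)) m"
proof -
  define f where "f k = cell_index a b (2 * N) (SOME z. z \<in> P \<inter> cell a b N k)" for k
  have f: "f k \<in> occ P a b (2 * N) \<and> (\<forall>i\<in>Basis. f k i = 2 * k i \<or> f k i = 2 * k i + 1)"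
    if k: "k \<in> occ P a b N" for k
  proof -
    define z where "z = (SOME z. z \<in> P \<inter> cell a b N k)"
    have kg: "k \<in> grid N" and fin: "finite (P \<inter> cell a b N k)" and ne: "P \<inter> cell a b N k \<noteq> {}"
      using k by (auto simp: occ_def intro: card_ge_0_finite)
    have z: "z \<in> P \<inter> cell a b N k"
      unfolding z_def using ne by (metis some_in_eq)
    then have zh: "z \<in> hbox a b" using cell_subset_hbox[OF ab kg] by auto
    have fk: "f k = cell_index a b (2 * N) z" by (simp add: f_def z_def)
    have zf: "z \<in> cell a b (2 * N) (f k)" "f k \<in> grid (2 * N)"
      unfolding fk using cell_index[OF ab(1) zh, of "2 * N"] ab(2) by auto
    have fi: "f k i = 2 * k i \<or> f k i = 2 * k i + 1" if i: "i \<in> Basis" for i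
    proof -
      have "real (k i) < real N * ((z \<bullet> i - a \<bullet> i) / (b \<bullet> i - a \<bullet> i))"
        "real N * ((z \<bullet> i - a \<bullet> i) / (b \<bullet> i - a \<bullet> i)) \<le> real (k i) + 1"
        using z i by (auto simp: cell_def)
      moreover have "real (f k i) < 2 * (real N * ((z \<bullet> i - a \<bullet> i) / (b \<bullet> i - a \<bullet> i)))"
        "2 * (real N * ((z \<bullet> i - a \<bullet> i) / (b \<bullet> i - a \<bullet> i))) \<le> real (f k i) + 1"
        using zf(1) i by (auto simp: cell_def)
      ultimately have "real (f k i) < 2 * real (k i) + 2" "2 * real (k i) < real (f k i) + 1" by linarith+
      then show ?thesis by linarith
    qed
    have "cell a b (2 * N) (f k) \<subseteq> cell a b N k"
    proof
      fix y assume y: "y \<in> cell a b (2 * N) (f k)"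
      have "real (k i) < real N * ((y \<bullet> i - a \<bullet> i) / (b \<bullet> i - a \<bullet> i)) \<and>
        real N * ((y \<bullet> i - a \<bullet> i) / (b \<bullet> i - a \<bullet> i)) \<le> real (k i) + 1" if i: "i \<in> Basis" for i
      proof -
        have "real (f k i) < 2 * (real N * ((y \<bullet> i - a \<bullet> i) / (b \<bullet> i - a \<bullet> i)))"
          "2 * (real N * ((y \<bullet> i - a \<bullet> i) / (b \<bullet> i - a \<bullet> i))) \<le> real (f k i) + 1"
          using y i by (auto simp: cell_def)
        then show ?thesis using fi[OF i] by auto
      qed
      then show "y \<in> cell a b N k" by (auto simp: cell_def)
    qed
    then have "finite (P \<inter> cell a b (2 * N) (f k))"
      using fin by (meson Int_mono finite_subset order_refl)
    then show ?thesis using z zf fi by (auto simp: occ_def card_gt_0_iff)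
  qed
  show ?thesis
  proof (rule chain_in_map[OF ch, of f])
    fix k l assume "k \<in> occ P a b N" "l \<in> occ P a b N" "ilt k l"
    then show "ilt (f k) (f l)" using f[of k] f[of l] unfolding ilt_def by fastforce
  qed (use f in auto)
qed

text \<open>A finite configuration has only finitely many strictly ordered pairs, and a fine enough
  grid separates all of them at once. Conversely, points in cells with strictly increasing indices
  are strictly ordered, whatever the grid.\<close>

lemma chain_iff_occ:
  fixes a b :: "'b::euclidean_space"
  assumes ab: "slt a b" and fin: "finite (P \<inter> hbox a b)"
  shows "chain_in slt (P \<inter> hbox a b) m \<longleftrightarrow> (\<exists>n. chain_in ilt (occ P a b (2 ^ n)) m)"
proof
  assume ch: "chain_in slt (P \<inter> hbox a b) m"
  let ?S = "P \<inter> hbox a b"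
  have ev: "\<forall>\<^sub>F n in sequentially. slt x y \<longrightarrow> ilt (cell_index a b (2 ^ n) x) (cell_index a b (2 ^ n) y)"
    if xy: "x \<in> ?S" "y \<in> ?S" for x y
  proof (cases "slt x y")
    \<comment> \<open>Once the gap between the two points is at least one cell width in every
      coordinate, the cell indices are strictly ordered; powers of 2 eventually achieve
      this.\<close>
    case True
    have "\<forall>\<^sub>F n in sequentially. \<forall>i\<in>Basis. 1 \<le> 2 ^ n * ((y \<bullet> i - x \<bullet> i) / (b \<bullet> i - a \<bullet> i))"
    proof (rule eventually_ball_finite)
      show "\<forall>i\<in>Basis. \<forall>\<^sub>F n in sequentially. 1 \<le> 2 ^ n * ((y \<bullet> i - x \<bullet> i) / (b \<bullet> i - a \<bullet> i))"
      proof
        fix i :: 'b assume i: "i \<in> Basis"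
        then have "(y \<bullet> i - x \<bullet> i) / (b \<bullet> i - a \<bullet> i) > 0" using True ab by (auto simp: slt_def)
        moreover have "filterlim (\<lambda>n::nat. (2::real) ^ n) at_top sequentially"
          using filterlim_at_infinity_imp_filterlim_at_top[OF filterlim_realpow_sequentially_gt1[of 2]] by simp
        ultimately have "filterlim (\<lambda>n. 2 ^ n * ((y \<bullet> i - x \<bullet> i) / (b \<bullet> i - a \<bullet> i))) at_top sequentially"
          by (intro filterlim_at_top_mult_tendsto_pos[OF tendsto_const])
        then show "\<forall>\<^sub>F n in sequentially. 1 \<le> 2 ^ n * ((y \<bullet> i - x \<bullet> i) / (b \<bullet> i - a \<bullet> i))"
          by (simp add: filterlim_at_top)
      qed
    qed simp
    then show ?thesis
    proof (rule eventually_mono, intro impI)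
      fix n :: nat
      assume gap: "\<forall>i\<in>Basis. 1 \<le> 2 ^ n * ((y \<bullet> i - x \<bullet> i) / (b \<bullet> i - a \<bullet> i))"
      show "ilt (cell_index a b (2 ^ n) x) (cell_index a b (2 ^ n) y)"
        unfolding ilt_def
      proof
        fix i :: 'b assume i: "i \<in> Basis"
        have "x \<in> cell a b (2 ^ n) (cell_index a b (2 ^ n) x)" "y \<in> cell a b (2 ^ n) (cell_index a b (2 ^ n) y)"
          using xy by (auto intro!: cell_index ab)
        then have "real (cell_index a b (2 ^ n) x i) < 2 ^ n * ((x \<bullet> i - a \<bullet> i) / (b \<bullet> i - a \<bullet> i))"
          "2 ^ n * ((y \<bullet> i - a \<bullet> i) / (b \<bullet> i - a \<bullet> i)) \<le> real (cell_index a b (2 ^ n) y i) + 1"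
          using i by (auto simp: cell_def)
        moreover have "2 ^ n * ((y \<bullet> i - a \<bullet> i) / (b \<bullet> i - a \<bullet> i)) = 2 ^ n * ((x \<bullet> i - a \<bullet> i) / (b \<bullet> i - a \<bullet> i))
            + 2 ^ n * ((y \<bullet> i - x \<bullet> i) / (b \<bullet> i - a \<bullet> i))"
          by (simp add: add_divide_distrib[symmetric] distrib_left[symmetric])
        ultimately have "real (cell_index a b (2 ^ n) x i) < real (cell_index a b (2 ^ n) y i)"
          using bspec[OF gap i] by linarith
        then show "cell_index a b (2 ^ n) x i < cell_index a b (2 ^ n) y i" by simp
      qed
    qed
  qed simp
  have "\<forall>\<^sub>F n in sequentially. \<forall>x\<in>?S. \<forall>y\<in>?S. slt x y \<longrightarrow> ilt (cell_index a b (2 ^ n) x) (cell_index a b (2 ^ n) y)"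
    by (intro eventually_ball_finite fin ballI ev)
  then obtain n where n: "\<forall>x\<in>?S. \<forall>y\<in>?S. slt x y \<longrightarrow> ilt (cell_index a b (2 ^ n) x) (cell_index a b (2 ^ n) y)"
    using eventually_happens'[OF sequentially_bot] by blast
  have "chain_in ilt (occ P a b (2 ^ n)) m"
  proof (rule chain_in_map[OF ch])
    fix x assume x: "x \<in> ?S"
    then have c: "x \<in> cell a b (2 ^ n) (cell_index a b (2 ^ n) x)" "cell_index a b (2 ^ n) x \<in> grid (2 ^ n)"
      using cell_index[OF ab] by auto
    then have "P \<inter> cell a b (2 ^ n) (cell_index a b (2 ^ n) x) \<subseteq> P \<inter> hbox a b"
      using cell_subset_hbox[OF ab _ c(2)] by auto
    then have "finite (P \<inter> cell a b (2 ^ n) (cell_index a b (2 ^ n) x))" using fin finite_subset by blast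
    then show "cell_index a b (2 ^ n) x \<in> occ P a b (2 ^ n)"
      using x c by (auto simp: occ_def card_gt_0_iff)
  qed (use n in auto)
  then show "\<exists>n. chain_in ilt (occ P a b (2 ^ n)) m" ..
next
  assume "\<exists>n. chain_in ilt (occ P a b (2 ^ n)) m"
  then obtain n where ch: "chain_in ilt (occ P a b (2 ^ n)) m" ..
  define f where "f k = (SOME z. z \<in> P \<inter> cell a b (2 ^ n) k)" for k
  have f: "f k \<in> P \<inter> cell a b (2 ^ n) k" "k \<in> grid (2 ^ n)" if "k \<in> occ P a b (2 ^ n)" for k
  proof -
    have "P \<inter> cell a b (2 ^ n) k \<noteq> {}" using that by (auto simp: occ_def)
    then show "f k \<in> P \<inter> cell a b (2 ^ n) k" unfolding f_def by (metis some_in_eq)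
    show "k \<in> grid (2 ^ n)" using that by (auto simp: occ_def)
  qed
  show "chain_in slt (P \<inter> hbox a b) m"
  proof (rule chain_in_map[OF ch, of f])
    fix k assume "k \<in> occ P a b (2 ^ n)"
    then show "f k \<in> P \<inter> hbox a b" using f[of k] cell_subset_hbox[OF ab, of "2 ^ n" k] by auto
  next
    fix k l assume kl: "k \<in> occ P a b (2 ^ n)" "l \<in> occ P a b (2 ^ n)" "ilt k l"
    show "slt (f k) (f l)"
      unfolding slt_def
    proof
      fix i :: 'b assume i: "i \<in> Basis"
      have "2 ^ n * ((f k \<bullet> i - a \<bullet> i) / (b \<bullet> i - a \<bullet> i)) \<le> real (k i) + 1"
        "real (l i) < 2 ^ n * ((f l \<bullet> i - a \<bullet> i) / (b \<bullet> i - a \<bullet> i))"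
        using f(1)[OF kl(1)] f(1)[OF kl(2)] i by (auto simp: cell_def)
      \<comment> \<open>The upper face of cell \<open>k\<close> lies at or below the lower face of
        cell \<open>l\<close>, and the lower face is excluded from the cell; this makes the
        inequality between the points strict.\<close>
      moreover have "real (k i) + 1 \<le> real (l i)" using kl(3) i unfolding ilt_def by fastforce
      ultimately have "2 ^ n * ((f k \<bullet> i - a \<bullet> i) / (b \<bullet> i - a \<bullet> i)) < 2 ^ n * ((f l \<bullet> i - a \<bullet> i) / (b \<bullet> i - a \<bullet> i))"
        by linarith
      moreover have "b \<bullet> i - a \<bullet> i > 0" using ab i by (auto simp: slt_def)
      ultimately show "f k \<bullet> i < f l \<bullet> i" by (simp add: divide_less_cancel)
    qed
  qed
qed

section \<open>Longest chains of a Poisson process in a half-space\<close>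

text \<open>The Poisson hypothesis treats families indexed by \<open>{..<k}\<close>. Reindexing
  allows families indexed by cells, or by pairs of a box and a cell.\<close>

lemma (in prob_space) indep_vars_image:
  assumes inj: "inj_on f I" and ind: "indep_vars (\<lambda>i. M' (f i)) (\<lambda>i. X (f i)) I"
  shows "indep_vars M' X (f ` I)"
  unfolding indep_vars_def2 indep_sets_def
proof (intro conjI ballI allI impI)
  have I: "\<And>i. i \<in> I \<Longrightarrow> random_variable (M' (f i)) (X (f i))"
    and S: "indep_sets (\<lambda>i. {X (f i) -` A \<inter> space M |A. A \<in> sets (M' (f i))}) I"
    using ind unfolding indep_vars_def2 by auto
  show "random_variable (M' j) (X j)" if "j \<in> f ` I" for j using I that by auto
  show "{X j -` A \<inter> space M |A. A \<in> sets (M' j)} \<subseteq> events" if "j \<in> f ` I" for j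
    using I that measurable_sets by blast
  fix J A
  assume J: "J \<subseteq> f ` I" "J \<noteq> {}" "finite J" and A: "A \<in> (\<Pi> j\<in>J. {X j -` A \<inter> space M |A. A \<in> sets (M' j)})"
  define J' where "J' = {i\<in>I. f i \<in> J}"
  have J': "J = f ` J'" "J' \<subseteq> I" "J' \<noteq> {}" "inj_on f J'" using J inj by (auto simp: J'_def inj_on_def)
  then have fin: "finite J'" using J(3) finite_image_iff by blast
  have "prob (\<Inter>i\<in>J'. A (f i)) = (\<Prod>i\<in>J'. prob (A (f i)))"
    by (rule indep_setsD[OF S]) (use J' fin A in auto)
  then show "prob (\<Inter>j\<in>J. A j) = (\<Prod>j\<in>J. prob (A j))"
    using J' by (simp add: prod.reindex image_image)
qed

text \<open>The vector \<open>e\<close> is the time direction. A general Euclidean space keeps space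
  and time coordinates on an equal footing in all volume computations.\<close>

locale poisson_half_space = prob_space M for M :: "'a measure" +
  fixes P :: "'a \<Rightarrow> 'b::euclidean_space set" and e :: 'b
  assumes e: "e \<in> Basis" and ppp: "poisson_process M P {z. 0 < z \<bullet> e}"
begin

lemma AE_locally_finite: "AE \<omega> in M. \<forall>B. bounded B \<longrightarrow> finite (P \<omega> \<inter> B)"
  using ppp unfolding poisson_process_def by blast

text \<open>Of the Poisson law only the probability of an empty set is retained, since chains of
  cells depend on occupation alone.\<close>

lemma poisson_counts:
  fixes A :: "'k \<Rightarrow> 'b set"
  assumes K: "finite K" and A: "\<And>k. k \<in> K \<Longrightarrow> A k \<in> sets borel" "\<And>k. k \<in> K \<Longrightarrow> bounded (A k)"
    "\<And>k. k \<in> K \<Longrightarrow> A k \<subseteq> {z. 0 < z \<bullet> e}" and disj: "disjoint_family_on A K"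
  shows "indep_vars (\<lambda>_. count_space UNIV) (\<lambda>k \<omega>. card (P \<omega> \<inter> A k)) K"
    and "\<And>k. k \<in> K \<Longrightarrow> prob {\<omega>\<in>space M. card (P \<omega> \<inter> A k) = 0} = exp (- measure lborel (A k))"
proof -
  obtain f where f: "bij_betw f {..<card K} K"
    using ex_bij_betw_nat_finite[OF K] unfolding lessThan_atLeast0 by blast
  have fK: "\<And>i. i < card K \<Longrightarrow> f i \<in> K" and inj: "inj_on f {..<card K}" and img: "f ` {..<card K} = K"
    using f by (auto simp: bij_betw_def)
  have dis: "disjoint_family_on (\<lambda>i. A (f i)) {..<card K}"
    using disj fK inj unfolding disjoint_family_on_def inj_on_def by (metis lessThan_iff)
  from ppp have pp: "(\<forall>i<k. B i \<in> sets lborel \<and> bounded (B i) \<and> B i \<subseteq> {z. 0 < z \<bullet> e}) \<and> disjoint_family_on B {..<k}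
        \<longrightarrow> indep_vars (\<lambda>_. count_space UNIV) (\<lambda>i \<omega>. card (P \<omega> \<inter> B i)) {..<k}
          \<and> (\<forall>i<k. \<forall>m::nat. prob {\<omega>\<in>space M. card (P \<omega> \<inter> B i) = m}
                 = measure lborel (B i) ^ m / fact m * exp (- measure lborel (B i)))"
    for k :: nat and B :: "nat \<Rightarrow> 'b set"
    unfolding poisson_process_def by blast
  have *: "indep_vars (\<lambda>_. count_space UNIV) (\<lambda>i \<omega>. card (P \<omega> \<inter> A (f i))) {..<card K}"
    "\<forall>i<card K. \<forall>m::nat. prob {\<omega>\<in>space M. card (P \<omega> \<inter> A (f i)) = m}
                 = measure lborel (A (f i)) ^ m / fact m * exp (- measure lborel (A (f i)))"
    using pp[of "card K" "\<lambda>i. A (f i)"] A fK dis by auto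
  show "indep_vars (\<lambda>_. count_space UNIV) (\<lambda>k \<omega>. card (P \<omega> \<inter> A k)) K"
    using indep_vars_image[OF inj, of "\<lambda>_. count_space UNIV" "\<lambda>k \<omega>. card (P \<omega> \<inter> A k)"] *(1) img by simp
  fix k assume "k \<in> K"
  then obtain i where i: "i < card K" "k = f i" using img by auto
  then show "prob {\<omega>\<in>space M. card (P \<omega> \<inter> A k) = 0} = exp (- measure lborel (A k))"
    using *(2)[rule_format, OF i(1), of 0] by simp
qed

section \<open>Grid events, their independence and their dependence on the volume only\<close>

text \<open>The lower face may lie on the boundary of the half-space, because \<open>hbox\<close> is
  open below.\<close>

definition good_box :: "'b \<Rightarrow> 'b \<Rightarrow> bool" where
  "good_box a b \<longleftrightarrow> slt a b \<and> 0 \<le> a \<bullet> e"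

definition no_chain_at :: "nat \<Rightarrow> 'b \<Rightarrow> 'b \<Rightarrow> nat \<Rightarrow> 'a set" where
  "no_chain_at N a b m = {\<omega>\<in>space M. \<not> chain_in ilt (occ (P \<omega>) a b N) m}"

text \<open>A measurable substitute for the set where \<open>lis\<close> of the box is less than
  \<open>m\<close>: a countable intersection of events about finitely many counts each.\<close>

definition no_chain :: "'b \<Rightarrow> 'b \<Rightarrow> nat \<Rightarrow> 'a set" where
  "no_chain a b m = (\<Inter>n. no_chain_at (2 ^ n) a b m)"

lemma good_box_subset: "good_box a b \<Longrightarrow> hbox a b \<subseteq> {z. 0 < z \<bullet> e}"
  using e by (fastforce simp: good_box_def hbox_def)

lemma cell_facts:
  assumes "good_box a b" "N > 0" "k \<in> grid N"
  shows "cell a b N k \<in> sets borel" "bounded (cell a b N k)" "cell a b N k \<subseteq> {z. 0 < z \<bullet> e}"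
proof -
  have "cell a b N k \<subseteq> hbox a b" using assms by (intro cell_subset_hbox) (auto simp: good_box_def)
  then show "bounded (cell a b N k)" "cell a b N k \<subseteq> {z. 0 < z \<bullet> e}"
    using bounded_hbox bounded_subset good_box_subset[OF assms(1)] by blast+
qed (rule sets_cell)

lemma cells_indep:
  assumes "good_box a b" "N > 0"
  shows "indep_vars (\<lambda>_. count_space UNIV) (\<lambda>k \<omega>. card (P \<omega> \<inter> cell a b N k)) (grid N)"
    and "\<And>k. k \<in> grid N \<Longrightarrow> prob {\<omega>\<in>space M. card (P \<omega> \<inter> cell a b N k) = 0}
      = exp (- ((\<Prod>i\<in>Basis. b \<bullet> i - a \<bullet> i) / real N ^ DIM('b)))"
proof -
  note c = poisson_counts[OF finite_grid, of N "cell a b N", OF cell_facts[OF assms] disjoint_cells]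
  show "indep_vars (\<lambda>_. count_space UNIV) (\<lambda>k \<omega>. card (P \<omega> \<inter> cell a b N k)) (grid N)" using c(1) by simp
  show "prob {\<omega>\<in>space M. card (P \<omega> \<inter> cell a b N k) = 0}
      = exp (- ((\<Prod>i\<in>Basis. b \<bullet> i - a \<bullet> i) / real N ^ DIM('b)))" if "k \<in> grid N" for k
    using c(2)[OF _ _ _ that] measure_cell[of a b N k] assms by (simp add: good_box_def)
qed

lemma measurable_cell_count:
  assumes "good_box a b" "N > 0" "k \<in> grid N"
  shows "(\<lambda>\<omega>. card (P \<omega> \<inter> cell a b N k)) \<in> measurable M (count_space UNIV)"
  using cells_indep(1)[OF assms(1,2)] assms(3) unfolding indep_vars_def by blast

text \<open>Summing over the finitely many occupation patterns \<open>Q\<close> reduces both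
  measurability and probability of a grid event to the cell counts.\<close>

lemma not_chain_pattern:
  "\<not> chain_in ilt {k\<in>grid N. (c k :: nat) \<noteq> 0} m \<longleftrightarrow>
    (\<exists>Q\<in>{Q\<in>Pow (grid N). \<not> chain_in ilt Q m}. \<forall>k\<in>grid N. (c k \<noteq> 0) = (k \<in> Q))"
proof
  assume "\<not> chain_in ilt {k\<in>grid N. c k \<noteq> 0} m"
  then show "\<exists>Q\<in>{Q\<in>Pow (grid N). \<not> chain_in ilt Q m}. \<forall>k\<in>grid N. (c k \<noteq> 0) = (k \<in> Q)"
    by (intro bexI[of _ "{k\<in>grid N. c k \<noteq> 0}"]) auto
next
  assume "\<exists>Q\<in>{Q\<in>Pow (grid N). \<not> chain_in ilt Q m}. \<forall>k\<in>grid N. (c k \<noteq> 0) = (k \<in> Q)"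
  then obtain Q where Q: "Q \<subseteq> grid N" "\<not> chain_in ilt Q m" "\<forall>k\<in>grid N. (c k \<noteq> 0) = (k \<in> Q)" by auto
  then have "{k\<in>grid N. c k \<noteq> 0} = Q" by auto
  then show "\<not> chain_in ilt {k\<in>grid N. c k \<noteq> 0} m" using Q by simp
qed

lemma finite_patterns: "finite {Q\<in>Pow (grid N). \<not> chain_in ilt Q m}"
  by (rule finite_subset[of _ "Pow (grid N)"]) (auto simp: finite_grid)

lemma sets_no_chain_at:
  assumes "good_box a b" "N > 0"
  shows "no_chain_at N a b m \<in> events"
proof -
  note [measurable] = measurable_cell_count[OF assms]
  have ne: "grid N \<noteq> ({} :: ('b \<Rightarrow> nat) set)" using assms(2) by (auto simp: grid_def PiE_eq_empty_iff)
  have "no_chain_at N a b m = {\<omega>\<in>space M. \<exists>Q\<in>{Q\<in>Pow (grid N). \<not> chain_in ilt Q m}.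
      \<forall>k\<in>grid N. (card (P \<omega> \<inter> cell a b N k) \<noteq> 0) = (k \<in> Q)}"
    unfolding no_chain_at_def occ_def by (simp only: not_chain_pattern)
  also have "\<dots> \<in> events"
    by (intro sets.sets_Collect_finite_Ex[OF _ finite_patterns] sets.sets_Collect_finite_All'[OF _ finite_grid])
      (use ne in auto)
  finally show ?thesis .
qed

text \<open>All cells of all boxes form one disjoint family, hence have independent counts. Grouping
  them by box, each event is a Boolean function of the counts in its own group.\<close>

lemma no_chain_at_prod:
  assumes J: "finite J" and good: "\<And>j. j \<in> J \<Longrightarrow> good_box (a j) (b j)"
    and disj: "disjoint_family_on (\<lambda>j. hbox (a j) (b j)) J" and N: "N > 0"
  shows "prob {\<omega>\<in>space M. \<forall>j\<in>J. \<omega> \<in> no_chain_at N (a j) (b j) (m j)}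
    = (\<Prod>j\<in>J. prob (no_chain_at N (a j) (b j) (m j)))"
proof (cases "J = {}")
  case True
  then show ?thesis by (simp add: prob_space)
next
  case False
  define X where "X jk \<omega> = card (P \<omega> \<inter> cell (a (fst jk)) (b (fst jk)) N (snd jk))" for jk \<omega>
  define Y where "Y j f = (\<not> chain_in ilt {k\<in>(grid N :: ('b \<Rightarrow> nat) set). f (j, k) \<noteq> (0::nat)} (m j))" for j f
  have "indep_vars (\<lambda>_. count_space UNIV) X (J \<times> grid N)"
    unfolding X_def
  proof (rule poisson_counts)
    show "finite (J \<times> (grid N :: ('b \<Rightarrow> nat) set))" using J finite_grid by blast
    show "disjoint_family_on (\<lambda>jk. cell (a (fst jk)) (b (fst jk)) N (snd jk)) (J \<times> grid N)"
      unfolding disjoint_family_on_def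
    proof (intro ballI impI)
      fix p q assume pq: "p \<in> J \<times> (grid N :: ('b \<Rightarrow> nat) set)" "q \<in> J \<times> (grid N :: ('b \<Rightarrow> nat) set)" "p \<noteq> q"
      obtain j k where p: "p = (j, k)" "j \<in> J" "k \<in> grid N" using pq by auto
      obtain i l where q: "q = (i, l)" "i \<in> J" "l \<in> grid N" using pq by auto
      show "cell (a (fst p)) (b (fst p)) N (snd p) \<inter> cell (a (fst q)) (b (fst q)) N (snd q) = {}"
      proof (cases "i = j")
        case True
        then show ?thesis using p q pq cell_inj[of _ "a j" "b j" N k l] by auto
      next
        case False
        then have "hbox (a j) (b j) \<inter> hbox (a i) (b i) = {}" using disj p q unfolding disjoint_family_on_def by auto
        moreover have "cell (a j) (b j) N k \<subseteq> hbox (a j) (b j)" "cell (a i) (b i) N l \<subseteq> hbox (a i) (b i)"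
          using good[OF p(2)] good[OF q(2)] p q N by (intro cell_subset_hbox; simp add: good_box_def)+
        ultimately show ?thesis using p q by auto
      qed
    qed
  next
    fix jk assume "jk \<in> J \<times> (grid N :: ('b \<Rightarrow> nat) set)"
    then have "good_box (a (fst jk)) (b (fst jk))" "snd jk \<in> grid N" using good by auto
    from cell_facts[OF this(1) N this(2)]
    show "cell (a (fst jk)) (b (fst jk)) N (snd jk) \<in> sets borel"
      "bounded (cell (a (fst jk)) (b (fst jk)) N (snd jk))"
      "cell (a (fst jk)) (b (fst jk)) N (snd jk) \<subseteq> {z. 0 < z \<bullet> e}" .
  qed
  then have "indep_vars (\<lambda>j. PiM ({j} \<times> grid N) (\<lambda>_. count_space UNIV)) (\<lambda>j \<omega>. restrict (\<lambda>i. X i \<omega>) ({j} \<times> grid N)) J"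
    by (rule indep_vars_restrict) (auto simp: disjoint_family_on_def)
  then have ind: "indep_vars (\<lambda>_. count_space UNIV) (\<lambda>j \<omega>. Y j (restrict (\<lambda>i. X i \<omega>) ({j} \<times> grid N))) J"
  proof (rule indep_vars_compose2)
    fix j assume "j \<in> J"
    have Y: "Y j = (\<lambda>f. \<exists>Q\<in>{Q\<in>Pow (grid N). \<not> chain_in ilt Q (m j)}. \<forall>k\<in>grid N. (f (j, k) \<noteq> 0) = (k \<in> Q))"
      unfolding Y_def by (rule ext) (rule not_chain_pattern)
    have "Measurable.pred (PiM ({j} \<times> grid N) (\<lambda>_. count_space UNIV)) (\<lambda>f. (f (j, k) \<noteq> (0::nat)) = (k \<in> Q))"
      if "k \<in> grid N" for k :: "'b \<Rightarrow> nat" and Q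
    proof -
      have [measurable]: "(\<lambda>f. f (j, k)) \<in> measurable (PiM ({j} \<times> grid N) (\<lambda>_. count_space (UNIV :: nat set))) (count_space UNIV)"
        using measurable_component_singleton[of "(j,k)" "{j} \<times> grid N" "\<lambda>_. count_space (UNIV :: nat set)"] that by simp
      have "Measurable.pred (PiM ({j} \<times> grid N) (\<lambda>_. count_space UNIV)) (\<lambda>f. f (j, k) \<noteq> (0::nat))"
        "Measurable.pred (PiM ({j} \<times> grid N) (\<lambda>_. count_space UNIV)) (\<lambda>f. f (j, k) = (0::nat))"
        using that by measurable
      then show ?thesis by (cases "k \<in> Q") simp_all
    qed
    then show "Y j \<in> measurable (PiM ({j} \<times> grid N) (\<lambda>_. count_space UNIV)) (count_space UNIV)"
      unfolding Y by (intro pred_intros_finite finite_patterns finite_grid)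
  qed
  have YX: "(\<lambda>\<omega>. Y j (restrict (\<lambda>i. X i \<omega>) ({j} \<times> grid N))) -` {True} \<inter> space M
      = no_chain_at N (a j) (b j) (m j)" for j
  proof -
    have "{k \<in> grid N. restrict (\<lambda>i. X i \<omega>) ({j} \<times> grid N) (j, k) \<noteq> 0} = occ (P \<omega>) (a j) (b j) N" for \<omega>
      unfolding occ_def X_def by auto
    then show ?thesis unfolding Y_def no_chain_at_def by auto
  qed
  have "prob (\<Inter>j\<in>J. (\<lambda>\<omega>. Y j (restrict (\<lambda>i. X i \<omega>) ({j} \<times> grid N))) -` {True} \<inter> space M)
      = (\<Prod>j\<in>J. prob ((\<lambda>\<omega>. Y j (restrict (\<lambda>i. X i \<omega>) ({j} \<times> grid N))) -` {True} \<inter> space M))"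
    by (rule indep_varsD_finite[OF ind False J]) simp
  moreover have "(\<Inter>j\<in>J. no_chain_at N (a j) (b j) (m j)) = {\<omega>\<in>space M. \<forall>j\<in>J. \<omega> \<in> no_chain_at N (a j) (b j) (m j)}"
    using False by (auto simp: no_chain_at_def)
  ultimately show ?thesis unfolding YX by simp
qed

lemma prob_occupied:
  assumes "good_box a b" "N > 0" "k \<in> grid N"
  shows "prob {\<omega>\<in>space M. card (P \<omega> \<inter> cell a b N k) \<noteq> 0}
    = 1 - exp (- ((\<Prod>i\<in>Basis. b \<bullet> i - a \<bullet> i) / real N ^ DIM('b)))"
proof -
  have [measurable]: "(\<lambda>\<omega>. card (P \<omega> \<inter> cell a b N k)) \<in> measurable M (count_space UNIV)"
    by (rule measurable_cell_count[OF assms])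
  have "prob {\<omega>\<in>space M. \<not> card (P \<omega> \<inter> cell a b N k) = 0} = 1 - prob {\<omega>\<in>space M. card (P \<omega> \<inter> cell a b N k) = 0}"
    by (rule prob_neg) measurable
  then show ?thesis using cells_indep(2)[OF assms] by simp
qed

text \<open>Only the volume of the box enters the right-hand side, because all cells of one grid
  have the same volume.\<close>

lemma prob_no_chain_at:
  assumes "good_box a b" "N > 0"
  shows "prob (no_chain_at N a b m) = (\<Sum>Q\<in>{Q\<in>Pow (grid N :: ('b \<Rightarrow> nat) set). \<not> chain_in ilt Q m}. \<Prod>k\<in>grid N.
    (if k \<in> Q then 1 - exp (- ((\<Prod>i\<in>Basis. b \<bullet> i - a \<bullet> i) / real N ^ DIM('b)))
      else exp (- ((\<Prod>i\<in>Basis. b \<bullet> i - a \<bullet> i) / real N ^ DIM('b)))))"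
proof -
  let ?X = "\<lambda>k \<omega>. card (P \<omega> \<inter> cell a b N k)"
  let ?S = "{Q\<in>Pow (grid N :: ('b \<Rightarrow> nat) set). \<not> chain_in ilt Q m}"
  define E where "E Q = {\<omega>\<in>space M. \<forall>k\<in>grid N. (?X k \<omega> \<noteq> 0) = (k \<in> Q)}" for Q
  \<comment> \<open>The set of counts that pattern \<open>Q\<close> allows in cell \<open>k\<close>,
    so that the event of seeing exactly this pattern becomes an intersection of preimages.\<close>
  define B where "B Q k = (if k \<in> Q then - {0} else {0::nat})" for Q and k :: "'b \<Rightarrow> nat"
  have ne: "grid N \<noteq> ({} :: ('b \<Rightarrow> nat) set)" using assms(2) by (auto simp: grid_def PiE_eq_empty_iff)
  have EB: "E Q = (\<Inter>k\<in>grid N. ?X k -` B Q k \<inter> space M)" for Q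
    using ne unfolding E_def B_def by (auto split: if_splits)
  have Ep: "prob (E Q) = (\<Prod>k\<in>grid N. prob (?X k -` B Q k \<inter> space M))" for Q
    unfolding EB by (rule indep_varsD_finite[OF cells_indep(1)[OF assms] ne finite_grid]) simp
  have Es: "E Q \<in> events" for Q
    unfolding EB using measurable_cell_count[OF assms] ne finite_grid
    by (intro sets.finite_INT) (auto intro: measurable_sets)
  have "no_chain_at N a b m = (\<Union>Q\<in>?S. E Q)"
    unfolding no_chain_at_def occ_def E_def not_chain_pattern by auto
  then have "prob (no_chain_at N a b m) = prob (\<Union>Q\<in>?S. E Q)" by simp
  also have "\<dots> = (\<Sum>Q\<in>?S. prob (E Q))"
  proof (rule finite_measure_finite_Union[OF finite_patterns])
    show "disjoint_family_on E ?S"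
      unfolding disjoint_family_on_def E_def by (auto 4 4)
  qed (use Es in auto)
  also have "\<dots> = (\<Sum>Q\<in>?S. \<Prod>k\<in>grid N.
    (if k \<in> Q then 1 - exp (- ((\<Prod>i\<in>Basis. b \<bullet> i - a \<bullet> i) / real N ^ DIM('b)))
      else exp (- ((\<Prod>i\<in>Basis. b \<bullet> i - a \<bullet> i) / real N ^ DIM('b)))))"
  proof (rule sum.cong[OF refl])
    fix Q assume "Q \<in> ?S"
    have "?X k -` B Q k \<inter> space M = (if k \<in> Q then {\<omega>\<in>space M. ?X k \<omega> \<noteq> 0} else {\<omega>\<in>space M. ?X k \<omega> = 0})" for k
      by (auto simp: B_def)
    then show "prob (E Q) = (\<Prod>k\<in>grid N.
      (if k \<in> Q then 1 - exp (- ((\<Prod>i\<in>Basis. b \<bullet> i - a \<bullet> i) / real N ^ DIM('b)))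
        else exp (- ((\<Prod>i\<in>Basis. b \<bullet> i - a \<bullet> i) / real N ^ DIM('b)))))"
      unfolding Ep by (intro prod.cong refl) (simp only: prob_occupied[OF assms] cells_indep(2)[OF assms] if_distrib[of prob] cong: if_cong)
  qed
  finally show ?thesis .
qed

lemma no_chain_at_decseq:
  assumes "good_box a b"
  shows "decseq (\<lambda>n. no_chain_at (2 ^ n) a b m)"
proof (rule decseq_SucI)
  fix n show "no_chain_at (2 ^ Suc n) a b m \<subseteq> no_chain_at (2 ^ n) a b m"
    using occ_refine[of a b "2 ^ n"] assms unfolding no_chain_at_def good_box_def by auto
qed

lemma sets_no_chain: "good_box a b \<Longrightarrow> no_chain a b m \<in> events"
  unfolding no_chain_def by (intro sets.countable_INT') (auto intro: sets_no_chain_at)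

lemma no_chain_at_lim:
  assumes "good_box a b"
  shows "(\<lambda>n. prob (no_chain_at (2 ^ n) a b m)) \<longlonglongrightarrow> prob (no_chain a b m)"
  unfolding no_chain_def
  by (rule finite_Lim_measure_decseq[OF _ no_chain_at_decseq[OF assms]])
    (auto intro: sets_no_chain_at assms)

text \<open>For each grid the product formula holds; along dyadic refinements the events decrease,
  so both sides converge by continuity from above.\<close>

lemma no_chain_prod:
  assumes J: "finite J" and good: "\<And>j. j \<in> J \<Longrightarrow> good_box (a j) (b j)"
    and disj: "disjoint_family_on (\<lambda>j. hbox (a j) (b j)) J"
  shows "prob {\<omega>\<in>space M. \<forall>j\<in>J. \<omega> \<in> no_chain (a j) (b j) (m j)} = (\<Prod>j\<in>J. prob (no_chain (a j) (b j) (m j)))"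
proof -
  let ?E = "\<lambda>n. {\<omega>\<in>space M. \<forall>j\<in>J. \<omega> \<in> no_chain_at (2 ^ n) (a j) (b j) (m j)}"
  have "(\<lambda>n. prob (?E n)) \<longlonglongrightarrow> prob (\<Inter>n. ?E n)"
  proof (rule finite_Lim_measure_decseq)
    show "decseq ?E"
      using no_chain_at_decseq[OF good] unfolding decseq_def by blast
    show "range ?E \<subseteq> events"
    proof safe
      fix n
      show "?E n \<in> events"
        by (rule sets.sets_Collect_finite_All[OF _ J])
          (use sets_no_chain_at[OF good] in \<open>auto simp: no_chain_at_def\<close>)
    qed
  qed
  moreover have "(\<Inter>n. ?E n) = {\<omega>\<in>space M. \<forall>j\<in>J. \<omega> \<in> no_chain (a j) (b j) (m j)}"
    by (auto simp: no_chain_def)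
  moreover have "(\<lambda>n. prob (?E n)) \<longlonglongrightarrow> (\<Prod>j\<in>J. prob (no_chain (a j) (b j) (m j)))"
    by (subst no_chain_at_prod[OF J good disj]) (auto intro!: tendsto_prod no_chain_at_lim good)
  ultimately show ?thesis using LIMSEQ_unique by fastforce
qed

text \<open>The cells of a box are occupied independently, with a probability depending only on the
  volume of the box; this replaces the translation and scaling invariance of the process.\<close>

lemma prob_no_chain_cong:
  assumes "good_box a b" "good_box a' b'"
    and "(\<Prod>i\<in>Basis. b \<bullet> i - a \<bullet> i) = (\<Prod>i\<in>Basis. b' \<bullet> i - a' \<bullet> i)"
  shows "prob (no_chain a b m) = prob (no_chain a' b' m)"
proof -
  have "prob (no_chain_at (2 ^ n) a b m) = prob (no_chain_at (2 ^ n) a' b' m)" for n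
    unfolding prob_no_chain_at[OF assms(1) zero_less_power[OF pos2]]
      prob_no_chain_at[OF assms(2) zero_less_power[OF pos2]] assms(3) ..
  then show ?thesis
    using LIMSEQ_unique[OF no_chain_at_lim[OF assms(1), of m]] no_chain_at_lim[OF assms(2), of m] by simp
qed

text \<open>The bridge between grid events and chains of points; it can fail only where the
  configuration is not locally finite.\<close>

lemma AE_no_chain_iff:
  assumes "good_box a b"
  shows "AE \<omega> in M. \<omega> \<in> no_chain a b m \<longleftrightarrow> lis (P \<omega> \<inter> hbox a b) < m"
  using AE_locally_finite AE_space
proof eventually_elim
  case (elim \<omega>)
  then have fin: "finite (P \<omega> \<inter> hbox a b)" using bounded_hbox by blast
  show ?case
    unfolding lis_less_iff[OF fin] no_chain_def no_chain_at_def
    using chain_iff_occ[of a b "P \<omega>" m] assms fin elim by (auto simp: good_box_def)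
qed

text \<open>The grids of the two boxes are unrelated, so monotonicity is obtained almost surely
  through \<open>lis\<close>.\<close>

lemma prob_no_chain_anti:
  assumes "good_box a b" "good_box a' b'" "hbox a b \<subseteq> hbox a' b'" "m' \<le> m"
  shows "prob (no_chain a' b' m') \<le> prob (no_chain a b m)"
proof (rule finite_measure_mono_AE)
  show "AE \<omega> in M. \<omega> \<in> no_chain a' b' m' \<longrightarrow> \<omega> \<in> no_chain a b m"
    using AE_no_chain_iff[OF assms(1), of m] AE_no_chain_iff[OF assms(2), of m'] AE_locally_finite
  proof eventually_elim
    case (elim \<omega>)
    have "finite (P \<omega> \<inter> hbox a' b')" using elim bounded_hbox by blast
    then have "lis (P \<omega> \<inter> hbox a b) \<le> lis (P \<omega> \<inter> hbox a' b')" by (rule lis_mono) (use assms in auto)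
    then show ?case using elim assms by auto
  qed
qed (rule sets_no_chain[OF assms(1)])

section \<open>Upper bound by counting chains of cells\<close>

definition grid_chains :: "nat \<Rightarrow> nat \<Rightarrow> (nat \<Rightarrow> 'b \<Rightarrow> nat) set" where
  "grid_chains N m = {p \<in> PiE {..<m} (\<lambda>_. grid N). \<forall>k. Suc k < m \<longrightarrow> ilt (p k) (p (Suc k))}"

lemma ilt_less:
  assumes "p \<in> grid_chains N m" "k < l" "l < m" "i \<in> Basis"
  shows "p k i < p l i"
proof -
  have "transp (ilt :: ('b \<Rightarrow> nat) \<Rightarrow> _)" by (rule transpI) (fastforce simp: ilt_def intro: less_trans)
  from chain_in_less[OF this, of m p k l] show ?thesis using assms by (auto simp: grid_chains_def ilt_def)
qed

text \<open>In each coordinate a chain of cells is a strictly increasing sequence, so it is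
  determined by its set of values, an \<open>m\<close>-element subset of \<open>{..<N}\<close>. This
  leaves at most \<open>(N choose m) ^ DIM('b)\<close> chains.\<close>

lemma card_grid_chains: "real (card (grid_chains N m)) \<le> (real N ^ m / fact m) ^ DIM('b)"
proof -
  let ?T = "PiE (Basis :: 'b set) (\<lambda>_. {S. S \<subseteq> {..<N} \<and> card S = m})"
  define h where "h p = restrict (\<lambda>i. (\<lambda>k. p k i) ` {..<m}) (Basis :: 'b set)" for p :: "nat \<Rightarrow> 'b \<Rightarrow> nat"
  have "inj_on h (grid_chains N m)"
  proof (rule inj_onI)
    fix p q assume p: "p \<in> grid_chains N m" and q: "q \<in> grid_chains N m" and hpq: "h p = h q"
    have srt: "sorted_wrt (<) (map (\<lambda>k. r k i) [0..<m])" if "r \<in> grid_chains N m" "i \<in> Basis" for r i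
      unfolding sorted_wrt_map sorted_wrt_iff_nth_less using ilt_less[OF that(1) _ _ that(2)] by auto
    have eq: "p k i = q k i" if k: "k < m" and i: "i \<in> Basis" for k i
    proof -
      have "(\<lambda>k. p k i) ` {..<m} = (\<lambda>k. q k i) ` {..<m}" using fun_cong[OF hpq, of i] i by (simp add: h_def)
      then have "set (map (\<lambda>k. p k i) [0..<m]) = set (map (\<lambda>k. q k i) [0..<m])" by (simp add: lessThan_atLeast0)
      then have "map (\<lambda>k. p k i) [0..<m] = map (\<lambda>k. q k i) [0..<m]"
        using srt[OF p i] srt[OF q i] strict_sorted_equal by blast
      then show ?thesis using k by (auto simp: map_eq_conv)
    qed
    show "p = q"
    proof (rule ext)+
      fix k i show "p k i = q k i"
      proof (cases "k < m")
        case True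
        then have "p k \<in> grid N" "q k \<in> grid N" using p q by (auto simp: grid_chains_def)
        then show ?thesis using eq[OF True] by (cases "i \<in> Basis") (auto simp: grid_def PiE_def extensional_def)
      next
        case False
        then show ?thesis using p q by (auto simp: grid_chains_def PiE_def extensional_def)
      qed
    qed
  qed
  moreover have "h ` grid_chains N m \<subseteq> ?T"
  proof
    fix x assume "x \<in> h ` grid_chains N m"
    then obtain p where p: "p \<in> grid_chains N m" and x: "x = h p" by auto
    have "inj_on (\<lambda>k. p k i) {..<m}" if "i \<in> Basis" for i
      by (rule linorder_inj_onI) (use ilt_less[OF p _ _ that] in fastforce)+
    moreover have "p k i < N" if "k < m" "i \<in> Basis" for k i
      using p that by (auto simp: grid_chains_def grid_def PiE_iff)
    ultimately show "x \<in> ?T" by (auto simp: x h_def card_image)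
  qed
  moreover have "finite ?T" by (intro finite_PiE) auto
  ultimately have "card (grid_chains N m) \<le> card ?T" by (rule card_inj_on_le)
  also have "\<dots> = (N choose m) ^ DIM('b)" by (simp add: card_PiE n_subsets)
  finally have "real (card (grid_chains N m)) \<le> real (N choose m) ^ DIM('b)" by (metis of_nat_le_iff of_nat_power)
  also have "\<dots> \<le> (real N ^ m / fact m) ^ DIM('b)"
  proof (rule power_mono)
    have "real ((N choose m) * fact m) \<le> real (N ^ m)" by (simp only: of_nat_le_iff binomial_fact_pow)
    then show "real (N choose m) \<le> real N ^ m / fact m" by (simp add: field_simps)
  qed simp
  finally show ?thesis .
qed

lemma finite_grid_chains: "finite (grid_chains N m)"
  unfolding grid_chains_def using finite_grid by (auto intro!: finite_PiE finite_Collect_conjI)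

text \<open>Union bound over chains of cells. A given cell is occupied with probability at most its
  volume, and the powers of \<open>N\<close> from the number of chains and from the cell volumes
  cancel, so the bound is uniform in the grid.\<close>

lemma prob_chain_at_le:
  assumes gb: "good_box a b" and N: "N > 0"
  shows "1 - prob (no_chain_at N a b m) \<le> (\<Prod>i\<in>Basis. b \<bullet> i - a \<bullet> i) ^ m / fact m ^ DIM('b)"
proof (cases "m = 0")
  case True
  then show ?thesis by simp
next
  case False
  let ?X = "\<lambda>k \<omega>. card (P \<omega> \<inter> cell a b N k)"
  let ?v = "\<Prod>i\<in>Basis. b \<bullet> i - a \<bullet> i"
  have v: "?v > 0" using gb by (intro prod_pos) (auto simp: good_box_def slt_def)
  define E where "E p = {\<omega>\<in>space M. \<forall>k\<in>{..<m}. ?X (p k) \<omega> \<noteq> 0}" for p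
  have pg: "p k \<in> grid N" if "p \<in> grid_chains N m" "k < m" for p k using that by (auto simp: grid_chains_def)
  have Es: "E p \<in> events" if "p \<in> grid_chains N m" for p
    unfolding E_def
  proof (rule sets.sets_Collect_finite_All)
    fix k assume k: "k \<in> {..<m}"
    have [measurable]: "?X (p k) \<in> measurable M (count_space UNIV)"
      by (rule measurable_cell_count[OF gb N]) (use k pg[OF that] in auto)
    show "{\<omega>\<in>space M. ?X (p k) \<omega> \<noteq> 0} \<in> events" by measurable
  qed simp
  have Ep: "prob (E p) \<le> (?v / real N ^ DIM('b)) ^ m" if p: "p \<in> grid_chains N m" for p
  proof -
    \<comment> \<open>The cells of a chain are distinct, so their occupations are independent and
      the probabilities multiply; any one coordinate shows this, here the one along
      \<open>e\<close>.\<close>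
    have inj: "inj_on p {..<m}"
    proof (rule linorder_inj_onI)
      fix k l assume "k < l" "k \<in> {..<m}" "l \<in> {..<m}"
      then have "p k e < p l e" using ilt_less[OF p] e by auto
      then show "p k \<noteq> p l" by auto
    qed auto
    have "prob (E p) = prob (\<Inter>k\<in>p ` {..<m}. ?X k -` (- {0}) \<inter> space M)"
      unfolding E_def using False by (intro arg_cong[of _ _ prob]) auto
    also have "\<dots> = (\<Prod>k\<in>p ` {..<m}. prob (?X k -` (- {0}) \<inter> space M))"
      by (rule indep_varsD[OF cells_indep(1)[OF gb N]]) (use pg[OF p] False in auto)
    also have "\<dots> = (\<Prod>k\<in>p ` {..<m}. 1 - exp (- (?v / real N ^ DIM('b))))"
    proof (rule prod.cong[OF refl])
      fix k assume "k \<in> p ` {..<m}"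
      then have "k \<in> grid N" using pg[OF p] by auto
      moreover have "?X k -` (- {0}) \<inter> space M = {\<omega>\<in>space M. ?X k \<omega> \<noteq> 0}" by auto
      ultimately show "prob (?X k -` (- {0}) \<inter> space M) = 1 - exp (- (?v / real N ^ DIM('b)))"
        by (simp only: prob_occupied[OF gb N])
    qed
    also have "\<dots> = (1 - exp (- (?v / real N ^ DIM('b)))) ^ m"
      using inj by (simp add: card_image)
    also have "\<dots> \<le> (?v / real N ^ DIM('b)) ^ m"
    proof (rule power_mono)
      show "1 - exp (- (?v / real N ^ DIM('b))) \<le> ?v / real N ^ DIM('b)"
        using exp_ge_add_one_self[of "- (?v / real N ^ DIM('b))"] by linarith
      show "0 \<le> 1 - exp (- (?v / real N ^ DIM('b)))" using v by simp
    qed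
    finally show ?thesis .
  qed
  have "1 - prob (no_chain_at N a b m) = prob (space M - no_chain_at N a b m)"
    using prob_compl[OF sets_no_chain_at[OF gb N]] by simp
  also have "\<dots> \<le> prob (\<Union>p\<in>grid_chains N m. E p)"
  proof (rule finite_measure_mono)
    show "(\<Union>p\<in>grid_chains N m. E p) \<in> events" using Es finite_grid_chains by blast
    show "space M - no_chain_at N a b m \<subseteq> (\<Union>p\<in>grid_chains N m. E p)"
    proof
      fix \<omega> assume "\<omega> \<in> space M - no_chain_at N a b m"
      then have \<omega>: "\<omega> \<in> space M" and "chain_in ilt (occ (P \<omega>) a b N) m" by (auto simp: no_chain_at_def)
      then obtain p where p: "\<And>k. k < m \<Longrightarrow> p k \<in> occ (P \<omega>) a b N" "\<And>k. Suc k < m \<Longrightarrow> ilt (p k) (p (Suc k))"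
        unfolding chain_in_def by blast
      have "restrict p {..<m} \<in> grid_chains N m" using p by (auto simp: grid_chains_def occ_def)
      moreover have "\<omega> \<in> E (restrict p {..<m})" using p \<omega> by (auto simp: E_def occ_def)
      ultimately show "\<omega> \<in> (\<Union>p\<in>grid_chains N m. E p)" by blast
    qed
  qed
  also have "\<dots> \<le> (\<Sum>p\<in>grid_chains N m. prob (E p))"
    by (rule finite_measure_subadditive_finite[OF finite_grid_chains]) (use Es in auto)
  also have "\<dots> \<le> (\<Sum>p\<in>grid_chains N m. (?v / real N ^ DIM('b)) ^ m)" by (rule sum_mono) (rule Ep)
  also have "\<dots> = real (card (grid_chains N m)) * (?v / real N ^ DIM('b)) ^ m" by simp
  also have "\<dots> \<le> (real N ^ m / fact m) ^ DIM('b) * (?v / real N ^ DIM('b)) ^ m"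
    using v by (intro mult_right_mono card_grid_chains) auto
  also have "\<dots> = ?v ^ m / fact m ^ DIM('b)"
    using N by (simp add: power_divide power_mult[symmetric] mult.commute)
  finally show ?thesis .
qed

lemma prob_chain_le:
  assumes "good_box a b"
  shows "1 - prob (no_chain a b m) \<le> (\<Prod>i\<in>Basis. b \<bullet> i - a \<bullet> i) ^ m / fact m ^ DIM('b)"
  by (rule LIMSEQ_le_const2[OF tendsto_diff[OF tendsto_const no_chain_at_lim[OF assms]]])
    (use prob_chain_at_le[OF assms] in auto)

end

section \<open>Tail bounds for cubes\<close>

text \<open>Some tail intersection \<open>B n\<close> has probability above 1/2. By multiplicativity
  and \<open>p \<le> exp (- (1 - p))\<close>, every partial sum of the failure probabilities from
  \<open>n\<close> on is then at most \<open>ln 2\<close>.\<close>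

lemma (in prob_space) converse_Borel_Cantelli:
  assumes A: "\<And>k::nat. A k \<in> events"
    and prod: "\<And>J. finite J \<Longrightarrow> prob {\<omega>\<in>space M. \<forall>j\<in>J. \<omega> \<in> A j} = (\<Prod>j\<in>J. prob (A j))"
    and ev: "AE \<omega> in M. eventually (\<lambda>k. \<omega> \<in> A k) sequentially"
  shows "summable (\<lambda>k. 1 - prob (A k))"
proof -
  define B where "B n = {\<omega>\<in>space M. \<forall>k\<in>{n..}. \<omega> \<in> A k}" for n
  have Bs: "B n \<in> events" for n
    unfolding B_def by (intro sets.sets_Collect_countable_Ball) (use A sets.sets_into_space in \<open>auto simp: Int_absorb1 Collect_conj_eq\<close>)
  have "(\<lambda>n. prob (B n)) \<longlonglongrightarrow> prob (\<Union>n. B n)"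
    by (rule finite_Lim_measure_incseq) (auto simp: incseq_def B_def Bs[unfolded B_def])
  moreover have "AE \<omega> in M. \<omega> \<in> (\<Union>n. B n)"
    using ev AE_space by eventually_elim (auto simp: B_def eventually_sequentially)
  then have "prob (\<Union>n. B n) = 1"
    using Bs by (intro iffD2[OF prob_eq_1]) auto
  ultimately have "eventually (\<lambda>n. 1/2 < prob (B n)) sequentially"
    by (intro order_tendstoD(1)[of _ 1]) auto
  then obtain n where n: "1/2 < prob (B n)" by (auto simp: eventually_sequentially)
  have "(\<Sum>k<N. 1 - prob (A (k + n))) \<le> ln 2" for N
  proof -
    have "prob (B n) \<le> prob {\<omega>\<in>space M. \<forall>j\<in>(\<lambda>k. k + n) ` {..<N}. \<omega> \<in> A j}"
    proof (rule finite_measure_mono)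
      show "{\<omega>\<in>space M. \<forall>j\<in>(\<lambda>k. k + n) ` {..<N}. \<omega> \<in> A j} \<in> events"
        by (rule sets.sets_Collect_finite_All) (use A sets.sets_into_space in \<open>auto simp: Int_absorb1 Collect_conj_eq\<close>)
    qed (auto simp: B_def)
    also have "\<dots> = (\<Prod>k<N. prob (A (k + n)))"
      by (subst prod) (auto simp: prod.reindex inj_on_def)
    also have "\<dots> \<le> (\<Prod>k<N. exp (- (1 - prob (A (k + n)))))"
    proof (rule prod_mono, intro conjI)
      fix k show "prob (A (k + n)) \<le> exp (- (1 - prob (A (k + n))))"
        using exp_ge_add_one_self[of "- (1 - prob (A (k + n)))"] by linarith
    qed simp
    also have "\<dots> = exp (- (\<Sum>k<N. 1 - prob (A (k + n))))"
      by (simp add: exp_sum sum_negf[symmetric])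
    finally have "1/2 \<le> exp (- (\<Sum>k<N. 1 - prob (A (k + n))))" using n by linarith
    then have "ln (1/2) \<le> - (\<Sum>k<N. 1 - prob (A (k + n)))" using ln_mono[of "1/2" "exp (- (\<Sum>k<N. 1 - prob (A (k + n))))"] by simp
    then show ?thesis by (simp add: ln_div)
  qed
  then have "summable (\<lambda>k. 1 - prob (A (k + n)))"
    by (intro summableI_nonneg_bounded) auto
  then show ?thesis by (rule iffD1[OF summable_iff_shift])
qed

lemma (in prob_space) prob_tendsto_0:
  assumes A: "\<And>k::nat. A k \<in> events"
    and ev: "AE \<omega> in M. eventually (\<lambda>k. \<omega> \<notin> A k) sequentially"
  shows "(\<lambda>k. prob (A k)) \<longlonglongrightarrow> 0"
proof -
  define B where "B n = (\<Union>k\<in>{n..}. A k)" for n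
  have Bs: "B n \<in> events" for n unfolding B_def using A by blast
  have "(\<lambda>n. prob (B n)) \<longlonglongrightarrow> prob (\<Inter>n. B n)"
  proof (rule finite_Lim_measure_decseq)
    show "decseq B" unfolding decseq_def B_def by (intro allI impI UN_mono) auto
  qed (use Bs in auto)
  moreover have "AE \<omega> in M. \<omega> \<notin> (\<Inter>n. B n)"
    using ev by eventually_elim (auto simp: B_def eventually_sequentially)
  then have "prob (\<Inter>n. B n) = 0"
    using Bs by (subst prob_eq_0) auto
  ultimately have "(\<lambda>n. prob (B n)) \<longlonglongrightarrow> 0" by simp
  then show ?thesis
    by (rule tendsto_sandwich[OF _ _ tendsto_const, rotated -1])
      (use Bs in \<open>auto intro!: always_eventually finite_measure_mono simp: B_def\<close>)
qed

text \<open>Real thresholds are encoded as \<open>nat \<lceil>x\<rceil>\<close>; for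
  \<open>x \<le> 0\<close> both sides are false, so no sign condition arises.\<close>

lemma less_nat_ceiling_iff: "k < nat \<lceil>x\<rceil> \<longleftrightarrow> real k < x"
  by linarith

text \<open>Used to join summability results known only along each residue class of
  exponents.\<close>

lemma eventually_residues:
  fixes j :: nat
  assumes "j > 0" "\<And>i. i < j \<Longrightarrow> eventually (\<lambda>k. Q (i + j * k)) sequentially"
  shows "eventually Q sequentially"
proof -
  have "eventually (\<lambda>k. \<forall>i\<in>{..<j}. Q (i + j * k)) sequentially"
    by (intro eventually_ball_finite) (use assms in auto)
  then obtain K where K: "\<And>k i. k \<ge> K \<Longrightarrow> i < j \<Longrightarrow> Q (i + j * k)"
    unfolding eventually_sequentially by auto
  have "Q n" if "n \<ge> j * K" for n
  proof -
    have "n div j \<ge> K" using that assms(1) by (simp add: less_eq_div_iff_mult_less_eq mult.commute)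
    then show ?thesis using K[of "n div j" "n mod j"] assms(1) by simp
  qed
  then show ?thesis unfolding eventually_sequentially by blast
qed

section \<open>Consequences of the limit along cubes at the origin\<close>

locale chain_constant = poisson_half_space M P e for M P and e :: "'b::euclidean_space" +
  fixes c :: real
  assumes c_lim: "AE \<omega> in M. (\<lambda>n. real (lis (P \<omega> \<inter> hbox 0 (real n *\<^sub>R \<Sum>Basis))) / real n) \<longlonglongrightarrow> c"
begin

lemma c_nonneg: "0 \<le> c"
proof -
  have "AE \<omega> in M. 0 \<le> c" using c_lim
    by eventually_elim (rule LIMSEQ_le_const, auto)
  then show ?thesis using prob_space by (auto simp: AE_const)
qed

text \<open>The probability that chains in a cube of side \<open>s\<close> are shorter than
  \<open>m\<close>. By equality of laws it serves for every good box of volume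
  \<open>s ^ DIM('b)\<close>.\<close>

definition cube_prob :: "real \<Rightarrow> nat \<Rightarrow> real" where
  "cube_prob s m = prob (no_chain 0 (s *\<^sub>R \<Sum>Basis) m)"

lemma good_cube: "0 \<le> s \<Longrightarrow> s < t \<Longrightarrow> good_box (s *\<^sub>R \<Sum>Basis) (t *\<^sub>R \<Sum>Basis)"
  using e by (auto simp: good_box_def slt_def)

lemma good_cube0: "0 < t \<Longrightarrow> good_box 0 (t *\<^sub>R \<Sum>Basis)"
  using good_cube[of 0 t] by simp

lemma prob_eq_cube:
  assumes "good_box a b" "s > 0" "(\<Prod>i\<in>Basis. b \<bullet> i - a \<bullet> i) = s ^ DIM('b)"
  shows "prob (no_chain a b m) = cube_prob s m"
  unfolding cube_prob_def by (rule prob_no_chain_cong[OF assms(1) good_cube0[OF assms(2)]]) (simp add: assms)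

lemma cube_prob_anti:
  assumes "0 < s" "s \<le> t" "m' \<le> m"
  shows "cube_prob t m' \<le> cube_prob s m"
  unfolding cube_prob_def
  by (rule prob_no_chain_anti[OF good_cube0 good_cube0 hbox_mono]) (use assms in auto)

text \<open>The hypothesis covers integer sides only; a real side is rounded up, and half of
  \<open>\<epsilon>\<close> pays for the enlargement.\<close>

lemma lis_cube_upper:
  assumes "\<epsilon> > 0"
  shows "AE \<omega> in M. eventually (\<lambda>s::real. real (lis (P \<omega> \<inter> hbox 0 (s *\<^sub>R \<Sum>Basis))) < (c + \<epsilon>) * s) at_top"
  using c_lim AE_locally_finite
proof eventually_elim
  case (elim \<omega>)
  have "eventually (\<lambda>n. real (lis (P \<omega> \<inter> hbox 0 (real n *\<^sub>R \<Sum>Basis))) / real n < c + \<epsilon>/2) sequentially"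
    using elim(1) assms by (intro order_tendstoD(2)) auto
  then obtain N where N: "\<And>n. n \<ge> N \<Longrightarrow> real (lis (P \<omega> \<inter> hbox 0 (real n *\<^sub>R \<Sum>Basis))) / real n < c + \<epsilon>/2"
    by (auto simp: eventually_sequentially)
  \<comment> \<open>The last summand ensures
    \<open>S * \<epsilon> / 2 \<ge> c + \<epsilon>/2\<close>, which absorbs the unit lost in
    \<open>real n \<le> s + 1\<close>.\<close>
  define S where "S = real N + 1 + 2 * (c + \<epsilon>/2) / \<epsilon>"
  have "real (lis (P \<omega> \<inter> hbox 0 (s *\<^sub>R \<Sum>Basis))) < (c + \<epsilon>) * s" if s: "s \<ge> S" for s
  proof -
    define n where "n = nat \<lceil>s\<rceil>"
    have S: "S \<ge> real N + 1" "S * \<epsilon> / 2 \<ge> c + \<epsilon>/2"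
      using c_nonneg assms by (auto simp: S_def field_simps)
    have n: "real n \<ge> s" "real n \<le> s + 1" "n \<ge> N" "n > 0" using s S by (auto simp: n_def; linarith)+
    have "lis (P \<omega> \<inter> hbox 0 (s *\<^sub>R \<Sum>Basis)) \<le> lis (P \<omega> \<inter> hbox 0 (real n *\<^sub>R \<Sum>Basis))"
    proof (rule lis_mono)
      have "hbox 0 (s *\<^sub>R \<Sum>Basis) \<subseteq> hbox 0 (real n *\<^sub>R \<Sum>Basis :: 'b)"
        using n by (intro hbox_mono) auto
      then show "P \<omega> \<inter> hbox 0 (s *\<^sub>R \<Sum>Basis) \<subseteq> P \<omega> \<inter> hbox 0 (real n *\<^sub>R \<Sum>Basis)" by blast
    qed (use elim bounded_hbox in blast)
    moreover have "real (lis (P \<omega> \<inter> hbox 0 (real n *\<^sub>R \<Sum>Basis))) < (c + \<epsilon>/2) * real n"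
      using N[OF n(3)] n by (simp add: field_simps)
    moreover have "(c + \<epsilon>/2) * real n \<le> (c + \<epsilon>/2) * (s + 1)" using n c_nonneg assms by (intro mult_left_mono) auto
    moreover have "S * \<epsilon> \<le> s * \<epsilon>" using s assms by simp
    then have "c * s + s * \<epsilon> / 2 + (c + \<epsilon>/2) \<le> c * s + s * \<epsilon>" using S by linarith
    then have "(c + \<epsilon>/2) * (s + 1) \<le> (c + \<epsilon>) * s" by (simp add: distrib_left distrib_right mult.commute add_divide_distrib)
    ultimately show ?thesis by linarith
  qed
  then show ?case unfolding eventually_at_top_linorder by blast
qed

text \<open>The boxes between consecutive cubes of a geometric sequence are disjoint, so the almost sure
  upper bound on the longest chains in them yields summable tails by the converse Borel--Cantelli lemma.\<close>

lemma upper_tail_summable: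
  assumes eps: "\<epsilon> > 0"
  shows "\<exists>R0>1. \<forall>R\<ge>R0. \<forall>s0>0. summable (\<lambda>k. 1 - cube_prob (s0 * R ^ k) (nat \<lceil>(c + \<epsilon>) * (s0 * R ^ k)\<rceil>))"
\<comment> \<open>The second bound on \<open>R\<close> is equivalent to
  \<open>(c + \<epsilon>/2) * R \<le> (c + \<epsilon>) * (R - 1)\<close>: the almost sure bound with
  \<open>\<epsilon>/2\<close> for the cube of side \<open>S k\<close> then gives the bound with
  \<open>\<epsilon>\<close> for the smaller box inside it.\<close>
proof (intro exI[of _ "max 2 (2 * (c + \<epsilon>) / \<epsilon>)"] conjI allI impI)
  fix R s0 :: real assume R: "max 2 (2 * (c + \<epsilon>) / \<epsilon>) \<le> R" and s0: "0 < s0"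
  have R2: "R \<ge> 2" and R1: "R * \<epsilon> \<ge> 2 * (c + \<epsilon>)" using R eps by (auto simp: field_simps)
  \<comment> \<open>The outer side is chosen so that the box from \<open>S k / R\<close> to
    \<open>S k\<close> has side exactly \<open>s0 * R ^ k\<close>. Since
    \<open>S (Suc k) / R = S k\<close>, consecutive boxes meet only in a corner, which half-openness
    removes.\<close>
  define S where "S k = s0 * R ^ Suc k / (R - 1)" for k :: nat
  define m where "m k = nat \<lceil>(c + \<epsilon>) * (s0 * R ^ k)\<rceil>" for k
  define a where "a k = (S k / R) *\<^sub>R (\<Sum>Basis :: 'b)" for k
  define b where "b k = S k *\<^sub>R (\<Sum>Basis :: 'b)" for k
  have Spos: "S k > 0" for k using s0 R2 by (simp add: S_def)
  have good: "good_box (a k) (b k)" for k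
    unfolding a_def b_def using Spos[of k] R2 by (intro good_cube) (auto simp: field_simps)
  have diff: "S k - S k / R = s0 * R ^ k" for k
  proof -
    have "S k - S k / R = S k * (R - 1) / R" using R2 by (simp add: field_simps)
    then show ?thesis using R2 by (simp add: S_def)
  qed
  have law: "prob (no_chain (a k) (b k) (m k)) = cube_prob (s0 * R ^ k) (m k)" for k
  proof (rule prob_eq_cube[OF good])
    have "(\<Prod>i\<in>Basis. b k \<bullet> i - a k \<bullet> i) = (\<Prod>i\<in>(Basis :: 'b set). S k - S k / R)"
      by (intro prod.cong) (auto simp: a_def b_def)
    then show "(\<Prod>i\<in>Basis. b k \<bullet> i - a k \<bullet> i) = (s0 * R ^ k) ^ DIM('b)"
      unfolding diff by simp
  qed (use s0 R2 in auto)
  have SS: "S k \<le> S l / R" if "k < l" for k l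
  proof -
    have "S (Suc k) / R = S k" using R2 by (simp add: S_def)
    moreover have "S (Suc k) \<le> S l"
      unfolding S_def using that R2 s0 by (intro divide_right_mono mult_left_mono power_increasing) auto
    ultimately show ?thesis using R2 by (simp add: field_simps)
  qed
  have dis0: "hbox (a k) (b k) \<inter> hbox (a l) (b l) = {}" if "k < l" for k l
  proof -
    have "z \<bullet> e \<le> S k" if "z \<in> hbox (a k) (b k)" for z using that e by (auto simp: hbox_def b_def)
    moreover have "S l / R < z \<bullet> e" if "z \<in> hbox (a l) (b l)" for z using that e by (auto simp: hbox_def a_def)
    ultimately show ?thesis using SS[OF that] by fastforce
  qed
  have disj: "disjoint_family_on (\<lambda>k. hbox (a k) (b k)) J" for J
    unfolding disjoint_family_on_def using dis0 by (metis Int_commute nat_neq_iff)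
  have "summable (\<lambda>k. 1 - prob (no_chain (a k) (b k) (m k)))"
  proof (rule converse_Borel_Cantelli)
    show "prob {\<omega>\<in>space M. \<forall>j\<in>J. \<omega> \<in> no_chain (a j) (b j) (m j)} = (\<Prod>j\<in>J. prob (no_chain (a j) (b j) (m j)))"
      if "finite J" for J by (rule no_chain_prod[OF that good disj])
    have "AE \<omega> in M. \<forall>k. \<omega> \<in> no_chain (a k) (b k) (m k) \<longleftrightarrow> lis (P \<omega> \<inter> hbox (a k) (b k)) < m k"
      by (rule iffD2[OF AE_all_countable]) (auto intro: AE_no_chain_iff good)
    moreover have "AE \<omega> in M. eventually (\<lambda>s::real. real (lis (P \<omega> \<inter> hbox 0 (s *\<^sub>R \<Sum>Basis))) < (c + \<epsilon>/2) * s) at_top"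
      using lis_cube_upper[of "\<epsilon>/2"] eps by simp
    ultimately show "AE \<omega> in M. \<forall>\<^sub>F k in sequentially. \<omega> \<in> no_chain (a k) (b k) (m k)"
      using AE_locally_finite
    proof eventually_elim
      case (elim \<omega>)
      have "filterlim (\<lambda>k. R ^ k) at_top sequentially"
        using filterlim_at_infinity_imp_filterlim_at_top[OF filterlim_realpow_sequentially_gt1[of R]] R2 by simp
      then have "filterlim (\<lambda>k. R ^ k * (s0 * R / (R - 1))) at_top sequentially"
        using R2 s0 by (intro filterlim_at_top_mult_tendsto_pos[OF tendsto_const]) auto
      moreover have "(\<lambda>k. R ^ k * (s0 * R / (R - 1))) = S" by (rule ext) (simp add: S_def mult_ac)
      ultimately have "filterlim S at_top sequentially" by simp
      from filterlim_iff[THEN iffD1, rule_format, OF this elim(2)]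
      show ?case
      proof (rule eventually_mono)
        fix k assume k: "real (lis (P \<omega> \<inter> hbox 0 (S k *\<^sub>R \<Sum>Basis))) < (c + \<epsilon>/2) * S k"
        have "lis (P \<omega> \<inter> hbox (a k) (b k)) \<le> lis (P \<omega> \<inter> hbox 0 (S k *\<^sub>R \<Sum>Basis))"
        proof (rule lis_mono)
          have "hbox (a k) (b k) \<subseteq> hbox 0 (S k *\<^sub>R \<Sum>Basis)"
            using Spos[of k] R2 by (intro hbox_mono) (auto simp: a_def b_def)
          then show "P \<omega> \<inter> hbox (a k) (b k) \<subseteq> P \<omega> \<inter> hbox 0 (S k *\<^sub>R \<Sum>Basis)" by blast
        qed (use elim bounded_hbox in blast)
        moreover have "(c + \<epsilon>/2) * S k \<le> (c + \<epsilon>) * (S k - S k / R)"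
        proof -
          have "(c + \<epsilon>/2) * R \<le> (c + \<epsilon>) * (R - 1)" using R1 by (simp add: algebra_simps)
          then have "(c + \<epsilon>/2) * R * (S k / R) \<le> (c + \<epsilon>) * (R - 1) * (S k / R)"
            using Spos[of k] R2 by (intro mult_right_mono) auto
          moreover have "R * (S k / R) = S k" "(R - 1) * (S k / R) = S k - S k / R"
            using R2 by (auto simp: field_simps)
          ultimately show ?thesis by (simp only: mult.assoc)
        qed
        ultimately have "real (lis (P \<omega> \<inter> hbox (a k) (b k))) < (c + \<epsilon>) * (s0 * R ^ k)"
          using k unfolding diff by linarith
        then show "\<omega> \<in> no_chain (a k) (b k) (m k)"
          using elim(1) by (simp only: m_def less_nat_ceiling_iff)
      qed
    qed
  qed (rule sets_no_chain[OF good])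
  then show "summable (\<lambda>k. 1 - cube_prob (s0 * R ^ k) (nat \<lceil>(c + \<epsilon>) * (s0 * R ^ k)\<rceil>))"
    unfolding law by (simp add: m_def)
qed simp

text \<open>No rate is available here; an arbitrarily small probability at one scale is all that the
  amplification needs. The shift to \<open>Suc n\<close> avoids the degenerate cube.\<close>

lemma cube_prob_lower_tendsto:
  assumes eps: "\<epsilon> > 0"
  shows "(\<lambda>n. cube_prob (real (Suc n)) (nat \<lceil>(c - \<epsilon>) * real (Suc n)\<rceil>)) \<longlonglongrightarrow> 0"
  unfolding cube_prob_def
proof (rule prob_tendsto_0)
  show "no_chain 0 (real (Suc n) *\<^sub>R \<Sum>Basis) (nat \<lceil>(c - \<epsilon>) * real (Suc n)\<rceil>) \<in> events" for n
    by (rule sets_no_chain[OF good_cube0]) simp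
  have "AE \<omega> in M. \<forall>n. \<omega> \<in> no_chain 0 (real (Suc n) *\<^sub>R \<Sum>Basis) (nat \<lceil>(c - \<epsilon>) * real (Suc n)\<rceil>) \<longleftrightarrow>
      lis (P \<omega> \<inter> hbox 0 (real (Suc n) *\<^sub>R \<Sum>Basis)) < nat \<lceil>(c - \<epsilon>) * real (Suc n)\<rceil>"
    by (rule iffD2[OF AE_all_countable], rule allI, rule AE_no_chain_iff[OF good_cube0]) simp
  with c_lim show "AE \<omega> in M. \<forall>\<^sub>F n in sequentially. \<omega> \<notin> no_chain 0 (real (Suc n) *\<^sub>R \<Sum>Basis) (nat \<lceil>(c - \<epsilon>) * real (Suc n)\<rceil>)"
  proof eventually_elim
    case (elim \<omega>)
    have "eventually (\<lambda>n. c - \<epsilon> < real (lis (P \<omega> \<inter> hbox 0 (real n *\<^sub>R \<Sum>Basis))) / real n) sequentially"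
      using elim(1) eps by (intro order_tendstoD(1)) auto
    then have "eventually (\<lambda>n. c - \<epsilon> < real (lis (P \<omega> \<inter> hbox 0 (real (Suc n) *\<^sub>R \<Sum>Basis))) / real (Suc n)) sequentially"
      by (rule eventually_sequentially_Suc[THEN iffD2])
    then show ?case
    proof (rule eventually_mono)
      fix n assume "c - \<epsilon> < real (lis (P \<omega> \<inter> hbox 0 (real (Suc n) *\<^sub>R \<Sum>Basis))) / real (Suc n)"
      then have "(c - \<epsilon>) * real (Suc n) < real (lis (P \<omega> \<inter> hbox 0 (real (Suc n) *\<^sub>R \<Sum>Basis)))"
        by (simp only: pos_less_divide_eq of_nat_0_less_iff zero_less_Suc)
      then show "\<omega> \<notin> no_chain 0 (real (Suc n) *\<^sub>R \<Sum>Basis) (nat \<lceil>(c - \<epsilon>) * real (Suc n)\<rceil>)"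
        using elim(2) by (simp only: less_nat_ceiling_iff not_less)
    qed
  qed
qed

text \<open>A cube of side \<open>L * s\<close> contains \<open>L\<close> diagonal cubes of side \<open>s\<close> whose chains concatenate;
  a short chain in the big cube forces a positive fraction of the independent small cubes to be bad.\<close>

lemma lower_tail_exponential:
  assumes eps: "\<epsilon> > 0"
  shows "\<exists>s>0. \<forall>L\<ge>1. cube_prob (real L * s) (nat \<lceil>(c - \<epsilon>) * (real L * s)\<rceil>) \<le> (1/2) ^ L"
proof (cases "c - \<epsilon> > 0")
  \<comment> \<open>The threshold is then 0, and a chain of length 0 always exists, so the event is
    empty.\<close>
  case False
  have "cube_prob (real L * 1) (nat \<lceil>(c - \<epsilon>) * (real L * 1)\<rceil>) \<le> (1/2) ^ L" for L
  proof -
    have "(c - \<epsilon>) * (real L * 1) \<le> 0" using False by (simp add: mult_nonpos_nonneg)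
    then have "nat \<lceil>(c - \<epsilon>) * (real L * 1)\<rceil> = 0" by linarith
    then have "cube_prob (real L * 1) (nat \<lceil>(c - \<epsilon>) * (real L * 1)\<rceil>) = 0"
      by (simp add: cube_prob_def no_chain_def no_chain_at_def chain_in_0)
    then show ?thesis by simp
  qed
  then show ?thesis by (intro exI[of _ 1]) auto
next
  case True
  \<comment> \<open>If \<open>T\<close> is the set of blocks with short chains, the remaining ones
    give \<open>(L - card T) * (c - \<epsilon>/2) < (c - \<epsilon>) * L\<close>, which forces
    \<open>card T \<ge> \<theta> * L\<close>.\<close>
  define \<theta> where "\<theta> = \<epsilon> / (2 * (c + \<epsilon>))"
  have \<theta>: "\<theta> > 0" using eps c_nonneg by (simp add: \<theta>_def)
  \<comment> \<open>Chosen so that \<open>q powr (\<theta> * L) = (1/4) ^ L\<close>. This beats the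
    at most \<open>2 ^ L\<close> possible sets of bad blocks and leaves
    \<open>(1/2) ^ L\<close>.\<close>
  define q where "q = (1/4 :: real) powr (1 / \<theta>)"
  have q: "0 < q" "q \<le> 1" using \<theta> powr_mono'[of 0 "1 / \<theta>" "1/4"] by (auto simp: q_def)
  have "eventually (\<lambda>n. cube_prob (real (Suc n)) (nat \<lceil>(c - \<epsilon>/2) * real (Suc n)\<rceil>) < q) sequentially"
    using cube_prob_lower_tendsto[of "\<epsilon>/2"] eps q by (intro order_tendstoD(2)) auto
  then obtain n where n: "cube_prob (real (Suc n)) (nat \<lceil>(c - \<epsilon>/2) * real (Suc n)\<rceil>) < q"
    by (auto simp: eventually_sequentially)
  define s where "s = real (Suc n)"
  define m0 where "m0 = nat \<lceil>(c - \<epsilon>/2) * s\<rceil>"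
  have s: "s > 0" by (simp add: s_def)
  have p: "cube_prob s m0 \<le> q" using n by (simp add: s_def m0_def)
  define a where "a i = (real i * s) *\<^sub>R (\<Sum>Basis :: 'b)" for i :: nat
  define b where "b i = (real (Suc i) * s) *\<^sub>R (\<Sum>Basis :: 'b)" for i :: nat
  have good: "good_box (a i) (b i)" for i
    unfolding a_def b_def using s by (intro good_cube) auto
  have ord: "slt x y" if "i < j" "x \<in> hbox (a i) (b i)" "y \<in> hbox (a j) (b j)" for i j x y
    unfolding slt_def
  proof
    fix k :: 'b assume k: "k \<in> Basis"
    have "x \<bullet> k \<le> real (Suc i) * s" "real j * s < y \<bullet> k" using that k by (auto simp: hbox_def a_def b_def)
    moreover have "real (Suc i) * s \<le> real j * s" using that s by (intro mult_right_mono) auto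
    ultimately show "x \<bullet> k < y \<bullet> k" by linarith
  qed
  have disj: "disjoint_family_on (\<lambda>k. hbox (a k) (b k)) J" for J
    unfolding disjoint_family_on_def using ord slt_irrefl by (metis disjoint_iff nat_neq_iff)
  have law: "prob (no_chain (a i) (b i) m0) = cube_prob s m0" for i
  proof (rule prob_eq_cube[OF good s])
    have "(\<Prod>j\<in>Basis. b i \<bullet> j - a i \<bullet> j) = (\<Prod>j\<in>(Basis :: 'b set). s)"
      by (intro prod.cong) (auto simp: a_def b_def algebra_simps)
    then show "(\<Prod>j\<in>Basis. b i \<bullet> j - a i \<bullet> j) = s ^ DIM('b)" by simp
  qed
  have "cube_prob (real L * s) (nat \<lceil>(c - \<epsilon>) * (real L * s)\<rceil>) \<le> (1/2) ^ L" if L: "L \<ge> 1" for L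
  proof -
    define m where "m = nat \<lceil>(c - \<epsilon>) * (real L * s)\<rceil>"
    define \<T> where "\<T> = {T. T \<subseteq> {..<L} \<and> \<theta> * real L \<le> real (card T)}"
    define E where "E T = {\<omega>\<in>space M. \<forall>i\<in>T. \<omega> \<in> no_chain (a i) (b i) m0}" for T
    have T: "finite T" if "T \<in> \<T>" for T using that finite_subset by (auto simp: \<T>_def)
    have fin: "finite \<T>" by (rule finite_subset[of _ "Pow {..<L}"]) (auto simp: \<T>_def)
    have cardT: "card \<T> \<le> 2 ^ L"
      using card_mono[of "Pow {..<L}" \<T>] by (auto simp: \<T>_def card_Pow)
    have Es: "E T \<in> events" if "T \<in> \<T>" for T
      unfolding E_def
      by (rule sets.sets_Collect_finite_All[OF _ T[OF that]])
        (use sets_no_chain[OF good] sets.sets_into_space in \<open>auto simp: Int_absorb1 Collect_conj_eq\<close>)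
    have Ep: "prob (E T) \<le> (1/4) ^ L" if "T \<in> \<T>" for T
    proof -
      have "prob (E T) = cube_prob s m0 ^ card T"
        unfolding E_def by (subst no_chain_prod[OF T[OF that] good disj]) (simp add: law)
      also have "\<dots> \<le> q ^ card T" using p by (intro power_mono) (auto simp: cube_prob_def)
      also have "\<dots> = (1/4) powr (real (card T) / \<theta>)"
        using q by (simp add: q_def powr_powr powr_realpow[symmetric])
      also have "\<dots> \<le> (1/4) powr (real L)"
        using that \<theta> by (intro powr_mono') (auto simp: \<T>_def field_simps)
      finally show ?thesis by (simp add: powr_realpow)
    qed
    have gL: "good_box 0 ((real L * s) *\<^sub>R \<Sum>Basis)" using L s by (intro good_cube0) auto
    have "cube_prob (real L * s) m \<le> prob (\<Union>T\<in>\<T>. E T)"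
      unfolding cube_prob_def
    proof (rule finite_measure_mono_AE)
      show "(\<Union>T\<in>\<T>. E T) \<in> events" using Es fin by blast
      have "AE \<omega> in M. \<forall>i. \<omega> \<in> no_chain (a i) (b i) m0 \<longleftrightarrow> lis (P \<omega> \<inter> hbox (a i) (b i)) < m0"
        by (rule iffD2[OF AE_all_countable]) (auto intro: AE_no_chain_iff good)
      with AE_no_chain_iff[OF gL, of m]
      show "AE \<omega> in M. \<omega> \<in> no_chain 0 ((real L * s) *\<^sub>R \<Sum>Basis) m \<longrightarrow> \<omega> \<in> (\<Union>T\<in>\<T>. E T)"
        using AE_locally_finite AE_space
      proof eventually_elim
        case (elim \<omega>)
        show ?case
        proof
          assume short: "\<omega> \<in> no_chain 0 ((real L * s) *\<^sub>R \<Sum>Basis) m"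
          have fin: "finite (P \<omega> \<inter> hbox x y)" for x y using elim(3) bounded_hbox by blast
          define T where "T = {i\<in>{..<L}. \<omega> \<in> no_chain (a i) (b i) m0}"
          \<comment> \<open>Bad blocks contribute nothing; every other block contributes a chain of
            length \<open>m0\<close>.\<close>
          define g where "g i = (if i \<in> T then 0 else m0)" for i
          have "chain_in slt (\<Union>i<L. P \<omega> \<inter> hbox (a i) (b i)) (\<Sum>i<L. g i)"
          proof (rule chain_in_UN)
            fix i assume i: "i < L"
            show "chain_in slt (P \<omega> \<inter> hbox (a i) (b i)) (g i)"
            proof (cases "i \<in> T")
              case False
              then have "\<not> lis (P \<omega> \<inter> hbox (a i) (b i)) < m0" using elim i by (auto simp: T_def)
              then show ?thesis using False by (simp add: lis_less_iff[OF fin] g_def)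
            qed (simp add: g_def chain_in_0)
          qed (use ord in auto)
          moreover have "(\<Union>i<L. P \<omega> \<inter> hbox (a i) (b i)) \<subseteq> P \<omega> \<inter> hbox 0 ((real L * s) *\<^sub>R \<Sum>Basis)"
          proof -
            have "hbox (a i) (b i) \<subseteq> hbox 0 ((real L * s) *\<^sub>R \<Sum>Basis)" if "i < L" for i
              using that s by (intro hbox_mono) (auto simp: a_def b_def intro!: mult_right_mono)
            then show ?thesis by blast
          qed
          ultimately have "chain_in slt (P \<omega> \<inter> hbox 0 ((real L * s) *\<^sub>R \<Sum>Basis)) (\<Sum>i<L. g i)"
            by (rule chain_in_mono)
          then have "(\<Sum>i<L. g i) \<le> lis (P \<omega> \<inter> hbox 0 ((real L * s) *\<^sub>R \<Sum>Basis))"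
            using le_lis_iff[OF fin] by blast
          also have "\<dots> < m" using elim short by auto
          finally have "real (\<Sum>i<L. g i) < (c - \<epsilon>) * (real L * s)" unfolding m_def less_nat_ceiling_iff .
          moreover have "(\<Sum>i<L. g i) = (L - card T) * m0"
          proof -
            have "(\<Sum>i<L. g i) = (\<Sum>i\<in>{..<L} - T. m0)"
              unfolding g_def by (rule sum.mono_neutral_cong_right) auto
            moreover have "card ({..<L} - T) = L - card T" by (subst card_Diff_subset) (auto simp: T_def)
            ultimately show ?thesis by simp
          qed
          moreover have cT: "card T \<le> L" using card_mono[of "{..<L}" T] by (auto simp: T_def)
          ultimately have 1: "(real L - real (card T)) * real m0 < (c - \<epsilon>) * (real L * s)" by (simp add: of_nat_diff)
          have "real m0 \<ge> (c - \<epsilon>/2) * s" unfolding m0_def by linarith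
          then have "(real L - real (card T)) * ((c - \<epsilon>/2) * s) \<le> (real L - real (card T)) * real m0"
            using cT by (intro mult_left_mono) auto
          with 1 have "((real L - real (card T)) * (c - \<epsilon>/2)) * s < ((c - \<epsilon>) * real L) * s" by (simp add: mult_ac)
          then have "(real L - real (card T)) * (c - \<epsilon>/2) < (c - \<epsilon>) * real L" using s by simp
          then have "real L * (\<epsilon>/2) < real (card T) * (c - \<epsilon>/2)" by (simp add: algebra_simps)
          also have "\<dots> \<le> real (card T) * (c + \<epsilon>)" using eps by (intro mult_left_mono) auto
          finally have "\<theta> * real L \<le> real (card T)" using eps c_nonneg by (simp add: \<theta>_def field_simps)
          then have "T \<in> \<T>" by (auto simp: \<T>_def T_def)
          moreover have "\<omega> \<in> E T" using elim(4) by (auto simp: E_def T_def)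
          ultimately show "\<omega> \<in> (\<Union>T\<in>\<T>. E T)" by blast
        qed
      qed
    qed
    also have "\<dots> \<le> (\<Sum>T\<in>\<T>. prob (E T))"
      by (rule finite_measure_subadditive_finite[OF fin]) (use Es in auto)
    also have "\<dots> \<le> (\<Sum>T\<in>\<T>. (1/4) ^ L)" by (rule sum_mono) (rule Ep)
    also have "\<dots> = real (card \<T>) * (1/4) ^ L" by simp
    also have "\<dots> \<le> 2 ^ L * (1/4) ^ L" using of_nat_mono[OF cardT, where 'a=real] by (intro mult_right_mono) auto
    also have "\<dots> = (1/2) ^ L" by (simp add: power_mult_distrib[symmetric])
    finally show ?thesis by (simp add: m_def)
  qed
  then show ?thesis using s by blast
qed

end

section \<open>The limit for general boxes\<close>

lemma lis_empty: "lis {} = 0"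
  using le_lis_iff[of "{}" "lis {}"] by (auto simp: chain_in_def)

text \<open>The left side is one term of the exponential series. With \<open>x = m\<close> it is the
  elementary form of Stirling's bound.\<close>

lemma power_over_fact_le_exp:
  fixes x :: real
  assumes "0 \<le> x"
  shows "x ^ m / fact m \<le> exp x"
proof -
  have s: "(\<lambda>n. x ^ n /\<^sub>R fact n) sums exp x" by (rule exp_converges)
  have "(\<Sum>n\<in>{m}. x ^ n /\<^sub>R fact n) \<le> exp x"
    by (rule sum_le_suminf[OF sums_summable[OF s], unfolded sums_unique[OF s, symmetric]]) (use assms in auto)
  then show ?thesis by (simp add: field_simps)
qed

section \<open>From summable tails to almost sure bounds\<close>

context poisson_half_space
begin

lemma good_box_scale: "good_box a b \<Longrightarrow> s > 0 \<Longrightarrow> good_box (s *\<^sub>R a) (s *\<^sub>R b)"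
  by (auto simp: good_box_def slt_def)

text \<open>The first Borel-Cantelli lemma, applied after a shift to \<open>Suc n\<close> because
  the scaled box degenerates at \<open>n = 0\<close>.\<close>

lemma AE_eventually_no_chain:
  assumes "\<And>n. n > 0 \<Longrightarrow> good_box (a n) (b n)" "summable (\<lambda>n. 1 - prob (no_chain (a n) (b n) (m n)))"
  shows "AE \<omega> in M. eventually (\<lambda>n::nat. lis (P \<omega> \<inter> hbox (a n) (b n)) < m n) sequentially"
proof -
  have "summable (\<lambda>n. prob (space M - no_chain (a (Suc n)) (b (Suc n)) (m (Suc n))))"
    using summable_iff_shift[of "\<lambda>n. 1 - prob (no_chain (a n) (b n) (m n))" 1] assms(2)
    by (simp add: prob_compl sets_no_chain[OF assms(1)])
  then have "AE \<omega> in M. eventually (\<lambda>n. \<omega> \<in> space M - (space M - no_chain (a (Suc n)) (b (Suc n)) (m (Suc n)))) sequentially"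
    by (intro borel_cantelli_AE1) (auto intro: sets_no_chain assms(1) simp: emeasure_eq_measure)
  moreover have "AE \<omega> in M. \<forall>n. \<omega> \<in> no_chain (a (Suc n)) (b (Suc n)) (m (Suc n)) \<longleftrightarrow> lis (P \<omega> \<inter> hbox (a (Suc n)) (b (Suc n))) < m (Suc n)"
    by (rule iffD2[OF AE_all_countable]) (auto intro: AE_no_chain_iff assms(1))
  ultimately show ?thesis
  proof eventually_elim
    case (elim \<omega>)
    from elim(1) have "eventually (\<lambda>n. lis (P \<omega> \<inter> hbox (a (Suc n)) (b (Suc n))) < m (Suc n)) sequentially"
      by (rule eventually_mono) (use elim(2) in auto)
    then show ?case by (rule eventually_sequentially_Suc[THEN iffD1])
  qed
qed

lemma AE_eventually_chain:
  assumes "\<And>n. n > 0 \<Longrightarrow> good_box (a n) (b n)" "summable (\<lambda>n. prob (no_chain (a n) (b n) (m n)))"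
  shows "AE \<omega> in M. eventually (\<lambda>n::nat. m n \<le> lis (P \<omega> \<inter> hbox (a n) (b n))) sequentially"
proof -
  have "summable (\<lambda>n. prob (no_chain (a (Suc n)) (b (Suc n)) (m (Suc n))))"
    using summable_iff_shift[of "\<lambda>n. prob (no_chain (a n) (b n) (m n))" 1] assms(2) by simp
  then have "AE \<omega> in M. eventually (\<lambda>n. \<omega> \<in> space M - no_chain (a (Suc n)) (b (Suc n)) (m (Suc n))) sequentially"
    by (intro borel_cantelli_AE1) (auto intro: sets_no_chain assms(1) simp: emeasure_eq_measure)
  moreover have "AE \<omega> in M. \<forall>n. \<omega> \<in> no_chain (a (Suc n)) (b (Suc n)) (m (Suc n)) \<longleftrightarrow> lis (P \<omega> \<inter> hbox (a (Suc n)) (b (Suc n))) < m (Suc n)"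
    by (rule iffD2[OF AE_all_countable]) (auto intro: AE_no_chain_iff assms(1))
  ultimately show ?thesis
  proof eventually_elim
    case (elim \<omega>)
    from elim(1) have "eventually (\<lambda>n. m (Suc n) \<le> lis (P \<omega> \<inter> hbox (a (Suc n)) (b (Suc n)))) sequentially"
      by (rule eventually_mono) (use elim(2) in auto)
    then show ?case by (rule eventually_sequentially_Suc[THEN iffD1])
  qed
qed

text \<open>In the counting bound, \<open>fact m \<ge> (m / exp 1) ^ m\<close> and
  \<open>m \<ge> 2 * exp 1 * s\<close> give \<open>s ^ m / fact m \<le> (1/2) ^ m\<close>. The bound
  is the \<open>DIM('b)\<close>-th power of this quantity, hence no larger than
  \<open>(1/2) ^ m\<close>.\<close>

lemma prob_long_chain:
  assumes "good_box a b" "(\<Prod>i\<in>Basis. b \<bullet> i - a \<bullet> i) \<le> s ^ DIM('b)" "0 \<le> s" "2 * exp 1 * s \<le> real m"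
  shows "1 - prob (no_chain a b m) \<le> (1/2) ^ m"
proof -
  let ?v = "\<Prod>i\<in>Basis. b \<bullet> i - a \<bullet> i"
  have v: "0 \<le> ?v" using assms(1) by (intro prod_nonneg) (auto simp: good_box_def slt_def less_imp_le)
  have "s ^ m / fact m \<le> (real m / (2 * exp 1)) ^ m / fact m"
    using assms by (intro divide_right_mono power_mono) (auto simp: field_simps)
  also have "\<dots> = (real m ^ m / fact m) * (1 / (2 * exp 1)) ^ m" by (simp add: power_divide)
  also have "\<dots> \<le> exp (real m) * (1 / (2 * exp 1)) ^ m"
    by (intro mult_right_mono power_over_fact_le_exp) auto
  also have "\<dots> = (1/2) ^ m" by (simp add: power_divide power_mult_distrib exp_of_nat_mult[of m 1, symmetric])
  finally have s: "s ^ m / fact m \<le> (1/2) ^ m" .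
  have "1 - prob (no_chain a b m) \<le> ?v ^ m / fact m ^ DIM('b)" by (rule prob_chain_le[OF assms(1)])
  also have "\<dots> \<le> (s ^ DIM('b)) ^ m / fact m ^ DIM('b)"
    using v assms(2) by (intro divide_right_mono power_mono) auto
  also have "\<dots> = (s ^ m / fact m) ^ DIM('b)" by (simp add: power_divide power_mult[symmetric] mult.commute)
  also have "\<dots> \<le> ((1/2) ^ m) ^ DIM('b)" using s assms(3) by (intro power_mono) auto
  also have "\<dots> \<le> ((1/2) ^ m) ^ 1" by (rule power_decreasing) (auto simp: power_le_one DIM_positive Suc_leI)
  finally show ?thesis by simp
qed

end

section \<open>Two-sided almost sure limit for scaled boxes\<close>

context chain_constant
begin

lemma volume_scale:
  fixes a b :: 'b
  assumes "0 < (\<Prod>i\<in>Basis. b \<bullet> i - a \<bullet> i)"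
  shows "(\<Prod>i\<in>Basis. (s *\<^sub>R b) \<bullet> i - (s *\<^sub>R a) \<bullet> i)
    = ((\<Prod>i\<in>Basis. b \<bullet> i - a \<bullet> i) powr (1 / DIM('b)) * s) ^ DIM('b)"
proof -
  define V where "V = (\<Prod>i\<in>Basis. b \<bullet> i - a \<bullet> i)"
  have "V = (V powr (1 / DIM('b))) ^ DIM('b)"
    using assms[folded V_def] by (simp add: powr_realpow[symmetric] powr_powr)
  then have V: "V * s ^ DIM('b) = (V powr (1 / DIM('b)) * s) ^ DIM('b)" by (simp add: power_mult_distrib)
  have "(\<Prod>i\<in>Basis. (s *\<^sub>R b) \<bullet> i - (s *\<^sub>R a) \<bullet> i) = (\<Prod>i\<in>Basis. s * (b \<bullet> i - a \<bullet> i))"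
    by (simp add: algebra_simps)
  also have "\<dots> = V * s ^ DIM('b)" by (simp add: prod.distrib V_def)
  finally show ?thesis unfolding V unfolding V_def .
qed

text \<open>The scaled box has the law of a cube of side \<open>w * n\<close>, which contains a cube
  made of \<open>L n\<close> blocks of side \<open>s\<close>. The exponential tail is summable over
  all \<open>n\<close>, so no interpolation between scales is needed; the additional
  \<open>- \<epsilon>\<close> absorbs the rounding in \<open>L n\<close>.\<close>

lemma lis_box_lower:
  assumes good: "good_box a b" and eps: "\<epsilon> > 0"
  defines "w \<equiv> (\<Prod>i\<in>Basis. b \<bullet> i - a \<bullet> i) powr (1 / DIM('b))"
  shows "AE \<omega> in M. eventually (\<lambda>n. (c - \<epsilon>) * w - \<epsilon> < real (lis (P \<omega> \<inter> hbox (real n *\<^sub>R a) (real n *\<^sub>R b))) / real n) sequentially"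
proof -
  have v: "0 < (\<Prod>i\<in>Basis. b \<bullet> i - a \<bullet> i)"
    using good by (intro prod_pos) (auto simp: good_box_def slt_def)
  then have w: "w > 0" unfolding w_def by (intro iffD2[OF powr_gt_zero]) linarith
  obtain s where s: "s > 0" and tail: "\<And>L. L \<ge> 1 \<Longrightarrow> cube_prob (real L * s) (nat \<lceil>(c - \<epsilon>) * (real L * s)\<rceil>) \<le> (1/2) ^ L"
    using lower_tail_exponential[OF eps] by blast
  define L where "L n = nat \<lfloor>w * real n / s\<rfloor>" for n
  define m where "m n = nat \<lceil>(c - \<epsilon>) * (real (L n) * s)\<rceil>" for n
  have L: "real (L n) \<le> w * real n / s" "w * real n / s < real (L n) + 1" for n
  proof -
    have "0 \<le> w * real n / s" using w s by simp
    then show "real (L n) \<le> w * real n / s" "w * real n / s < real (L n) + 1" unfolding L_def by linarith+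
  qed
  have good_n: "good_box (real n *\<^sub>R a) (real n *\<^sub>R b)" if "n > 0" for n
    using good_box_scale[OF good, of "real n"] that by simp
  have p: "prob (no_chain (real n *\<^sub>R a) (real n *\<^sub>R b) (m n)) \<le> 2 * ((1/2) powr (w / s)) ^ n" for n
  proof -
    have "prob (no_chain (real n *\<^sub>R a) (real n *\<^sub>R b) (m n)) \<le> (1/2) ^ L n"
    proof (cases "L n = 0")
      case False
      then have "n > 0" by (intro gr0I) (auto simp: L_def)
      have "prob (no_chain (real n *\<^sub>R a) (real n *\<^sub>R b) (m n)) = cube_prob (w * real n) (m n)"
        by (rule prob_eq_cube[OF good_n]) (use \<open>n > 0\<close> w volume_scale[OF v] in \<open>auto simp: w_def\<close>)
      also have "\<dots> \<le> cube_prob (real (L n) * s) (m n)"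
        by (rule cube_prob_anti) (use False s L[of n] in \<open>auto simp: field_simps\<close>)
      also have "\<dots> \<le> (1/2) ^ L n" unfolding m_def using False by (intro tail) simp
      finally show ?thesis .
    qed simp
    also have "\<dots> = (1/2) powr (real (L n))" by (simp add: powr_realpow)
    \<comment> \<open>Rounding down loses less than one block, which costs the factor 2.\<close>
    also have "\<dots> \<le> (1/2) powr (w * real n / s - 1)" using L[of n] by (intro powr_mono') auto
    also have "\<dots> = 2 * ((1/2) powr (w / s)) ^ n"
      by (simp add: powr_diff powr_realpow[symmetric] powr_powr)
    finally show ?thesis .
  qed
  have "summable (\<lambda>n. 2 * ((1/2 :: real) powr (w / s)) ^ n)"
  proof (intro summable_mult summable_geometric)
    have "(1/2 :: real) powr (w / s) < (1/2) powr 0" using w s by (intro powr_less_mono') auto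
    then show "norm ((1/2 :: real) powr (w / s)) < 1" by simp
  qed
  then have "summable (\<lambda>n. prob (no_chain (real n *\<^sub>R a) (real n *\<^sub>R b) (m n)))"
    by (rule summable_comparison_test'[where N=0]) (use p in auto)
  then have "AE \<omega> in M. eventually (\<lambda>n. m n \<le> lis (P \<omega> \<inter> hbox (real n *\<^sub>R a) (real n *\<^sub>R b))) sequentially"
    by (intro AE_eventually_chain good_n)
  then show ?thesis
  proof eventually_elim
    case (elim \<omega>)
    have lim: "(\<lambda>n. w - s / real n) \<longlonglongrightarrow> w - 0"
      by (intro tendsto_diff tendsto_const lim_const_over_n)
    have "(\<lambda>n. real (L n) * s / real n) \<longlonglongrightarrow> w"
    proof (rule tendsto_sandwich[where f="\<lambda>n. w - s / real n" and h="\<lambda>_. w"])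
      show "\<forall>\<^sub>F n in sequentially. w - s / real n \<le> real (L n) * s / real n"
        using eventually_gt_at_top[of 0]
      proof eventually_elim
        case (elim n)
        have "w * real n \<le> real (L n) * s + s" using L(2)[of n] s by (simp add: field_simps)
        then have "w \<le> (real (L n) * s + s) / real n" using elim by (simp add: pos_le_divide_eq)
        then show ?case by (simp add: add_divide_distrib)
      qed
      show "\<forall>\<^sub>F n in sequentially. real (L n) * s / real n \<le> w"
        using eventually_gt_at_top[of 0]
      proof eventually_elim
        case (elim n)
        have "real (L n) * s \<le> w * real n" using L(1)[of n] s by (simp add: field_simps)
        then show ?case using elim by (simp add: field_simps)
      qed
    qed (use lim in simp_all)
    then have "(\<lambda>n. (c - \<epsilon>) * (real (L n) * s / real n)) \<longlonglongrightarrow> (c - \<epsilon>) * w" by (intro tendsto_mult tendsto_const)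
    then have "eventually (\<lambda>n. (c - \<epsilon>) * w - \<epsilon> < (c - \<epsilon>) * (real (L n) * s / real n)) sequentially"
      using eps by (intro order_tendstoD(1)) auto
    with elim show ?case
      using eventually_gt_at_top[of 0]
    proof eventually_elim
      case (elim n)
      have "(c - \<epsilon>) * (real (L n) * s) \<le> real (m n)" unfolding m_def by linarith
      also have "\<dots> \<le> real (lis (P \<omega> \<inter> hbox (real n *\<^sub>R a) (real n *\<^sub>R b)))" using elim by simp
      finally have "(c - \<epsilon>) * (real (L n) * s) / real n \<le> real (lis (P \<omega> \<inter> hbox (real n *\<^sub>R a) (real n *\<^sub>R b))) / real n"
        by (rule divide_right_mono) simp
      then show ?case using elim by simp
    qed
  qed
qed

text \<open>Summability is available along geometric scales only. Each \<open>n\<close> lies between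
  consecutive powers of some \<open>r > 1\<close>, and the box at scale \<open>n\<close> is covered
  by one slightly larger box at scale \<open>r ^ k\<close>; choosing \<open>r\<close> near 1 makes
  the loss small.\<close>

lemma lis_box_upper:
  fixes a b :: 'b
  assumes good: "good_box a b" and eps: "\<epsilon> > 0"
  defines "w \<equiv> (\<Prod>i\<in>Basis. b \<bullet> i - a \<bullet> i) powr (1 / DIM('b))"
  shows "AE \<omega> in M. eventually (\<lambda>n. real (lis (P \<omega> \<inter> hbox (real n *\<^sub>R a) (real n *\<^sub>R b))) / real n < c * w + \<epsilon>) sequentially"
proof -
  have v: "0 < (\<Prod>i\<in>Basis. b \<bullet> i - a \<bullet> i)"
    using good by (intro prod_pos) (auto simp: good_box_def slt_def)
  then have w: "w > 0" unfolding w_def by (intro iffD2[OF powr_gt_zero]) linarith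
  \<comment> \<open>With \<open>w' r < w + 1\<close> this makes
    \<open>\<delta> * w' r \<le> \<epsilon>/2\<close>.\<close>
  define \<delta> where "\<delta> = \<epsilon> / (2 * (w + 1))"
  have \<delta>: "\<delta> > 0" using eps w by (simp add: \<delta>_def)
  \<comment> \<open>\<open>a' r\<close> and \<open>b' r\<close> are the corners of the smallest box
    containing all multiples, by factors in \<open>[1, r]\<close>, of the given one. The minimum and
    maximum account for coordinates of either sign.\<close>
  define a' where "a' r = (\<Sum>i\<in>Basis. min (a \<bullet> i) (r * (a \<bullet> i)) *\<^sub>R i)" for r
  define b' where "b' r = (\<Sum>i\<in>Basis. max (b \<bullet> i) (r * (b \<bullet> i)) *\<^sub>R i)" for r
  define w' where "w' r = (\<Prod>i\<in>Basis. b' r \<bullet> i - a' r \<bullet> i) powr (1 / DIM('b))" for r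
  have "(w' \<longlongrightarrow> (\<Prod>i\<in>Basis. max (b \<bullet> i) (1 * (b \<bullet> i)) - min (a \<bullet> i) (1 * (a \<bullet> i))) powr (1 / DIM('b))) (at_right 1)"
    unfolding w'_def a'_def b'_def
    by (simp, intro tendsto_powr tendsto_prod tendsto_diff tendsto_max tendsto_min tendsto_const)
      (use v in \<open>auto intro!: tendsto_eq_intros simp del: prod_zero_iff\<close>)
  then have w'w: "(w' \<longlongrightarrow> w) (at_right 1)" by (simp add: w_def)
  have "eventually (\<lambda>r. w' r < w + 1) (at_right 1)" using w'w by (rule order_tendstoD(2)) simp
  moreover have "((\<lambda>r. c * w' r) \<longlongrightarrow> c * w) (at_right 1)" using w'w by (intro tendsto_mult tendsto_const)
  then have "eventually (\<lambda>r. c * w' r < c * w + \<epsilon>/2) (at_right 1)" by (rule order_tendstoD(2)) (use eps in simp)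
  moreover have "eventually (\<lambda>r::real. 1 < r) (at_right 1)" by (rule eventually_at_right_less)
  ultimately have "eventually (\<lambda>r. w' r < w + 1 \<and> c * w' r < c * w + \<epsilon>/2 \<and> 1 < r) (at_right 1)"
    by eventually_elim auto
  then obtain r where r: "w' r < w + 1" "c * w' r < c * w + \<epsilon>/2" "1 < r"
    using eventually_happens'[OF trivial_limit_at_right_real] by blast
  have cw: "(c + \<delta>) * w' r < c * w + \<epsilon>"
  proof -
    have "\<delta> * w' r \<le> \<delta> * (w + 1)" using r \<delta> by (intro mult_left_mono) auto
    also have "\<dots> = \<epsilon>/2" using w by (simp add: \<delta>_def field_simps)
    finally show ?thesis using r by (simp add: distrib_right)
  qed
  have ab': "a' r \<bullet> i = min (a \<bullet> i) (r * (a \<bullet> i))" "b' r \<bullet> i = max (b \<bullet> i) (r * (b \<bullet> i))" if "i \<in> Basis" for i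
    using that by (auto simp: a'_def b'_def)
  have good': "good_box (a' r) (b' r)"
    unfolding good_box_def slt_def
  proof
    show "\<forall>i\<in>Basis. a' r \<bullet> i < b' r \<bullet> i"
      using good by (auto simp: ab' good_box_def slt_def less_max_iff_disj min_less_iff_disj)
    show "0 \<le> a' r \<bullet> e" using good r by (auto simp: ab'[OF e] good_box_def)
  qed
  have v': "0 < (\<Prod>i\<in>Basis. b' r \<bullet> i - a' r \<bullet> i)"
    using good' by (intro prod_pos) (auto simp: good_box_def slt_def)
  then have w'0: "w' r > 0" unfolding w'_def by (intro iffD2[OF powr_gt_zero]) linarith
  obtain R0 where R0: "R0 > 1" and sm: "\<forall>R\<ge>R0. \<forall>s0>0.
      summable (\<lambda>k. 1 - cube_prob (s0 * R ^ k) (nat \<lceil>(c + \<delta>) * (s0 * R ^ k)\<rceil>))"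
    using upper_tail_summable[OF \<delta>] by blast
  \<comment> \<open>Tails are summable for ratios at least \<open>R0\<close>, possibly large, while
    \<open>r\<close> must stay near 1. Along exponents \<open>i + j * k\<close> with
    \<open>i\<close> fixed the ratio is \<open>r ^ j\<close>, which exceeds \<open>R0\<close>; the
    residues \<open>i\<close> below \<open>j\<close> together cover all exponents.\<close>
  obtain j where j: "R0 < r ^ j" using real_arch_pow[OF r(3)] by blast
  then have j0: "j > 0" using R0 by (intro gr0I) auto
  define B where "B k = hbox (r ^ k *\<^sub>R a' r) (r ^ k *\<^sub>R b' r)" for k
  have "AE \<omega> in M. \<forall>i. eventually (\<lambda>k. real (lis (P \<omega> \<inter> B (i + j * k))) < (c + \<delta>) * w' r * r ^ (i + j * k)) sequentially"
  proof (rule iffD2[OF AE_all_countable], rule allI)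
    fix i
    have e1: "w' r * r ^ i * (r ^ j) ^ k = w' r * r ^ (i + j * k)" for k
      by (simp add: power_add power_mult)
    have gk: "good_box (r ^ (i + j * k) *\<^sub>R a' r) (r ^ (i + j * k) *\<^sub>R b' r)" for k
      using good_box_scale[OF good'] r by simp
    have "prob (no_chain (r ^ (i + j * k) *\<^sub>R a' r) (r ^ (i + j * k) *\<^sub>R b' r) m) = cube_prob (w' r * r ^ (i + j * k)) m" for k m
      by (rule prob_eq_cube[OF gk]) (use w'0 r volume_scale[OF v'] in \<open>auto simp: w'_def\<close>)
    moreover have "summable (\<lambda>k. 1 - cube_prob (w' r * r ^ i * (r ^ j) ^ k) (nat \<lceil>(c + \<delta>) * (w' r * r ^ i * (r ^ j) ^ k)\<rceil>))"
      using j w'0 r by (intro sm[rule_format]) auto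
    ultimately have "summable (\<lambda>k. 1 - prob (no_chain (r ^ (i + j * k) *\<^sub>R a' r) (r ^ (i + j * k) *\<^sub>R b' r) (nat \<lceil>(c + \<delta>) * (w' r * r ^ (i + j * k))\<rceil>)))"
      unfolding e1 by simp
    from AE_eventually_no_chain[OF gk this]
    show "AE \<omega> in M. eventually (\<lambda>k. real (lis (P \<omega> \<inter> B (i + j * k))) < (c + \<delta>) * w' r * r ^ (i + j * k)) sequentially"
      unfolding less_nat_ceiling_iff B_def by (simp add: mult.assoc)
  qed
  then show ?thesis
    using AE_locally_finite
  proof eventually_elim
    case (elim \<omega>)
    have "eventually (\<lambda>k. real (lis (P \<omega> \<inter> B k)) < (c + \<delta>) * w' r * r ^ k) sequentially"
      by (rule eventually_residues[OF j0]) (use elim in auto)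
    then obtain K where K: "\<And>k. k \<ge> K \<Longrightarrow> real (lis (P \<omega> \<inter> B k)) < (c + \<delta>) * w' r * r ^ k"
      by (auto simp: eventually_sequentially)
    have "eventually (\<lambda>n. r ^ K \<le> real n) sequentially"
      using filterlim_real_sequentially by (auto simp: filterlim_at_top)
    then show ?case
    proof (rule eventually_mono)
      fix n assume n: "r ^ K \<le> real n"
      have n1: "real n \<ge> 1" using n r one_le_power[of r K] by linarith
      \<comment> \<open>The largest exponent with \<open>r ^ k \<le> n\<close>, so that
        \<open>n / r ^ k\<close> lies in \<open>[1, r]\<close> and the covering box applies.\<close>
      define k where "k = nat \<lfloor>log r (real n)\<rfloor>"
      have lg: "0 \<le> log r (real n)" using n1 r by simp
      have "real k \<le> log r (real n)" "log r (real n) < real k + 1" unfolding k_def using lg by linarith+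
      then have k1: "r ^ k \<le> real n" "real n < r * r ^ k"
        using r n1 le_log_iff[of r "real n" "real k"] log_less_iff[of r "real n" "real k + 1"]
        by (auto simp: powr_realpow powr_add mult.commute)
      have "real K \<le> log r (real n)" using n r n1 by (simp add: le_log_iff powr_realpow)
      then have "K \<le> k" unfolding k_def by linarith
      have rk: "r ^ k > 0" using r by simp
      define \<rho> where "\<rho> = real n / r ^ k"
      have \<rho>: "1 \<le> \<rho>" "\<rho> \<le> r" "real n = r ^ k * \<rho>"
        using k1 rk by (auto simp: \<rho>_def field_simps less_imp_le)
      have "hbox (real n *\<^sub>R a) (real n *\<^sub>R b) \<subseteq> B k"
        unfolding B_def
      proof (rule hbox_mono)
        fix i :: 'b assume i: "i \<in> Basis"
        have "min (a \<bullet> i) (r * (a \<bullet> i)) \<le> \<rho> * (a \<bullet> i)"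
        proof (cases "0 \<le> a \<bullet> i")
          case True
          then have "1 * (a \<bullet> i) \<le> \<rho> * (a \<bullet> i)" using \<rho> by (intro mult_right_mono)
          then show ?thesis by simp
        next
          case False
          then have "r * (a \<bullet> i) \<le> \<rho> * (a \<bullet> i)" using \<rho> by (intro mult_right_mono_neg) auto
          then show ?thesis by simp
        qed
        then show "(r ^ k *\<^sub>R a' r) \<bullet> i \<le> (real n *\<^sub>R a) \<bullet> i"
          using rk by (simp add: ab'[OF i] \<rho>(3) mult.assoc mult_left_mono)
        have "\<rho> * (b \<bullet> i) \<le> max (b \<bullet> i) (r * (b \<bullet> i))"
        proof (cases "0 \<le> b \<bullet> i")
          case True
          then have "\<rho> * (b \<bullet> i) \<le> r * (b \<bullet> i)" using \<rho> by (intro mult_right_mono)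
          then show ?thesis by simp
        next
          case False
          then have "\<rho> * (b \<bullet> i) \<le> 1 * (b \<bullet> i)" using \<rho> by (intro mult_right_mono_neg) auto
          then show ?thesis by simp
        qed
        then show "(real n *\<^sub>R b) \<bullet> i \<le> (r ^ k *\<^sub>R b' r) \<bullet> i"
          using rk by (simp add: ab'[OF i] \<rho>(3) mult.assoc mult_left_mono)
      qed
      then have "lis (P \<omega> \<inter> hbox (real n *\<^sub>R a) (real n *\<^sub>R b)) \<le> lis (P \<omega> \<inter> B k)"

        using elim(2) bounded_hbox by (intro lis_mono) (auto simp: B_def)
      then have "real (lis (P \<omega> \<inter> hbox (real n *\<^sub>R a) (real n *\<^sub>R b))) \<le> real (lis (P \<omega> \<inter> B k))" by simp
      also have "\<dots> < (c + \<delta>) * w' r * r ^ k" by (rule K) fact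
      also have "\<dots> \<le> (c + \<delta>) * w' r * real n" using k1 c_nonneg \<delta> w'0 by (intro mult_left_mono) auto
      also have "\<dots> \<le> (c * w + \<epsilon>) * real n" using cw by (intro mult_right_mono) auto
      finally have "real (lis (P \<omega> \<inter> hbox (real n *\<^sub>R a) (real n *\<^sub>R b))) < (c * w + \<epsilon>) * real n" .
      then show "real (lis (P \<omega> \<inter> hbox (real n *\<^sub>R a) (real n *\<^sub>R b))) / real n < c * w + \<epsilon>"
        using n1 by (simp add: pos_divide_less_eq)
    qed
  qed
qed

theorem lis_box_tendsto:
  fixes a b :: 'b
  assumes ab: "\<And>i. i \<in> Basis \<Longrightarrow> a \<bullet> i \<le> b \<bullet> i" and ae: "0 \<le> a \<bullet> e"
  shows "AE \<omega> in M. (\<lambda>n. real (lis (P \<omega> \<inter> hbox (real n *\<^sub>R a) (real n *\<^sub>R b))) / real n)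
    \<longlonglongrightarrow> c * (\<Prod>i\<in>Basis. b \<bullet> i - a \<bullet> i) powr (1 / DIM('b))"
proof (cases "slt a b")
  \<comment> \<open>The degenerate case arises for starting points that share a coordinate with
    \<open>x\<close>: the half-open box is empty and its volume is 0.\<close>
  case False
  then obtain i where i: "i \<in> Basis" "a \<bullet> i = b \<bullet> i" using ab by (force simp: slt_def)
  then have "hbox (real n *\<^sub>R a) (real n *\<^sub>R b) = {}" for n by (force simp: hbox_def)
  moreover have "(\<Prod>i\<in>Basis. b \<bullet> i - a \<bullet> i) = 0" 
    by (rule prod_zero[OF finite_Basis], rule bexI[OF _ i(1)]) (simp add: i)
  ultimately show ?thesis by (simp add: lis_empty del: prod_zero_iff)
next
  case True
  then have good: "good_box a b" using ae by (simp add: good_box_def)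
  define w where "w = (\<Prod>i\<in>Basis. b \<bullet> i - a \<bullet> i) powr (1 / DIM('b))"
  have w: "0 \<le> w" by (simp add: w_def)
  have "AE \<omega> in M. \<forall>k::nat. eventually (\<lambda>n. (c - 1 / Suc k) * w - 1 / Suc k < real (lis (P \<omega> \<inter> hbox (real n *\<^sub>R a) (real n *\<^sub>R b))) / real n) sequentially"
    unfolding w_def by (rule iffD2[OF AE_all_countable], rule allI, rule lis_box_lower[OF good]) simp
  moreover have "AE \<omega> in M. \<forall>k::nat. eventually (\<lambda>n. real (lis (P \<omega> \<inter> hbox (real n *\<^sub>R a) (real n *\<^sub>R b))) / real n < c * w + 1 / Suc k) sequentially"
    unfolding w_def by (rule iffD2[OF AE_all_countable], rule allI, rule lis_box_upper[OF good]) simp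
  ultimately show ?thesis
    unfolding w_def[symmetric]
  proof eventually_elim
    case (elim \<omega>)
    show ?case
    proof (rule order_tendstoI)
      fix y assume "y < c * w"
      moreover have "(\<lambda>k. (c - 1 / Suc k) * w - 1 / Suc k) \<longlonglongrightarrow> (c - 0) * w - 0"
        by (intro tendsto_intros LIMSEQ_Suc[OF lim_1_over_n])
      ultimately have "eventually (\<lambda>k. y < (c - 1 / Suc k) * w - 1 / Suc k) sequentially"
        by (intro order_tendstoD(1)) auto
      then obtain k where "y < (c - 1 / Suc k) * w - 1 / Suc k" by (auto simp: eventually_sequentially)
      then show "\<forall>\<^sub>F n in sequentially. y < real (lis (P \<omega> \<inter> hbox (real n *\<^sub>R a) (real n *\<^sub>R b))) / real n"
        using elim(1)[rule_format, of k] by (auto elim!: eventually_mono)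
    next
      fix y assume "c * w < y"
      moreover have "(\<lambda>k. c * w + 1 / Suc k) \<longlonglongrightarrow> c * w + 0"
        by (intro tendsto_intros LIMSEQ_Suc[OF lim_1_over_n])
      ultimately have "eventually (\<lambda>k. c * w + 1 / Suc k < y) sequentially"
        by (intro order_tendstoD(2)) auto
      then obtain k where "c * w + 1 / Suc k < y" by (auto simp: eventually_sequentially)
      then show "\<forall>\<^sub>F n in sequentially. real (lis (P \<omega> \<inter> hbox (real n *\<^sub>R a) (real n *\<^sub>R b))) / real n < y"
        using elim(2)[rule_format, of k] by (auto elim!: eventually_mono)
    qed
  qed
qed

end

section \<open>The hydrodynamic limit\<close>

lemma Basis_spacetime:
  "(Basis :: ((real^'d) \<times> real) set) = insert (0, 1) (range (\<lambda>i. (axis i 1, 0)))"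
  by (auto simp: Basis_prod_def Basis_vec_def)

lemma slt_iff_plt: "slt p q \<longleftrightarrow> plt p q"
  by (cases p; cases q) (auto simp: slt_def plt_def vlt_def Basis_spacetime inner_axis)

lemma mem_hbox_spacetime:
  fixes s t :: real
  shows "z \<in> hbox (y, s) (x, t) \<longleftrightarrow> vlt y (fst z) \<and> fst z \<le> x \<and> s < snd z \<and> snd z \<le> t"
  by (cases z) (auto simp: hbox_def vlt_def less_eq_vec_def Basis_spacetime inner_axis)

lemma prod_spacetime:
  fixes x y :: "real^'d"
  shows "(\<Prod>i\<in>Basis. (x, t) \<bullet> i - (y, s) \<bullet> i) = (t - s) * (\<Prod>i\<in>UNIV. x $ i - y $ i)"
proof -
  have "inj (\<lambda>i::'d. (axis i (1::real), 0::real))" by (auto simp: inj_on_def axis_eq_axis)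
  then show ?thesis
    unfolding Basis_spacetime by (subst prod.insert) (auto simp: prod.reindex inner_axis)
qed

lemma scaleR_One_spacetime: "s *\<^sub>R (\<Sum>Basis :: (real^'d) \<times> real) = (s *\<^sub>R (\<chi> i. 1), s)"
proof (rule euclidean_eqI)
  fix i :: "(real^'d) \<times> real" assume i: "i \<in> Basis"
  then have "(s *\<^sub>R (\<chi> i. 1), s) \<bullet> i = s" by (auto simp: Basis_spacetime inner_axis)
  then show "(s *\<^sub>R \<Sum>Basis) \<bullet> i = (s *\<^sub>R (\<chi> i. 1), s) \<bullet> i" using i by simp
qed

lemma Hpath_eq_lis: "Hpath P y x t = lis (P \<inter> hbox (y, 0) (x, t))"
  unfolding Hpath_def lis_def chain_in_def slt_iff_plt Int_iff mem_hbox_spacetime ..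

lemma abs_le_supnorm: "\<bar>x $ i\<bar> \<le> supnorm x"
  unfolding supnorm_def by (rule Max_ge) auto

lemma supnorm_nonneg: "0 \<le> supnorm x"
  using abs_le_supnorm[of x undefined] by linarith

lemma Hpath_mono:
  assumes fin: "\<And>B. bounded B \<Longrightarrow> finite (P \<inter> B)" and "y' \<le> y" "x \<le> x'"
  shows "Hpath P y x t \<le> Hpath P y' x' t"
  unfolding Hpath_eq_lis
proof (rule lis_mono[OF fin[OF bounded_hbox]])
  show "P \<inter> hbox (y, 0) (x, t) \<subseteq> P \<inter> hbox (y', 0) (x', t)"
    using assms(2,3) unfolding mem_hbox_spacetime subset_iff Int_iff vlt_def less_eq_vec_def
    by (meson le_less_trans order_trans)
qed

text \<open>Failures are united over \<open>j\<close> for fixed \<open>n\<close>; the geometric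
  weights make this union summable in \<open>n\<close>. One threshold on \<open>n\<close> then
  serves all \<open>j\<close> simultaneously.\<close>

lemma (in poisson_half_space) AE_eventually_all_no_chain:
  assumes good: "\<And>n j. n > 0 \<Longrightarrow> good_box (a n j) (b n j)"
    and p: "\<And>n j. n > 0 \<Longrightarrow> 1 - prob (no_chain (a n j) (b n j) (m n j)) \<le> (1/2) ^ n * (1/2) ^ j"
  shows "AE \<omega> in M. eventually (\<lambda>n::nat. \<forall>j::nat. lis (P \<omega> \<inter> hbox (a n j) (b n j)) < m n j) sequentially"
proof -
  define U where "U n = (\<Union>j. space M - no_chain (a (Suc n) j) (b (Suc n) j) (m (Suc n) j))" for n
  have Us: "U n \<in> events" for n unfolding U_def using sets_no_chain[OF good] by blast
  have Up: "prob (U n) \<le> (1/2) ^ n" for n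
  proof -
    have pj: "prob (space M - no_chain (a (Suc n) j) (b (Suc n) j) (m (Suc n) j)) \<le> (1/2) ^ Suc n * (1/2) ^ j" for j
      using p[of "Suc n" j] by (simp add: prob_compl[OF sets_no_chain[OF good]])
    have s: "summable (\<lambda>j. (1/2 :: real) ^ Suc n * (1/2) ^ j)" by (intro summable_mult summable_geometric) simp
    have s': "summable (\<lambda>j. prob (space M - no_chain (a (Suc n) j) (b (Suc n) j) (m (Suc n) j)))"
      by (rule summable_comparison_test'[OF s, where N=0]) (use pj in auto)
    have "prob (U n) \<le> (\<Sum>j. prob (space M - no_chain (a (Suc n) j) (b (Suc n) j) (m (Suc n) j)))"
      unfolding U_def by (rule finite_measure_subadditive_countably[OF _ s']) (use sets_no_chain[OF good] in auto)
    also have "\<dots> \<le> (\<Sum>j. (1/2 :: real) ^ Suc n * (1/2) ^ j)" by (rule suminf_le[OF pj s' s])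
    also have "\<dots> = (1/2) ^ n" by (subst suminf_mult) (auto simp: suminf_geometric)
    finally show ?thesis .
  qed
  have "summable (\<lambda>n. prob (U n))"
    by (rule summable_comparison_test'[OF summable_geometric[of "1/2 :: real"], where N=0]) (use Up in auto)
  then have "AE \<omega> in M. eventually (\<lambda>n. \<omega> \<in> space M - U n) sequentially"
    by (intro borel_cantelli_AE1 Us) (auto simp: emeasure_eq_measure)
  moreover have "AE \<omega> in M. \<forall>n j. \<omega> \<in> no_chain (a (Suc n) j) (b (Suc n) j) (m (Suc n) j)
      \<longleftrightarrow> lis (P \<omega> \<inter> hbox (a (Suc n) j) (b (Suc n) j)) < m (Suc n) j"
    unfolding AE_all_countable by (auto intro: AE_no_chain_iff good)
  ultimately show ?thesis
  proof eventually_elim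
    case (elim \<omega>)
    from elim(1) have "eventually (\<lambda>n. \<forall>j. lis (P \<omega> \<inter> hbox (a (Suc n) j) (b (Suc n) j)) < m (Suc n) j) sequentially"
      by (rule eventually_mono) (use elim(2) in \<open>auto simp: U_def\<close>)
    then show ?case by (rule eventually_sequentially_Suc[THEN iffD1])
  qed
qed

section \<open>Uniform control of chains from distant starting points\<close>

lemma bracket_by_powers_of_2:
  fixes z :: real
  assumes "1 \<le> z"
  obtains j :: nat where "2 ^ j \<le> z" "z \<le> 2 ^ Suc j"
proof -
  define j where "j = nat \<lfloor>log 2 z\<rfloor>"
  have "0 \<le> log 2 z" using assms by simp
  then have "real j \<le> log 2 z" "log 2 z < real j + 1" unfolding j_def by linarith+
  then have "2 ^ j \<le> z" "z \<le> 2 ^ Suc j"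
    using assms le_log_iff[of 2 z "real j"] log_less_iff[of 2 z "real j + 1"]
    by (auto simp: powr_realpow powr_add mult.commute)
  then show ?thesis using that by blast
qed

text \<open>All starting points in one dyadic shell share a single enclosing box, so countably many
  boxes suffice. Only the \<open>d\<close> spatial sides grow with the shell, not the height
  \<open>n * t\<close>; the \<open>(d+1)\<close>-st root of the volume therefore grows like
  \<open>supnorm y powr \<alpha>\<close>.\<close>

lemma far_field_bound:
  fixes P :: "'a \<Rightarrow> ((real^'d) \<times> real) set" and x :: "real^'d"
  assumes "poisson_half_space M P (0, 1)" and t: "t > 0"
  defines "\<alpha> \<equiv> real CARD('d) / (real CARD('d) + 1)"
  shows "\<exists>C K. C > 0 \<and> (AE \<omega> in M. eventually (\<lambda>n. \<forall>y\<le>x. K \<le> supnorm y \<longrightarrow>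
    real (Hpath (P \<omega>) (real n *\<^sub>R y) (real n *\<^sub>R x) (real n * t)) \<le> C * real n * supnorm y powr \<alpha>) sequentially)"
proof -
  interpret poisson_half_space M P "(0, 1)" by fact
  \<comment> \<open>A single scale dominating 1, \<open>t\<close> and \<open>supnorm x\<close>, used
    both as the unit of the shells and as the radius beyond which the bound holds.\<close>
  define \<rho> where "\<rho> = 1 + supnorm x + t"
  have \<rho>: "1 \<le> \<rho>" "t \<le> \<rho>" "supnorm x \<le> \<rho>" using t supnorm_nonneg[of x] by (auto simp: \<rho>_def)
  \<comment> \<open>Since \<open>q ^ (d + 1) = 2 ^ d\<close>, doubling the \<open>d\<close> spatial
    sides multiplies the side of the cube of equal volume by \<open>q\<close>.\<close>
  define q where "q = 2 powr \<alpha>"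
  have d: "real CARD('d) \<ge> 1" using zero_less_card_finite[where 'a='d] by linarith
  have \<alpha>: "1/2 \<le> \<alpha>" "\<alpha> \<le> 1" using d by (auto simp: \<alpha>_def field_simps)
  have q: "5/4 \<le> q"
  proof -
    have "5/4 \<le> sqrt 2" by (rule real_le_rsqrt) (simp add: power2_eq_square)
    also have "\<dots> = 2 powr (1/2)" by (simp add: powr_half_sqrt)
    also have "\<dots> \<le> q" unfolding q_def using \<alpha> by (intro powr_mono) auto
    finally show ?thesis .
  qed
  define s where "s n j = 2 * \<rho> * real n * q ^ j" for n j :: nat
  define m where "m n j = nat \<lceil>2 * exp 1 * s n j\<rceil>" for n j
  define a :: "nat \<Rightarrow> nat \<Rightarrow> (real^'d) \<times> real" where "a n j = ((\<chi> i. - (real n * \<rho> * 2 ^ j)), 0)" for n j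
  define b :: "nat \<Rightarrow> nat \<Rightarrow> (real^'d) \<times> real" where "b n j = ((\<chi> i. real n * \<rho>), real n * t)" for n j
  have good: "good_box (a n j) (b n j)" if "n > 0" for n j
  proof -
    have "- (real n * \<rho> * 2 ^ j) < 0" "0 < real n * \<rho>" using that \<rho> by auto
    then have "- (real n * \<rho> * 2 ^ j) < real n * \<rho>" by linarith
    then show ?thesis using that t unfolding good_box_def slt_iff_plt by (auto simp: plt_def vlt_def a_def b_def)
  qed
  have s0: "0 \<le> s n j" for n j using \<rho> q by (simp add: s_def)
  have vol: "(\<Prod>i\<in>Basis. b n j \<bullet> i - a n j \<bullet> i) \<le> s n j ^ DIM((real^'d) \<times> real)" for n j
  proof -
    have "q ^ (CARD('d) + 1) = 2 ^ CARD('d)"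
    proof -
      have "q ^ (CARD('d) + 1) = q powr (real CARD('d) + 1)"
        using q powr_realpow[of q "CARD('d) + 1"] by (simp add: add.commute)
      also have "\<dots> = 2 powr (real CARD('d))" unfolding q_def powr_powr \<alpha>_def using d by simp
      finally show ?thesis by (simp add: powr_realpow)
    qed
    then have qj: "(q ^ j) ^ (CARD('d) + 1) = (2 ^ j) ^ CARD('d)"
      by (metis mult.commute power_mult)
    have "(\<Prod>i\<in>Basis. b n j \<bullet> i - a n j \<bullet> i) = (real n * t) * (real n * \<rho> + real n * \<rho> * 2 ^ j) ^ CARD('d)"
      unfolding a_def b_def prod_spacetime by simp
    also have "\<dots> \<le> (real n * \<rho>) * (real n * \<rho> * 2 * 2 ^ j) ^ CARD('d)"
    proof (intro mult_mono power_mono)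
      have "real n * \<rho> * 1 \<le> real n * \<rho> * 2 ^ j" using \<rho> by (intro mult_left_mono) auto
      then show "real n * \<rho> + real n * \<rho> * 2 ^ j \<le> real n * \<rho> * 2 * 2 ^ j" by linarith
    qed (use \<rho> t in \<open>auto intro!: mult_left_mono\<close>)
    also have "\<dots> \<le> (2 * \<rho> * real n) * (real n * \<rho> * 2 * 2 ^ j) ^ CARD('d)"
      using \<rho> by (intro mult_right_mono) auto
    also have "\<dots> = (2 * \<rho> * real n) ^ (CARD('d) + 1) * (2 ^ j) ^ CARD('d)"
      by (simp add: power_mult_distrib mult_ac)
    also have "\<dots> = s n j ^ (CARD('d) + 1)" unfolding s_def power_mult_distrib qj ..
    finally show ?thesis by simp
  qed
  have tail: "1 - prob (no_chain (a n j) (b n j) (m n j)) \<le> (1/2) ^ n * (1/2) ^ j" if n: "n > 0" for n j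
  proof -
    have m1: "2 * exp 1 * s n j \<le> real (m n j)" unfolding m_def by linarith
    have "1 - prob (no_chain (a n j) (b n j) (m n j)) \<le> (1/2) ^ m n j"
      by (rule prob_long_chain[OF good[OF n] vol s0 m1])
    also have "\<dots> \<le> (1/2) ^ (n + j)"
    proof (rule power_decreasing)
      \<comment> \<open>The geometric growth in \<open>j\<close> is weakened to a linear one, which
        is enough for \<open>m n j \<ge> n + j\<close> and so for weights summable in both
        indices.\<close>
      have "1 + real j * (1/4) \<le> (1 + 1/4) ^ j" by (rule Bernoulli_inequality) simp
      also have "\<dots> \<le> q ^ j" using q by (intro power_mono) auto
      finally have "1 + real j / 4 \<le> q ^ j" by simp
      then have "real n * (1 + real j / 4) \<le> real n * q ^ j" by (intro mult_left_mono) auto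
      also have "\<dots> \<le> \<rho> * (real n * q ^ j)" using \<rho> q mult_right_mono[of 1 \<rho> "real n * q ^ j"] by simp
      finally have 1: "real n * (1 + real j / 4) \<le> \<rho> * (real n * q ^ j)" .
      have "(2::real) \<le> exp 1" using exp_ge_add_one_self[of 1] by simp
      then have "2 * 1 * s n j \<le> 2 * exp 1 * s n j" using s0[of n j] by (intro mult_right_mono) auto
      then have "4 * (\<rho> * (real n * q ^ j)) \<le> real (m n j)" using m1 by (simp add: s_def mult_ac)
      then have "4 * real n + real n * real j \<le> real (m n j)" using 1 by (simp add: algebra_simps)
      moreover have "1 * real j \<le> real n * real j" using n by (intro mult_right_mono) auto
      ultimately have "real n + real j \<le> real (m n j)" by simp
      then show "n + j \<le> m n j" by linarith
    qed auto
    finally show ?thesis by (simp add: power_add)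
  qed
  from AE_eventually_all_no_chain[OF good tail]
  have "AE \<omega> in M. eventually (\<lambda>n. \<forall>j. lis (P \<omega> \<inter> hbox (a n j) (b n j)) < m n j) sequentially" .
  with AE_locally_finite have "AE \<omega> in M. eventually (\<lambda>n. \<forall>y\<le>x. \<rho> \<le> supnorm y \<longrightarrow>
    real (Hpath (P \<omega>) (real n *\<^sub>R y) (real n *\<^sub>R x) (real n * t)) \<le> (4 * exp 1 * \<rho> * q) * real n * supnorm y powr \<alpha>) sequentially"
  proof eventually_elim
    case (elim \<omega>)
    from elim(2) show ?case
    proof (rule eventually_mono, intro allI impI)
      fix n y assume H: "\<forall>j. lis (P \<omega> \<inter> hbox (a n j) (b n j)) < m n j" and y: "y \<le> x" "\<rho> \<le> supnorm y"
      have "1 \<le> supnorm y / \<rho>" using y \<rho> by simp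
      then obtain j where j: "2 ^ j \<le> supnorm y / \<rho>" "supnorm y / \<rho> \<le> 2 ^ Suc j"
        by (rule bracket_by_powers_of_2)
      have yj: "supnorm y \<le> \<rho> * 2 ^ Suc j" using j(2) \<rho> by (simp add: field_simps)
      \<comment> \<open>The box of index \<open>Suc j\<close> is taken because points of shell
        \<open>j\<close> have coordinates down to \<open>- \<rho> * 2 ^ Suc j\<close>.\<close>
      have "Hpath (P \<omega>) (real n *\<^sub>R y) (real n *\<^sub>R x) (real n * t)
        \<le> Hpath (P \<omega>) (fst (a n (Suc j))) (fst (b n (Suc j))) (real n * t)"
      proof (rule Hpath_mono)
        have "- (\<rho> * 2 ^ Suc j) \<le> y $ i" for i using abs_le_supnorm[of y i] yj by linarith
        then have "real n * - (\<rho> * 2 ^ Suc j) \<le> real n * y $ i" for i by (intro mult_left_mono) auto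
        then show "fst (a n (Suc j)) \<le> real n *\<^sub>R y" by (auto simp: a_def less_eq_vec_def mult_ac)
        have "x $ i \<le> \<rho>" for i using abs_le_supnorm[of x i] \<rho> by linarith
        then show "real n *\<^sub>R x \<le> fst (b n (Suc j))" by (auto simp: b_def less_eq_vec_def intro: mult_left_mono)
      qed (use elim in blast)
      also have "\<dots> = lis (P \<omega> \<inter> hbox (a n (Suc j)) (b n (Suc j)))"
        unfolding Hpath_eq_lis by (simp add: a_def b_def)
      also have "\<dots> < m n (Suc j)" using H by blast
      finally have "real (Hpath (P \<omega>) (real n *\<^sub>R y) (real n *\<^sub>R x) (real n * t)) < 2 * exp 1 * s n (Suc j)"
        unfolding m_def less_nat_ceiling_iff .
      also have "\<dots> = (4 * exp 1 * \<rho> * q) * real n * q ^ j" by (simp add: s_def mult_ac)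
      also have "\<dots> \<le> (4 * exp 1 * \<rho> * q) * real n * supnorm y powr \<alpha>"
      proof (rule mult_left_mono)
        have "q ^ j = (2 ^ j) powr \<alpha>"
          unfolding q_def by (simp add: powr_realpow[symmetric] powr_powr mult.commute)
        also have "\<dots> \<le> supnorm y powr \<alpha>"
        proof (rule powr_mono2)
          have "supnorm y / \<rho> \<le> supnorm y" using \<rho> supnorm_nonneg[of y] mult_left_mono[of 1 \<rho> "supnorm y"]
            by (simp add: divide_le_eq)
          then show "2 ^ j \<le> supnorm y" using j by linarith
        qed (use \<alpha> in auto)
        finally show "q ^ j \<le> supnorm y powr \<alpha>" .
      qed (use \<rho> q in auto)
      finally show "real (Hpath (P \<omega>) (real n *\<^sub>R y) (real n *\<^sub>R x) (real n * t)) \<le> (4 * exp 1 * \<rho> * q) * real n * supnorm y powr \<alpha>"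
        by simp
    qed
  qed
  moreover have "4 * exp 1 * \<rho> * q > 0" using \<rho> q by simp
  ultimately show ?thesis by blast
qed

lemma ereal_scale_add: "ereal r * (s + ereal h) = ereal r * s + ereal (r * h)" if "r > 0" for s :: ereal
  using that by (cases s) (auto simp: distrib_left)

section \<open>The macroscopic growth function\<close>

text \<open>This is \<open>t * g (z / t)\<close> with the factor \<open>t\<close> drawn under the
  root: \<open>c\<close> times the \<open>(d+1)\<close>-st root of the volume of the spacetime box
  with sides \<open>z\<close> and \<open>t\<close>.\<close>

definition growth :: "real \<Rightarrow> real \<Rightarrow> real^'d \<Rightarrow> real" where
  "growth c t z = c * (t * (\<Prod>i\<in>UNIV. z $ i)) powr (1 / (real CARD('d) + 1))"

lemma scaled_gfun:
  fixes x y :: "real^'d"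
  assumes "t > 0" "y \<le> x"
  shows "ereal t * gfun c ((1 / t) *\<^sub>R (x - y)) = ereal (growth c t (x - y))"
proof -
  define d where "d = CARD('d)"
  define V where "V = (\<Prod>i\<in>UNIV. x $ i - y $ i)"
  have V: "V \<ge> 0" unfolding V_def using assms(2) by (intro prod_nonneg) (auto simp: less_eq_vec_def)
  have "(\<Prod>i\<in>UNIV. ((1 / t) *\<^sub>R (x - y)) $ i) = V / t ^ d"
    by (simp add: V_def d_def prod_dividef)
  moreover have "t * (V / t ^ d) powr (1 / (real d + 1)) = (t * V) powr (1 / (real d + 1))"
  proof -
    have "t = (t ^ Suc d) powr (1 / (real d + 1))"
      using assms(1) by (simp add: powr_realpow[symmetric] powr_powr add.commute del: power_Suc)
    then have "t * (V / t ^ d) powr (1 / (real d + 1)) = (t ^ Suc d) powr (1 / (real d + 1)) * (V / t ^ d) powr (1 / (real d + 1))"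
      by simp
    also have "\<dots> = (t ^ Suc d * (V / t ^ d)) powr (1 / (real d + 1))"
      using assms(1) V by (intro powr_mult[symmetric])
    also have "t ^ Suc d * (V / t ^ d) = t * V" using assms(1) by simp
    finally show ?thesis .
  qed
  moreover have "\<forall>i. 0 \<le> ((1 / t) *\<^sub>R (x - y)) $ i" using assms by (auto simp: less_eq_vec_def)
  ultimately show ?thesis
    by (simp add: gfun_def growth_def V_def[symmetric] d_def[symmetric] mult.left_commute)
qed

lemma continuous_on_growth:
  assumes "t > 0"
  shows "continuous_on {z::real^'d. \<forall>i. 0 \<le> z $ i} (growth c t)"
  unfolding growth_def
  by (intro continuous_intros continuous_on_powr') (use assms in \<open>auto intro!: mult_nonneg_nonneg prod_nonneg continuous_intros\<close>)

text \<open>The root need not be Lipschitz where a coordinate of \<open>z\<close> vanishes, so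
  uniform continuity on a compact box is used. The side \<open>R + 1\<close> leaves room for the
  added step, which is at most 1.\<close>

lemma growth_step:
  fixes c t R \<epsilon> :: real
  assumes "t > 0" "\<epsilon> > 0"
  obtains q :: nat where "\<And>z::real^'d. (\<And>i. 0 \<le> z $ i) \<Longrightarrow> (\<And>i. z $ i \<le> R) \<Longrightarrow>
    growth c t (z + (1 / real (Suc q)) *\<^sub>R (\<chi> i. 1)) \<le> growth c t z + \<epsilon>"
proof -
  let ?S = "cbox 0 (\<chi> i. R + 1) :: (real^'d) set"
  have S: "z \<in> ?S \<longleftrightarrow> (\<forall>i. 0 \<le> z $ i \<and> z $ i \<le> R + 1)" for z by (auto simp: mem_box_cart)
  have "uniformly_continuous_on ?S (growth c t)"
    by (intro compact_uniformly_continuous continuous_on_subset[OF continuous_on_growth[OF assms(1)]])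
      (auto simp: S)
  then obtain \<delta> where \<delta>: "\<delta> > 0" and uc: "\<And>z z'. z \<in> ?S \<Longrightarrow> z' \<in> ?S \<Longrightarrow> dist z' z < \<delta> \<Longrightarrow> dist (growth c t z') (growth c t z) < \<epsilon>"
    unfolding uniformly_continuous_on_def using assms(2) by metis
  define v where "v = norm ((\<chi> i. 1) :: real^'d)"
  have "(\<lambda>q. v / real q) \<longlonglongrightarrow> 0" by (rule lim_const_over_n)
  then have "eventually (\<lambda>q. v / real (Suc q) < \<delta>) sequentially"
    using \<delta> by (intro order_tendstoD(2)[OF LIMSEQ_Suc])
  then obtain q where q: "v / real (Suc q) < \<delta>" by (auto simp: eventually_sequentially)
  show thesis
  proof (rule that)
    fix z :: "real^'d" assume z: "\<And>i. 0 \<le> z $ i" "\<And>i. z $ i \<le> R"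
    have q1: "1 / real (Suc q) \<le> 1" "0 \<le> 1 / real (Suc q)" by auto
    have "z \<in> ?S" unfolding S using z by (smt (verit))
    moreover have "z + (1 / real (Suc q)) *\<^sub>R (\<chi> i. 1) \<in> ?S"
      unfolding S using z q1 by (auto intro: add_mono)
    moreover have "dist (z + (1 / real (Suc q)) *\<^sub>R (\<chi> i. 1)) z < \<delta>"
      using q by (simp add: dist_norm v_def)
    ultimately have "dist (growth c t (z + (1 / real (Suc q)) *\<^sub>R (\<chi> i. 1))) (growth c t z) < \<epsilon>" by (rule uc)
    then show "growth c t (z + (1 / real (Suc q)) *\<^sub>R (\<chi> i. 1)) \<le> growth c t z + \<epsilon>"
      by (simp add: dist_real_def)
  qed
qed


section \<open>Deterministic passage to the limit\<close>

lemma evolve_lower: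
  assumes "n > 0" "t > 0" "y \<le> x"
  shows "ereal (1 / real n) * \<sigma> (real n *\<^sub>R y) + ereal (real (Hpath P (real n *\<^sub>R y) (real n *\<^sub>R x) (real n * t)) / real n)
    \<le> ereal (1 / real n) * evolve \<sigma> P (real n *\<^sub>R x) (real n * t)"
proof -
  have "real n *\<^sub>R y \<le> real n *\<^sub>R x" using assms by (auto simp: less_eq_vec_def)
  then have "\<sigma> (real n *\<^sub>R y) + ereal (real (Hpath P (real n *\<^sub>R y) (real n *\<^sub>R x) (real n * t)))
      \<le> evolve \<sigma> P (real n *\<^sub>R x) (real n * t)"
    unfolding evolve_def using assms by (auto intro!: Sup_upper)
  then have "ereal (1 / real n) * (\<sigma> (real n *\<^sub>R y) + ereal (real (Hpath P (real n *\<^sub>R y) (real n *\<^sub>R x) (real n * t))))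
      \<le> ereal (1 / real n) * evolve \<sigma> P (real n *\<^sub>R x) (real n * t)"
    by (rule ereal_mult_left_mono) simp
  then show ?thesis using assms(1) by (simp add: ereal_scale_add)
qed

lemma evolve_upper:
  fixes x :: "real^'d"
  assumes "n > 0" "t > 0"
    and B: "\<And>y. y \<le> x \<Longrightarrow> ereal (1 / real n) * \<sigma> (real n *\<^sub>R y)
      + ereal (real (Hpath P (real n *\<^sub>R y) (real n *\<^sub>R x) (real n * t)) / real n) \<le> ereal B"
  shows "ereal (1 / real n) * evolve \<sigma> P (real n *\<^sub>R x) (real n * t) \<le> ereal B"
proof -
  have n: "ereal (real n) * (ereal (1 / real n) * z) = z" for z
    using assms(1) by (cases z) auto
  have "evolve \<sigma> P (real n *\<^sub>R x) (real n * t) \<le> ereal (real n * B)"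
    unfolding evolve_def
  proof (subst if_not_P)
    show "Sup {\<sigma> y + ereal (real (Hpath P y (real n *\<^sub>R x) (real n * t))) |y. y \<le> real n *\<^sub>R x} \<le> ereal (real n * B)"
    proof (rule Sup_least, safe)
      fix y' :: "real^'d" assume y': "y' \<le> real n *\<^sub>R x"
      define y where "y = (1 / real n) *\<^sub>R y'"
      have y'y: "y' = real n *\<^sub>R y" using assms(1) by (simp add: y_def)
      have "y \<le> x" using y' assms(1) by (auto simp: y'y less_eq_vec_def)
      from B[OF this] have "ereal (1 / real n) * (\<sigma> y' + ereal (real (Hpath P y' (real n *\<^sub>R x) (real n * t)))) \<le> ereal B"
        using assms(1) by (simp add: ereal_scale_add y'y)
      then have "ereal (real n) * (ereal (1 / real n) * (\<sigma> y' + ereal (real (Hpath P y' (real n *\<^sub>R x) (real n * t))))) \<le> ereal (real n) * ereal B"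
        by (rule ereal_mult_left_mono) simp
      then show "\<sigma> y' + ereal (real (Hpath P y' (real n *\<^sub>R x) (real n * t))) \<le> ereal (real n * B)"
        unfolding n by simp
    qed
  qed (use assms in simp)
  then have "ereal (1 / real n) * evolve \<sigma> P (real n *\<^sub>R x) (real n * t) \<le> ereal (1 / real n) * ereal (real n * B)"
    by (rule ereal_mult_left_mono) simp
  then show ?thesis using assms(1) by simp
qed

text \<open>This isolates what one fixed realisation must satisfy: limits at countably many starting
  points and one far-field bound. In the upper bound the two terms move in opposite directions,
  heights increasing and chain lengths decreasing in \<open>y\<close>, so they are compared at
  different corners of a mesh cell.\<close>

lemma evolve_limit:
  fixes P :: "((real^'d) \<times> real) set" and x :: "real^'d" and u0 :: "real^'d \<Rightarrow> real"
  assumes t: "t > 0"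
    and fin: "\<And>B. bounded B \<Longrightarrow> finite (P \<inter> B)"
    and mono: "\<And>n y y'. n > 0 \<Longrightarrow> y \<le> y' \<Longrightarrow> \<sigma> n y \<le> \<sigma> n y'"
    and Y: "\<And>k::nat. Y k \<le> x"
    and u_eq: "u = (SUP k. ereal (u0 (Y k) + growth c t (x - Y k)))"
    and u_ge: "\<And>y. y \<le> x \<Longrightarrow> ereal (u0 y + growth c t (x - y)) \<le> u"
    and Y_lim: "\<And>k. (\<lambda>n. ereal (1 / real n) * \<sigma> n (real n *\<^sub>R Y k)) \<longlonglongrightarrow> ereal (u0 (Y k))"
      "\<And>k. (\<lambda>n. real (Hpath P (real n *\<^sub>R Y k) (real n *\<^sub>R x) (real n * t)) / real n) \<longlonglongrightarrow> growth c t (x - Y k)"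
    and grid_lim: "\<And>(q::nat) (k::'d \<Rightarrow> nat). (\<lambda>n. ereal (1 / real n) * \<sigma> n (real n *\<^sub>R (x - (1 / real (Suc q)) *\<^sub>R (\<chi> i. real (k i)))))
        \<longlonglongrightarrow> ereal (u0 (x - (1 / real (Suc q)) *\<^sub>R (\<chi> i. real (k i))))"
      "\<And>(q::nat) (k::'d \<Rightarrow> nat). (\<lambda>n. real (Hpath P (real n *\<^sub>R (x - (1 / real (Suc q)) *\<^sub>R (\<chi> i. real (k i)))) (real n *\<^sub>R x) (real n * t)) / real n)
        \<longlonglongrightarrow> growth c t ((1 / real (Suc q)) *\<^sub>R (\<chi> i. real (k i)))"
    and far: "eventually (\<lambda>n. \<forall>y\<le>x. K \<le> supnorm y \<longrightarrow> ereal (1 / real n) * \<sigma> n (real n *\<^sub>R y)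
      + ereal (real (Hpath P (real n *\<^sub>R y) (real n *\<^sub>R x) (real n * t)) / real n) \<le> ereal (u0 x)) sequentially"
  shows "(\<lambda>n. ereal (1 / real n) * evolve (\<sigma> n) P (real n *\<^sub>R x) (real n * t)) \<longlonglongrightarrow> u"
proof (rule order_tendstoI)
  fix v assume "v < u"
  then obtain k where k: "v < ereal (u0 (Y k) + growth c t (x - Y k))" unfolding u_eq less_SUP_iff by auto
  have "(\<lambda>n. ereal (1 / real n) * \<sigma> n (real n *\<^sub>R Y k) + ereal (real (Hpath P (real n *\<^sub>R Y k) (real n *\<^sub>R x) (real n * t)) / real n))
      \<longlonglongrightarrow> ereal (u0 (Y k)) + ereal (growth c t (x - Y k))"
    by (rule tendsto_add_ereal) (use Y_lim in auto)
  then have "eventually (\<lambda>n. v < ereal (1 / real n) * \<sigma> n (real n *\<^sub>R Y k) + ereal (real (Hpath P (real n *\<^sub>R Y k) (real n *\<^sub>R x) (real n * t)) / real n)) sequentially"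
    using k by (intro order_tendstoD(1)) auto
  then show "\<forall>\<^sub>F n in sequentially. v < ereal (1 / real n) * evolve (\<sigma> n) P (real n *\<^sub>R x) (real n * t)"
    using eventually_gt_at_top[of 0]
    by eventually_elim (rule less_le_trans[OF _ evolve_lower[OF _ t Y]])
next
  fix v assume v: "u < v"
  \<comment> \<open>The starting point \<open>y = x\<close> gives growth 0, so \<open>u0 x\<close>
    is a lower bound for \<open>u\<close>; the far-field bound is therefore harmless.\<close>
  have u0x: "ereal (u0 x) \<le> u" using u_ge[of x] by (simp add: growth_def zero_power[OF zero_less_card_finite])
  then obtain u' where u': "u = ereal u'" using v by (cases u) auto
  obtain z where z: "u < ereal z" "ereal z < v" using ereal_dense2[OF v] by blast
  \<comment> \<open>One third each for the limit of the heights, the limit of the chain lengths and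
    the mesh of the grid.\<close>
  define \<epsilon> where "\<epsilon> = (z - u') / 3"
  have eps: "\<epsilon> > 0" "u' + 3 * \<epsilon> = z" using z u' by (auto simp: \<epsilon>_def field_simps)
  \<comment> \<open>Bounds all coordinates of \<open>x - y\<close> when
    \<open>supnorm y < K\<close>, so that finitely many grid indices suffice.\<close>
  define R where "R = supnorm x + max K 0"
  obtain q :: nat where q: "\<And>z::real^'d. (\<And>i. 0 \<le> z $ i) \<Longrightarrow> (\<And>i. z $ i \<le> R) \<Longrightarrow>
      growth c t (z + (1 / real (Suc q)) *\<^sub>R (\<chi> i. 1)) \<le> growth c t z + \<epsilon>"
    using growth_step[OF t eps(1)] by blast
  define \<delta> where "\<delta> = 1 / real (Suc q)"
  have \<delta>: "\<delta> > 0" by (simp add: \<delta>_def)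
  define Z where "Z k = x - \<delta> *\<^sub>R (\<chi> i. real (k i))" for k :: "'d \<Rightarrow> nat"
  define F where "F = (PiE UNIV (\<lambda>_. {..nat \<lfloor>R / \<delta>\<rfloor>}) :: ('d \<Rightarrow> nat) set)"
  have F: "finite F" unfolding F_def by (rule finite_PiE) auto
  have "eventually (\<lambda>n. \<forall>k\<in>F. ereal (1 / real n) * \<sigma> n (real n *\<^sub>R Z k) < ereal (u0 (Z k) + \<epsilon>)) sequentially"
    by (intro eventually_ball_finite F ballI order_tendstoD(2)[OF grid_lim(1)[of q, folded \<delta>_def, folded Z_def]]) (use eps in simp)
  moreover have "eventually (\<lambda>n. \<forall>k\<in>F. real (Hpath P (real n *\<^sub>R Z (\<lambda>i. Suc (k i))) (real n *\<^sub>R x) (real n * t)) / real n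
      < growth c t (\<delta> *\<^sub>R (\<chi> i. real (Suc (k i)))) + \<epsilon>) sequentially"
    by (intro eventually_ball_finite F ballI order_tendstoD(2)[OF grid_lim(2)[of q "\<lambda>i. Suc (_ i)", folded \<delta>_def, folded Z_def]]) (use eps in simp)
  ultimately show "\<forall>\<^sub>F n in sequentially. ereal (1 / real n) * evolve (\<sigma> n) P (real n *\<^sub>R x) (real n * t) < v"
    using far eventually_gt_at_top[of 0]
  proof eventually_elim
    case (elim n)
    have "ereal (1 / real n) * evolve (\<sigma> n) P (real n *\<^sub>R x) (real n * t) \<le> ereal z"
    proof (rule evolve_upper[OF elim(4) t])
      fix y assume y: "y \<le> x"
      show "ereal (1 / real n) * \<sigma> n (real n *\<^sub>R y)
        + ereal (real (Hpath P (real n *\<^sub>R y) (real n *\<^sub>R x) (real n * t)) / real n) \<le> ereal z"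
      proof (cases "K \<le> supnorm y")
        case True
        then show ?thesis using elim(3) y u0x z(1) by (meson less_imp_le order_trans)
      next
        case False
        \<comment> \<open>Rounding down places \<open>y\<close> in the mesh cell with upper corner
          \<open>Z k\<close> and lower corner \<open>Z (\<lambda>i. Suc (k i))\<close>; the former
          bounds the height, the latter the chain length.\<close>
        define k where "k i = nat \<lfloor>(x $ i - y $ i) / \<delta>\<rfloor>" for i
        have xy: "0 \<le> x $ i - y $ i" "x $ i - y $ i \<le> R" for i
          using y abs_le_supnorm[of x i] abs_le_supnorm[of y i] False by (auto simp: less_eq_vec_def R_def)
        have k1: "real (k i) \<le> (x $ i - y $ i) / \<delta>" "(x $ i - y $ i) / \<delta> \<le> real (k i) + 1" for i
        proof -
          have "0 \<le> (x $ i - y $ i) / \<delta>" using xy \<delta> by simp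
          then show "real (k i) \<le> (x $ i - y $ i) / \<delta>" "(x $ i - y $ i) / \<delta> \<le> real (k i) + 1"
            unfolding k_def by linarith+
        qed
        then have k2: "\<delta> * real (k i) \<le> x $ i - y $ i" "x $ i - y $ i \<le> \<delta> * (real (k i) + 1)" for i
          using \<delta> by (simp_all add: field_simps)
        have kF: "k \<in> F"
        proof -
          have "k i \<le> nat \<lfloor>R / \<delta>\<rfloor>" for i
            unfolding k_def using xy[of i] \<delta> by (intro nat_mono floor_mono divide_right_mono) auto
          then show ?thesis by (auto simp: F_def)
        qed
        have yZ: "y \<le> Z k" using k2(1) by (simp add: Z_def less_eq_vec_def algebra_simps)
        have Zx: "Z k \<le> x" using \<delta> by (simp add: Z_def less_eq_vec_def)
        have Zy: "Z (\<lambda>i. Suc (k i)) \<le> y" using k2(2) by (simp add: Z_def less_eq_vec_def algebra_simps)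
        have "\<sigma> n (real n *\<^sub>R y) \<le> \<sigma> n (real n *\<^sub>R Z k)"
          using yZ by (intro mono elim) (auto simp: less_eq_vec_def intro: mult_left_mono)
        then have "ereal (1 / real n) * \<sigma> n (real n *\<^sub>R y) \<le> ereal (1 / real n) * \<sigma> n (real n *\<^sub>R Z k)"
          by (rule ereal_mult_left_mono) simp
        also have "\<dots> \<le> ereal (u0 (Z k) + \<epsilon>)" using elim(1) kF by (auto intro: less_imp_le)
        finally have A: "ereal (1 / real n) * \<sigma> n (real n *\<^sub>R y) \<le> ereal (u0 (Z k) + \<epsilon>)" .
        have "Hpath P (real n *\<^sub>R y) (real n *\<^sub>R x) (real n * t) \<le> Hpath P (real n *\<^sub>R Z (\<lambda>i. Suc (k i))) (real n *\<^sub>R x) (real n * t)"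
          using Zy by (intro Hpath_mono fin) (auto simp: less_eq_vec_def intro: mult_left_mono)
        then have "real (Hpath P (real n *\<^sub>R y) (real n *\<^sub>R x) (real n * t)) / real n
            \<le> real (Hpath P (real n *\<^sub>R Z (\<lambda>i. Suc (k i))) (real n *\<^sub>R x) (real n * t)) / real n"
          by (intro divide_right_mono) auto
        also have "\<dots> \<le> growth c t (\<delta> *\<^sub>R (\<chi> i. real (Suc (k i)))) + \<epsilon>" using elim(2) kF by (auto intro: less_imp_le)
        \<comment> \<open>The lower corner differs from \<open>Z k\<close> by one mesh step in each
          coordinate; \<open>growth_step\<close> moves the growth term back to \<open>Z k\<close>,
          where the variational bound applies to both terms together.\<close>
        also have "\<delta> *\<^sub>R (\<chi> i. real (Suc (k i))) = (x - Z k) + (1 / real (Suc q)) *\<^sub>R (\<chi> i. 1)"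
          unfolding \<delta>_def[symmetric] by (simp add: Z_def vec_eq_iff algebra_simps)
        also have "growth c t \<dots> \<le> growth c t (x - Z k) + \<epsilon>"
        proof (rule q)
          fix i show "0 \<le> (x - Z k) $ i" using \<delta> by (simp add: Z_def)
          show "(x - Z k) $ i \<le> R" using k2(1)[of i] xy(2)[of i] by (simp add: Z_def)
        qed
        finally have B: "real (Hpath P (real n *\<^sub>R y) (real n *\<^sub>R x) (real n * t)) / real n \<le> growth c t (x - Z k) + 2 * \<epsilon>" by simp
        have "u0 (Z k) + growth c t (x - Z k) \<le> u'" using u_ge[OF Zx] u' by simp
        then have "(u0 (Z k) + \<epsilon>) + (growth c t (x - Z k) + 2 * \<epsilon>) \<le> z" using eps by linarith
        then have "ereal (u0 (Z k) + \<epsilon>) + ereal (growth c t (x - Z k) + 2 * \<epsilon>) \<le> ereal z" by simp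
        moreover have "ereal (1 / real n) * \<sigma> n (real n *\<^sub>R y)
          + ereal (real (Hpath P (real n *\<^sub>R y) (real n *\<^sub>R x) (real n * t)) / real n)
          \<le> ereal (u0 (Z k) + \<epsilon>) + ereal (growth c t (x - Z k) + 2 * \<epsilon>)"
          using A B by (intro add_mono) auto
        ultimately show ?thesis by (rule order_trans[rotated])
      qed
    qed
    then show ?case using z(2) by (rule le_less_trans)
  qed
qed

theorem theorem4p1:
  fixes M :: "'a measure"
    and P :: "'a \<Rightarrow> ((real^'d) \<times> real) set"
    and \<sigma>0 :: "nat \<Rightarrow> 'a \<Rightarrow> real^'d \<Rightarrow> ereal"
    and u0 :: "real^'d \<Rightarrow> real"
    and c :: real
  assumes dim: "CARD('d) \<ge> 2"
    and u0_mono: "\<forall>x y. x \<le> y \<longrightarrow> u0 x \<le> u0 y"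
    and u0_loclip: "\<forall>x. \<exists>e>0. \<exists>L. L-lipschitz_on (ball x e) u0"
    and u0_growth: "\<forall>b::real^'d. ((\<lambda>K::real. Sup {ereal (supnorm y powr (- real CARD('d) / (real CARD('d) + 1)) * u0 y)
                       | y. y \<le> b \<and> supnorm y \<ge> K}) \<longlongrightarrow> -\<infinity>) at_top"
    and prob: "prob_space M"
    and sigma_in: "\<forall>n\<ge>1. AE \<omega> in M. \<sigma>0 n \<omega> \<in> Sigma_space"
    and init_lim: "\<forall>y. AE \<omega> in M.
        ((\<lambda>n. ereal (1 / real n) * \<sigma>0 n \<omega> (real n *\<^sub>R y)) \<longlongrightarrow> ereal (u0 y)) sequentially"
    and init_bound: "\<forall>(b::real^'d) (C::real). C > 0 \<longrightarrow> (AE \<omega> in M. \<exists>K N::real. K > 0 \<and> N > 0 \<and>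
        (\<forall>(n::nat) y. 1 \<le> n \<and> real n \<ge> N \<and> y \<le> b \<and> supnorm y \<ge> K \<longrightarrow>
            \<sigma>0 n \<omega> (real n *\<^sub>R y) \<le> ereal (- C * real n * supnorm y powr (real CARD('d) / (real CARD('d) + 1)))))"
    and ppp: "poisson_process M P (UNIV \<times> {0<..})"
    and c_def: "AE \<omega> in M. ((\<lambda>n. real (Hpath (P \<omega>) 0 (real n *\<^sub>R (\<chi> i. 1)) (real n)) / real n)
                  \<longlongrightarrow> c) sequentially"
  shows "\<forall>x (t::real). t \<ge> 0 \<longrightarrow> (AE \<omega> in M.
     ((\<lambda>n. ereal (1 / real n) * evolve (\<sigma>0 n \<omega>) (P \<omega>) (real n *\<^sub>R x) (real n * t))
        \<longlongrightarrow> ufun c u0 x t) sequentially)"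
proof (intro allI impI)
  fix x :: "real^'d" and t :: real
  assume t0: "t \<ge> 0"
  show "AE \<omega> in M. ((\<lambda>n. ereal (1 / real n) * evolve (\<sigma>0 n \<omega>) (P \<omega>) (real n *\<^sub>R x) (real n * t))
        \<longlongrightarrow> ufun c u0 x t) sequentially"
  proof (cases "t = 0")
    case True
    then show ?thesis using init_lim by (simp add: evolve_def ufun_def)
  next
    case False
    with t0 have t: "t > 0" by simp
    have half_space: "UNIV \<times> {0<..} = {z :: (real^'d) \<times> real. 0 < z \<bullet> (0, 1)}" by auto
    have hs: "poisson_half_space M P (0, 1)"
      using prob ppp unfolding poisson_half_space_def poisson_half_space_axioms_def half_space
      by (simp add: Basis_spacetime)
    interpret chain_constant M P "(0, 1)" c
    proof (intro chain_constant.intro hs chain_constant_axioms.intro)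
      show "AE \<omega> in M. (\<lambda>n. real (lis (P \<omega> \<inter> hbox 0 (real n *\<^sub>R \<Sum>Basis))) / real n) \<longlonglongrightarrow> c"
        using c_def unfolding Hpath_eq_lis scaleR_One_spacetime zero_prod_def .
    qed
    have box_lim: "AE \<omega> in M. (\<lambda>n. real (Hpath (P \<omega>) (real n *\<^sub>R y) (real n *\<^sub>R x) (real n * t)) / real n)
        \<longlonglongrightarrow> growth c t (x - y)" if "y \<le> x" for y
    proof -
      have "AE \<omega> in M. (\<lambda>n. real (lis (P \<omega> \<inter> hbox (real n *\<^sub>R (y, 0)) (real n *\<^sub>R (x, t)))) / real n)
        \<longlonglongrightarrow> c * (\<Prod>i\<in>Basis. (x, t) \<bullet> i - (y, 0) \<bullet> i) powr (1 / DIM((real^'d) \<times> real))"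
        by (rule lis_box_tendsto) (use that t in \<open>auto simp: Basis_spacetime inner_axis less_eq_vec_def\<close>)
      then show ?thesis
        unfolding Hpath_eq_lis prod_spacetime growth_def by (simp add: add.commute)
    qed
    define A where "A = {ereal (u0 y + growth c t (x - y)) |y. y \<le> x}"
    have u: "ufun c u0 x t = Sup A"
    proof -
      have "{ereal (u0 y) + ereal t * gfun c ((1 / t) *\<^sub>R (x - y)) |y. y \<le> x} = A"
        unfolding A_def by (rule Collect_cong, rule ex_cong1) (auto simp: scaled_gfun[OF t])
      then show ?thesis using t by (simp add: ufun_def)
    qed
    have "A \<noteq> {}" by (auto simp: A_def)
    \<comment> \<open>The exceptional null set depends on the starting point, so the supremum must
      be realised along a sequence.\<close>
    from Sup_countable_SUP[OF this] obtain f :: "nat \<Rightarrow> ereal" where f: "range f \<subseteq> A" "Sup A = (SUP i. f i)" by auto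
    have "\<forall>k. \<exists>y\<le>x. f k = ereal (u0 y + growth c t (x - y))" using f(1) unfolding A_def by blast
    then obtain Y where Y: "\<And>k. Y k \<le> x" "\<And>k. f k = ereal (u0 (Y k) + growth c t (x - Y k))" by metis
    let ?Z = "\<lambda>(q::nat) (k::'d \<Rightarrow> nat). x - (1 / real (Suc q)) *\<^sub>R (\<chi> i. real (k i))"
    have Zx: "?Z q k \<le> x" for q k by (simp add: less_eq_vec_def)
    define \<alpha> where "\<alpha> = real CARD('d) / (real CARD('d) + 1)"
    obtain C K where C: "C > 0" and farH: "AE \<omega> in M. eventually (\<lambda>n. \<forall>y\<le>x. K \<le> supnorm y \<longrightarrow>
        real (Hpath (P \<omega>) (real n *\<^sub>R y) (real n *\<^sub>R x) (real n * t)) \<le> C * real n * supnorm y powr \<alpha>) sequentially"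
      using far_field_bound[OF hs t, of x] unfolding \<alpha>_def by blast
    \<comment> \<open>\<open>C\<close> cancels the chain bound; the surplus
      \<open>\<bar>u0 x\<bar>\<close> brings the sum below \<open>u0 x\<close>, because
      \<open>supnorm y powr \<alpha> \<ge> 1\<close> in the far field.\<close>
    define C' where "C' = C + \<bar>u0 x\<bar>"
    have "C' > 0" using C by (simp add: C'_def)
    then have farS: "AE \<omega> in M. \<exists>K N::real. K > 0 \<and> N > 0 \<and>
        (\<forall>(n::nat) y. 1 \<le> n \<and> real n \<ge> N \<and> y \<le> x \<and> supnorm y \<ge> K \<longrightarrow>
            \<sigma>0 n \<omega> (real n *\<^sub>R y) \<le> ereal (- C' * real n * supnorm y powr \<alpha>))"
      unfolding \<alpha>_def using init_bound by blast
    have "AE \<omega> in M. \<forall>n. n \<ge> 1 \<longrightarrow> \<sigma>0 n \<omega> \<in> Sigma_space"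
      unfolding AE_all_countable using sigma_in by auto
    moreover have "AE \<omega> in M. \<forall>k. (\<lambda>n. ereal (1 / real n) * \<sigma>0 n \<omega> (real n *\<^sub>R Y k)) \<longlonglongrightarrow> ereal (u0 (Y k))"
      unfolding AE_all_countable using init_lim by blast
    moreover have "AE \<omega> in M. \<forall>k. (\<lambda>n. real (Hpath (P \<omega>) (real n *\<^sub>R Y k) (real n *\<^sub>R x) (real n * t)) / real n) \<longlonglongrightarrow> growth c t (x - Y k)"
      unfolding AE_all_countable using box_lim Y by blast
    \<comment> \<open>The type \<open>'d \<Rightarrow> nat\<close> is countable because
      \<open>'d\<close> is finite, so all grids together still cost only one null set.\<close>
    moreover have "AE \<omega> in M. \<forall>q k. (\<lambda>n. ereal (1 / real n) * \<sigma>0 n \<omega> (real n *\<^sub>R ?Z q k)) \<longlonglongrightarrow> ereal (u0 (?Z q k))"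
      unfolding AE_all_countable using init_lim by blast
    moreover have "AE \<omega> in M. \<forall>q k. (\<lambda>n. real (Hpath (P \<omega>) (real n *\<^sub>R ?Z q k) (real n *\<^sub>R x) (real n * t)) / real n) \<longlonglongrightarrow> growth c t (x - ?Z q k)"
      unfolding AE_all_countable using box_lim[OF Zx] by blast
    ultimately show ?thesis
      using farH farS AE_locally_finite
    proof eventually_elim
      case (elim \<omega>)
      obtain K' N where K': "K' > 0" and N: "\<And>n y. 1 \<le> n \<Longrightarrow> real n \<ge> N \<Longrightarrow> y \<le> x \<Longrightarrow> supnorm y \<ge> K' \<Longrightarrow>
          \<sigma>0 n \<omega> (real n *\<^sub>R y) \<le> ereal (- C' * real n * supnorm y powr \<alpha>)"
        using elim(7) by blast
      show ?case
      \<comment> \<open>The entry 1 in the maximum ensures that the power of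
        \<open>supnorm y\<close> is at least 1.\<close>
      proof (rule evolve_limit[OF t, where Y = Y and K = "max 1 (max K K')"])
        show "\<sigma>0 n \<omega> y \<le> \<sigma>0 n \<omega> y'" if "n > 0" "y \<le> y'" for n y y'
          using elim(1) that by (auto simp: Sigma_space_def)
        show "ufun c u0 x t = (SUP k. ereal (u0 (Y k) + growth c t (x - Y k)))"
          unfolding u f(2) Y(2) ..
        show "ereal (u0 y + growth c t (x - y)) \<le> ufun c u0 x t" if "y \<le> x" for y
          unfolding u A_def using that by (intro Sup_upper) blast
        show "(\<lambda>n. real (Hpath (P \<omega>) (real n *\<^sub>R ?Z q k) (real n *\<^sub>R x) (real n * t)) / real n)
            \<longlonglongrightarrow> growth c t ((1 / real (Suc q)) *\<^sub>R (\<chi> i. real (k i)))" for q k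
          using elim(5)[rule_format, of q k] by simp
        have "eventually (\<lambda>n. N \<le> real n) sequentially"
          using filterlim_real_sequentially by (auto simp: filterlim_at_top)
        with elim(6) show "\<forall>\<^sub>F n in sequentially. \<forall>y\<le>x. max 1 (max K K') \<le> supnorm y \<longrightarrow>
            ereal (1 / real n) * \<sigma>0 n \<omega> (real n *\<^sub>R y)
            + ereal (real (Hpath (P \<omega>) (real n *\<^sub>R y) (real n *\<^sub>R x) (real n * t)) / real n) \<le> ereal (u0 x)"
          using eventually_gt_at_top[of 0]
        proof eventually_elim
          case (elim n)
          show ?case
          proof (intro allI impI)
            fix y assume y: "y \<le> x" "max 1 (max K K') \<le> supnorm y"
            let ?s = "supnorm y powr \<alpha>"
            have s1: "1 \<le> ?s" using y by (intro ge_one_powr_ge_zero) (auto simp: \<alpha>_def)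
            have "\<sigma>0 n \<omega> (real n *\<^sub>R y) \<le> ereal (- C' * real n * ?s)" using N elim y by auto
            then have "ereal (1 / real n) * \<sigma>0 n \<omega> (real n *\<^sub>R y) \<le> ereal (1 / real n) * ereal (- C' * real n * ?s)"
              by (rule ereal_mult_left_mono) simp
            also have "\<dots> = ereal (- C' * ?s)" using elim by simp
            finally have 1: "ereal (1 / real n) * \<sigma>0 n \<omega> (real n *\<^sub>R y) \<le> ereal (- C' * ?s)" .
            have "real (Hpath (P \<omega>) (real n *\<^sub>R y) (real n *\<^sub>R x) (real n * t)) \<le> C * real n * ?s"
              using elim(1) y by auto
            then have "real (Hpath (P \<omega>) (real n *\<^sub>R y) (real n *\<^sub>R x) (real n * t)) / real n \<le> C * ?s"
              using elim(3) by (simp add: divide_le_eq mult_ac)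
            with 1 have "ereal (1 / real n) * \<sigma>0 n \<omega> (real n *\<^sub>R y)
              + ereal (real (Hpath (P \<omega>) (real n *\<^sub>R y) (real n *\<^sub>R x) (real n * t)) / real n) \<le> ereal (- C' * ?s) + ereal (C * ?s)"
              by (intro add_mono) auto
            also have "\<dots> = ereal (- (\<bar>u0 x\<bar> * ?s))" by (simp add: C'_def algebra_simps)
            also have "\<dots> \<le> ereal (u0 x)"
              using mult_left_mono[OF s1, of "\<bar>u0 x\<bar>"] by simp
            finally show "ereal (1 / real n) * \<sigma>0 n \<omega> (real n *\<^sub>R y)
              + ereal (real (Hpath (P \<omega>) (real n *\<^sub>R y) (real n *\<^sub>R x) (real n * t)) / real n) \<le> ereal (u0 x)" .
          qed
        qed
      qed (use elim Y in auto)
    qed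
  qed
qed

end
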